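(* Let $l_0,l_1,l_2,l_3\in\mathbb Z_{\ge 0}$, $r_1,\dots,r_M\in\mathbb Z_{>0}$, and assume that all the regular singular points $z=b_{i'}$ ($i'=1,\dots,M$) of the Fuchsian equation (F) described in the context are apparent. Set $\tilde l_0=l_0+\sum_{i'=1}^M r_{i'}$ and $\tilde l_i=l_i$ ($i=1,2,3$). The function $$\Lambda_g(x)=\Psi_g(x)\sqrt{\Xi (x)}\exp \int \frac{ \sqrt{-Q}\,dx}{\Xi (x)}$$ is expressed as $$\text{(a)}\quad \Lambda _g (x) = \exp \left( \kappa x \right) \left( \sum _{i=0}^3 \sum_{j=0}^{\tilde{l}_i-1} \tilde{b} ^{(i)}_j \left( \frac{d}{dx} \right) ^{j} \Phi _i(x, \alpha ) \right)$$ for some values $\alpha\in\mathbb C\setminus(2\omega_1\mathbb Z\oplus 2\omega_3\mathbb Z)$, $\kappa$ and $\tilde b^{(i)}_j$ ($i=0,\dots,3$, $j=0,\dots,\tilde l_i-1$), or $$\text{(b)}\quad \Lambda _g (x) = \exp \left( \bar{\kappa } x \right) \left( \bar{c} +\sum _{i=0}^3 \sum_{j=0}^{\tilde{l}_i-2} \bar{b} ^{(i)}_j \left( \frac{d}{dx} \right) ^{j} \wp (x+\omega _i) +\sum_{i=1}^3 \bar{c}_i \frac{\wp '(x)}{\wp (x)-e_i} \right)$$ for some values $\bar\kappa$, $\bar c$, $\bar c_i$ ($i=1,2,3$) and $\bar b^{(i)}_j$ ($i=0,\dots,3$, $j=0,\dots,\tilde l_i-2$). If $\Lambda_g$ is expressed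 as in (a), then $$\Lambda _g (x+2\omega _j) = \exp (-2\eta _j \alpha +2\omega _j \zeta (\alpha ) +2 \kappa \omega _j ) \Lambda _g (x) \quad (j=1,3);$$ otherwise (expression (b)) $$\Lambda _g (x+2\omega _j) = \exp (2 \bar{\kappa } \omega _j ) \Lambda _g (x) \quad (j=1,3).$$
   Context: Fix $\omega_1,\omega_3\in\mathbb C$ linearly independent over $\mathbb R$; put $\omega_0=0$, $\omega_2=-\omega_1-\omega_3$. Let $\wp,\sigma,\zeta$ be the Weierstrass functions with periods $(2\omega_1,2\omega_3)$, $e_i=\wp(\omega_i)$, $\eta_i=\zeta(\omega_i)$ ($i=1,2,3$). "Doubly-periodic" means meromorphic on $\mathbb C$ with periods $2\omega_1,2\omega_3$. Let $$\Phi_i(x,\alpha)=\frac{\sigma(x+\omega_i-\alpha)}{\sigma(x+\omega_i)}\exp(\zeta(\alpha)x)\quad(i=0,1,2,3).$$ Let $M\ge 0$ be an integer, $\delta_1,\dots,\delta_M\in\mathbb C$ with $b_{i'}=\wp(\delta_{i'})$ finite and $e_1,e_2,e_3,b_1,\dots,b_M$ pairwise distinct, and $s_1,\dots,s_M,E\in\mathbb C$. Set $$v(x)=\sum_{i=0}^3 l_i(l_i+1)\wp (x+\omega_i)+ \sum_{i'=1}^M \left\{\frac{r_{i'}}{2} \left( \frac{r_{i'}}{2}+1\right) (\wp (x-\delta _{i'}) + \wp (x+\delta _{i'})) +\frac{s_{i'}}{\wp (x) -\wp (\delta _{i'})}\right\}.$$ (F) is the Fuchsian equation for $\tilde f(z)$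 obtained from $-f''+vf=Ef$ by $z=\wp(x)$, $f(x)=\tilde f(z)\Phi(z)$, $\Phi(z)=\prod_{i=1}^3(z-e_i)^{-l_i/2}\prod_{i'=1}^M(z-b_{i'})^{-r_{i'}/2}$; its singular points are $e_1,e_2,e_3,b_1,\dots,b_M,\infty$ and its exponents at $z=b_{i'}$ are $0$ and $r_{i'}+1$. A regular singular point is apparent if its exponents are integers and there is no logarithmic solution there (equivalently, the local monodromy matrix is the identity). $\Psi_g(x)=\prod_{i'=1}^M(\wp(x)-\wp(\delta_{i'}))^{r_{i'}/2}$. $\Xi(x)$ denotes a non-zero even doubly-periodic solution of $\Xi'''-4(v-E)\Xi'-2v'\Xi=0$ of the form $$\Xi (x)=c_0+\sum_{i=0}^3 \sum_{j=0}^{l_i-1} b^{(i)}_j \wp (x+\omega_i)^{l_i-j} + \sum _{i'=1}^M \sum_{j=0}^{r_{i'}-1} \frac{d^{(i')}_j}{(\wp (x)-\wp (\delta _{i'}))^{r_{i'} -j}}$$ (such a solution exists under the stated assumptions), and $Q=\Xi^2(E-v)+\frac12\Xi\,\Xi''-\frac14(\Xi')^2$, which is independent of $x$. The function $\Lambda_g$ is single-valued and meromorphic on $\mathbb C$. *)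

theory Defs
  imports "HOL-Complex_Analysis.Complex_Analysis"
begin

section \<open>Apparent singularities of second order linear equations\<close>

text \<open>
  The equation is \<open>y'' + p y' + q y = 0\<close>, represented by its coefficients \<open>p\<close> and \<open>q\<close>.
\<close>

definition ode_solution ::
  "(complex \<Rightarrow> complex) \<Rightarrow> (complex \<Rightarrow> complex) \<Rightarrow> complex set \<Rightarrow> (complex \<Rightarrow> complex) \<Rightarrow> bool" where
  "ode_solution p q U y \<longleftrightarrow>
     y holomorphic_on U \<and> (\<forall>z\<in>U. (deriv ^^ 2) y z + p z * deriv y z + q z * y z = 0)"

definition regular_singular_point ::
  "(complex \<Rightarrow> complex) \<Rightarrow> (complex \<Rightarrow> complex) \<Rightarrow> complex \<Rightarrow> bool" where
  "regular_singular_point p q b \<longleftrightarrow>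
     isolated_singularity_at p b \<and> isolated_singularity_at q b \<and>
     (is_pole p b \<or> is_pole q b) \<and>
     (\<exists>p0. (\<lambda>z. (z - b) * p z) \<midarrow>b\<rightarrow> p0) \<and>
     (\<exists>q0. (\<lambda>z. (z - b)^2 * q z) \<midarrow>b\<rightarrow> q0)"

definition exponents ::
  "(complex \<Rightarrow> complex) \<Rightarrow> (complex \<Rightarrow> complex) \<Rightarrow> complex \<Rightarrow> complex set" where
  "exponents p q b =
     {\<rho>. \<rho> * (\<rho> - 1) + Lim (at b) (\<lambda>z. (z - b) * p z) * \<rho> + Lim (at b) (\<lambda>z. (z - b)^2 * q z) = 0}"

text \<open>
  A logarithmic solution is one of the form \<open>A(z) log(z - b) + B(z)\<close> with \<open>A\<close>, \<open>B\<close>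
  single-valued near \<open>b\<close> and \<open>A\<close> not identically zero. The principal branch of the
  logarithm is used on the slit disc; another branch only changes \<open>B\<close> by a multiple of \<open>A\<close>.
\<close>

definition has_logarithmic_solution ::
  "(complex \<Rightarrow> complex) \<Rightarrow> (complex \<Rightarrow> complex) \<Rightarrow> complex \<Rightarrow> bool" where
  "has_logarithmic_solution p q b \<longleftrightarrow>
     (\<exists>\<epsilon>>0. \<exists>A B.
        A holomorphic_on (ball b \<epsilon> - {b}) \<and> B holomorphic_on (ball b \<epsilon> - {b}) \<and>
        (\<exists>z\<in>ball b \<epsilon> - {b}. A z \<noteq> 0) \<and>
        ode_solution p q {z \<in> ball b \<epsilon>. z - b \<notin> \<real>\<^sub>\<le>\<^sub>0} (\<lambda>z. A z * Ln (z - b) + B z))"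

definition apparent_singularity ::
  "(complex \<Rightarrow> complex) \<Rightarrow> (complex \<Rightarrow> complex) \<Rightarrow> complex \<Rightarrow> bool" where
  "apparent_singularity p q b \<longleftrightarrow>
     regular_singular_point p q b \<and> exponents p q b \<subseteq> \<int> \<and> \<not> has_logarithmic_solution p q b"


section \<open>Weierstrass functions\<close>

context
  fixes \<omega>\<^sub>1 \<omega>\<^sub>3 :: complex
begin

definition lattice :: "complex set" where
  "lattice = {2 * of_int m * \<omega>\<^sub>1 + 2 * of_int n * \<omega>\<^sub>3 | m n :: int. True}"

text \<open>
  The values of \<open>wp\<close> and \<open>wzeta\<close> at lattice points carry no meaning (\<open>1 / 0 = 0\<close>);
  everything below is evaluated away from the poles.
\<close>

definition wp :: "complex \<Rightarrow> complex" where
  "wp z = 1 / z^2 + (\<Sum>\<^sub>\<infinity>w\<in>lattice - {0}. 1 / (z - w)^2 - 1 / w^2)"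

definition wzeta :: "complex \<Rightarrow> complex" where
  "wzeta z = 1 / z + (\<Sum>\<^sub>\<infinity>w\<in>lattice - {0}. 1 / (z - w) + 1 / w + z / w^2)"

definition wsigma :: "complex \<Rightarrow> complex" where
  "wsigma z = z * Lim (finite_subsets_at_top (lattice - {0}))
     (\<lambda>F. \<Prod>w\<in>F. (1 - z / w) * exp (z / w + z^2 / (2 * w^2)))"

definition \<omega> :: "nat \<Rightarrow> complex" where
  "\<omega> i = (if i = 0 then 0 else if i = 1 then \<omega>\<^sub>1 else if i = 2 then - \<omega>\<^sub>1 - \<omega>\<^sub>3 else \<omega>\<^sub>3)"

definition e :: "nat \<Rightarrow> complex" where
  "e i = wp (\<omega> i)"

definition \<eta> :: "nat \<Rightarrow> complex" where
  "\<eta> i = wzeta (\<omega> i)"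

definition \<Phi> :: "nat \<Rightarrow> complex \<Rightarrow> complex \<Rightarrow> complex" where
  "\<Phi> i x \<alpha> = wsigma (x + \<omega> i - \<alpha>) / wsigma (x + \<omega> i) * exp (wzeta \<alpha> * x)"

text \<open>
  Requiring \<open>nicely_meromorphic_on\<close> rather than \<open>meromorphic_on\<close> pins down the values at
  removable singularities and at poles, so that identities may be stated pointwise.
\<close>

definition doubly_periodic :: "(complex \<Rightarrow> complex) \<Rightarrow> bool" where
  "doubly_periodic f \<longleftrightarrow>
     f nicely_meromorphic_on UNIV \<and> (\<forall>x. f (x + 2 * \<omega>\<^sub>1) = f x \<and> f (x + 2 * \<omega>\<^sub>3) = f x)"

definition half_periods :: "complex set" where
  "half_periods = {x. 2 * x \<in> lattice}"


section \<open>The potential and the Fuchsian equation\<close>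

context
  fixes l :: "nat \<Rightarrow> nat" and M :: nat and \<delta> :: "nat \<Rightarrow> complex"
    and r :: "nat \<Rightarrow> nat" and s :: "nat \<Rightarrow> complex"
begin

definition potential :: "complex \<Rightarrow> complex" where
  "potential x =
     (\<Sum>i=0..3. of_nat (l i) * (of_nat (l i) + 1) * wp (x + \<omega> i)) +
     (\<Sum>k=1..M. of_nat (r k) / 2 * (of_nat (r k) / 2 + 1) * (wp (x - \<delta> k) + wp (x + \<delta> k)) +
        s k / (wp x - wp (\<delta> k)))"

text \<open>Contains all poles of the potential.\<close>

definition singular_set :: "complex set" where
  "singular_set = half_periods \<union> {x. \<exists>k\<in>{1..M}. x - \<delta> k \<in> lattice \<or> x + \<delta> k \<in> lattice}"

text \<open>
  Put \<open>z = wp x\<close> and \<open>P(z) = 4 (z - e\<^sub>1) (z - e\<^sub>2) (z - e\<^sub>3)\<close>, so that \<open>(wp' x)\<^sup>2 = P(z)\<close> and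
  \<open>wp'' x = P'(z) / 2\<close>. The potential becomes a rational function of \<open>z\<close> by the classical
  formulas, with \<open>{i, j, k} = {1, 2, 3}\<close> and \<open>b = wp \<delta>\<close>:
  \<open>wp (x + \<omega>\<^sub>i) = e\<^sub>i + (e\<^sub>i - e\<^sub>j) (e\<^sub>i - e\<^sub>k) / (z - e\<^sub>i)\<close>, and
  \<open>wp (x - \<delta>) + wp (x + \<delta>) = P(b) / (z - b)\<^sup>2 + (P'(b) / 2) / (z - b) + 2 b\<close>.
\<close>

definition cubic :: "complex \<Rightarrow> complex" where
  "cubic z = 4 * (\<Prod>i=1..3. z - e i)"

definition rational_potential :: "complex \<Rightarrow> complex" where
  "rational_potential z =
     of_nat (l 0) * (of_nat (l 0) + 1) * z +
     (\<Sum>i=1..3. of_nat (l i) * (of_nat (l i) + 1) *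
        (e i + (\<Prod>j\<in>{1..3} - {i}. e i - e j) / (z - e i))) +
     (\<Sum>k=1..M. let b = wp (\<delta> k) in
        of_nat (r k) / 2 * (of_nat (r k) / 2 + 1) *
          (cubic b / (z - b)^2 + deriv cubic b / 2 / (z - b) + 2 * b) +
        s k / (z - b))"

text \<open>
  The logarithmic derivative of the gauge factor
  \<open>\<Prod>\<^sub>i (z - e\<^sub>i) powr (- l\<^sub>i / 2) * \<Prod>\<^sub>k (z - b\<^sub>k) powr (- r\<^sub>k / 2)\<close>,
  which is a rational function although the factor itself is multivalued.
\<close>

definition gauge_log_deriv :: "complex \<Rightarrow> complex" where
  "gauge_log_deriv z =
     - (\<Sum>i=1..3. of_nat (l i) / 2 / (z - e i)) - (\<Sum>k=1..M. of_nat (r k) / 2 / (z - wp (\<delta> k)))"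

text \<open>
  Substituting \<open>f(x) = y(z) g(z)\<close> with \<open>g' = L g\<close> into \<open>- f'' + v f = E f\<close> yields
  \<open>P (y'' + 2 L y' + (L' + L\<^sup>2) y) + (P' / 2) (y' + L y) - (v - E) y = 0\<close>.
  Dividing by \<open>P\<close> and using \<open>P' / (2 P) = \<Sum>\<^sub>i (1/2) / (z - e\<^sub>i)\<close> gives
  \<open>y'' + fuchs_p y' + fuchs_q y = 0\<close> with the following coefficients.
\<close>

definition fuchs_p :: "complex \<Rightarrow> complex" where
  "fuchs_p z = 2 * gauge_log_deriv z + (\<Sum>i=1..3. (1 / 2) / (z - e i))"

definition fuchs_q :: "complex \<Rightarrow> complex \<Rightarrow> complex" where
  "fuchs_q E z = deriv gauge_log_deriv z + (gauge_log_deriv z)^2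
     + (\<Sum>i=1..3. (1 / 2) / (z - e i)) * gauge_log_deriv z
     - (rational_potential z - E) / cubic z"


section \<open>The functions \<open>\<Xi>\<close> and \<open>\<Lambda>\<^sub>g\<close>\<close>

definition is_\<Xi> :: "complex \<Rightarrow> (complex \<Rightarrow> complex) \<Rightarrow> bool" where
  "is_\<Xi> E \<Xi> \<longleftrightarrow>
     doubly_periodic \<Xi> \<and> (\<forall>x. \<Xi> (- x) = \<Xi> x) \<and> (\<exists>x. \<Xi> x \<noteq> 0) \<and>
     (\<forall>x. x \<notin> singular_set \<longrightarrow>
        (deriv ^^ 3) \<Xi> x - 4 * (potential x - E) * deriv \<Xi> x - 2 * deriv potential x * \<Xi> x = 0) \<and>
     (\<exists>c0 b d. \<forall>x. x \<notin> singular_set \<longrightarrow>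
        \<Xi> x = c0 + (\<Sum>i=0..3. \<Sum>j<l i. b i j * wp (x + \<omega> i) ^ (l i - j)) +
          (\<Sum>k=1..M. \<Sum>j<r k. d k j / (wp x - wp (\<delta> k)) ^ (r k - j)))"

definition Q_expr :: "complex \<Rightarrow> (complex \<Rightarrow> complex) \<Rightarrow> complex \<Rightarrow> complex" where
  "Q_expr E \<Xi> x =
     (\<Xi> x)^2 * (E - potential x) + 1 / 2 * \<Xi> x * (deriv ^^ 2) \<Xi> x - 1 / 4 * (deriv \<Xi> x)^2"

text \<open>
  \<open>\<Psi>\<^sub>g sqrt(\<Xi>) exp (\<integral> sqrt(-Q) / \<Xi>)\<close> is multivalued a priori. \<open>is_\<Lambda>\<^sub>g Q \<Xi> \<Lambda>\<close> says that \<open>\<Lambda>\<close> is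
  a single-valued meromorphic function on the plane which, on some disc, is given by this
  expression for some choice of the branches \<open>\<psi>\<close> of \<open>\<Psi>\<^sub>g\<close> and \<open>\<rho>\<close> of \<open>sqrt(\<Xi>)\<close>, of the square
  root \<open>q\<close> of \<open>-Q\<close>, and of the primitive \<open>I\<close>. By analytic continuation it then agrees with
  the expression everywhere.
\<close>

definition is_\<Lambda>\<^sub>g :: "complex \<Rightarrow> (complex \<Rightarrow> complex) \<Rightarrow> (complex \<Rightarrow> complex) \<Rightarrow> bool" where
  "is_\<Lambda>\<^sub>g Q \<Xi> \<Lambda> \<longleftrightarrow>
     \<Lambda> nicely_meromorphic_on UNIV \<and>
     (\<exists>x0 \<epsilon> \<psi> \<rho> q I. \<epsilon> > 0 \<and> ball x0 \<epsilon> \<inter> singular_set = {} \<and>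
        (\<forall>x\<in>ball x0 \<epsilon>. \<Xi> x \<noteq> 0) \<and>
        \<psi> holomorphic_on ball x0 \<epsilon> \<and>
        (\<forall>x\<in>ball x0 \<epsilon>. (\<psi> x)^2 = (\<Prod>k=1..M. (wp x - wp (\<delta> k)) ^ r k)) \<and>
        \<rho> holomorphic_on ball x0 \<epsilon> \<and> (\<forall>x\<in>ball x0 \<epsilon>. (\<rho> x)^2 = \<Xi> x) \<and>
        q^2 = - Q \<and>
        (\<forall>x\<in>ball x0 \<epsilon>. (I has_field_derivative q / \<Xi> x) (at x)) \<and>
        (\<forall>x\<in>ball x0 \<epsilon>. \<Lambda> x = \<psi> x * \<rho> x * exp (I x)))"

definition tilde_l :: "nat \<Rightarrow> nat" where
  "tilde_l i = (if i = 0 then l 0 + (\<Sum>k=1..M. r k) else l i)"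

definition form_a :: "complex \<Rightarrow> complex \<Rightarrow> (nat \<Rightarrow> nat \<Rightarrow> complex) \<Rightarrow> complex \<Rightarrow> complex" where
  "form_a \<alpha> \<kappa> b x =
     exp (\<kappa> * x) * (\<Sum>i=0..3. \<Sum>j<tilde_l i. b i j * (deriv ^^ j) (\<lambda>y. \<Phi> i y \<alpha>) x)"

text \<open>The inner sum is over \<open>0 \<le> j \<le> tilde_l i - 2\<close>, and is empty if \<open>tilde_l i \<le> 1\<close>.\<close>

definition form_b ::
  "complex \<Rightarrow> complex \<Rightarrow> (nat \<Rightarrow> complex) \<Rightarrow> (nat \<Rightarrow> nat \<Rightarrow> complex) \<Rightarrow> complex \<Rightarrow> complex" where
  "form_b \<kappa> c0 c b x =
     exp (\<kappa> * x) * (c0 +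
       (\<Sum>i=0..3. \<Sum>j<tilde_l i - 1. b i j * (deriv ^^ j) (\<lambda>y. wp (y + \<omega> i)) x) +
       (\<Sum>i=1..3. c i * (deriv wp x / (wp x - e i))))"

end

end

end

theory Submission
  imports Defs
begin

text \<open>
  Let \<open>f = \<Lambda> / \<Psi>\<^sub>g\<close>. The constancy of \<open>Q\<close> makes \<open>f' / f = \<Xi>' / (2 \<Xi>) + sqrt (- Q) / \<Xi>\<close> a solution of the
  Riccati equation of \<open>f'' = (v - E) f\<close>. This logarithmic derivative is elliptic, so \<open>\<Lambda>\<close> is
  multiplied by a constant under each period; and as \<open>\<Lambda>\<close> is single-valued, the exponents
  \<open>- L\<close>, \<open>L + 1\<close> of \<open>f'' = (v - E) f\<close> show that its only poles are at the half periods, of order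
  at most \<open>tilde_l i\<close>. By the Legendre relation the two multipliers are those of
  \<open>exp (\<kappa> x) \<Phi>\<^sub>i(x, \<alpha>)\<close> for suitable \<open>\<alpha>\<close>, \<open>\<kappa>\<close>, or, when \<open>\<alpha>\<close> would be a period, those of \<open>exp (\<kappa> x)\<close>.
  Subtracting derivatives of \<open>\<Phi>\<^sub>i\<close> (respectively of \<open>\<wp>\<close>, and then \<open>\<wp>' / (\<wp> - e\<^sub>i)\<close>) removes the
  principal parts. What remains is zero (respectively constant) because no elliptic function has a
  single simple pole as its only singularity.
\<close>

text \<open>Orders are read off leading coefficients: \<open>polar\<close> is stable under sums,
  products, derivatives and shifts, so residues, the coefficient of the potential and the indicial
  equation become arithmetic with indicators of lattice membership. The branch of \<Psi>_g
  disappears because only its square \<open>W\<close>, and half the logarithmic derivative of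
  \<open>W\<close>, enter the equations. The obstacle is isolated points: quotients and derivatives
  have arbitrary values at poles. Identities are therefore stated in punctured neighbourhoods and
  become pointwise only at the end, by analyticity off the half periods or because a nicely
  meromorphic function is fixed by its limits. The fact about a lone simple pole comes from
  Liouville rather than from contour integrals: subtracting c \<zeta> leaves an entire function with
  additive periods, hence an affine one, while the periods and the quasi-periods are linearly
  independent over the complex numbers. The same independence realizes every pair of nonzero
  multipliers; the Legendre relation, in the exponential form that \<sigma> provides, settles the
  case where \<alpha> is a period.\<close>

section \<open>Leading Laurent coefficients\<close>

text \<open>The coefficient \<open>c\<close> may vanish, so \<open>polar f p n c\<close> only bounds the order of the pole by \<open>n\<close>.\<close>

definition polar_rep :: "(complex \<Rightarrow> complex) \<Rightarrow> (complex \<Rightarrow> complex) \<Rightarrow> complex \<Rightarrow> nat \<Rightarrow> complex \<Rightarrow> bool" where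
  "polar_rep g f p n c \<longleftrightarrow>
     g analytic_on {p} \<and> g p = c \<and> (\<forall>\<^sub>F x in at p. f x = g x / (x - p) ^ n)"

definition polar :: "(complex \<Rightarrow> complex) \<Rightarrow> complex \<Rightarrow> nat \<Rightarrow> complex \<Rightarrow> bool" where
  "polar f p n c \<longleftrightarrow> (\<exists>g. polar_rep g f p n c)"

lemma polarI:
  "g analytic_on {p} \<Longrightarrow> g p = c \<Longrightarrow> (\<forall>\<^sub>F x in at p. f x = g x / (x - p) ^ n) \<Longrightarrow>
    polar f p n c"
  unfolding polar_def polar_rep_def by (rule exI[of _ g]) simp

lemma polar_repD:
  assumes "polar_rep g f p n c"
  shows "g analytic_on {p}" "g p = c" "\<forall>\<^sub>F x in at p. f x = g x / (x - p) ^ n"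
  using assms by (auto simp: polar_rep_def)

lemma polar_analytic: "f analytic_on {p} \<Longrightarrow> polar f p 0 (f p)"
  by (rule polarI[of f]) auto

lemma polar_cong:
  assumes "polar f p n c" "\<forall>\<^sub>F x in at p. f x = h x"
  shows "polar h p n c"
proof -
  obtain g where "polar_rep g f p n c" using assms(1) polar_def by blast
  note g = polar_repD[OF this]
  have "\<forall>\<^sub>F x in at p. h x = g x / (x - p) ^ n"
    using g(3) assms(2) by eventually_elim auto
  then show ?thesis using g(1,2) by (intro polarI[of g]) auto
qed

lemma eventually_neq_at: "\<forall>\<^sub>F x in at p. x \<noteq> (p :: 'a :: t1_space)"
  by (simp add: eventually_at_topological) auto

lemma polar_lim:
  assumes "polar f p n c"
  shows "((\<lambda>x. f x * (x - p) ^ n) \<longlongrightarrow> c) (at p)"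
proof -
  obtain g where "polar_rep g f p n c" using assms polar_def by blast
  note g = polar_repD[OF this]
  have "(g \<longlongrightarrow> c) (at p)"
    using g analytic_at_imp_isCont isCont_def by blast
  moreover have "\<forall>\<^sub>F x in at p. g x = f x * (x - p) ^ n"
    using g(3) eventually_neq_at by eventually_elim auto
  ultimately show ?thesis
    by (rule Lim_transform_eventually)
qed

text \<open>A coefficient is thus a number attached to \<open>f\<close>, \<open>p\<close> and
  \<open>n\<close>. Later arguments compute one coefficient in two ways and equate the results;
  orders, residues and the indicial equation are obtained like this.\<close>

lemma polar_unique: "polar f p n c \<Longrightarrow> polar f p n d \<Longrightarrow> c = d"
  using tendsto_unique[OF trivial_limit_at polar_lim polar_lim] .

lemma polar_raise:
  assumes "polar f p n c" "n < m"
  shows "polar f p m 0"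
proof -
  obtain g where "polar_rep g f p n c" using assms(1) polar_def by blast
  note g = polar_repD[OF this]
  show ?thesis
  proof (rule polarI[where g = "\<lambda>x. g x * (x - p) ^ (m - n)"])
    show "g p * (p - p) ^ (m - n) = 0" using assms(2) by simp
    show "(\<lambda>x. g x * (x - p) ^ (m - n)) analytic_on {p}"
      using g(1) by (intro analytic_intros)
    have m: "m = (m - n) + n" using assms(2) by simp
    show "\<forall>\<^sub>F x in at p. f x = g x * (x - p) ^ (m - n) / (x - p) ^ m"
      using g(3) eventually_neq_at
      by eventually_elim (subst (2) m, simp add: power_add)
  qed
qed

lemma polar_raise_le: "polar f p n c \<Longrightarrow> n \<le> m \<Longrightarrow> \<exists>d. polar f p m d"
  using polar_raise[of f p n c m] by (cases "n = m") auto

text \<open>The difference quotient, completed by \<open>deriv g p\<close> at \<open>p\<close>, has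
  a removable singularity.\<close>

lemma analytic_factor_zero:
  fixes g :: "complex \<Rightarrow> complex"
  assumes "g analytic_on {p}" "g p = 0"
  obtains h where "h analytic_on {p}" "h p = deriv g p" "\<forall>\<^sub>F x in at p. g x = (x - p) * h x"
proof -
  obtain S where S: "open S" "p \<in> S" "g holomorphic_on S"
    using assms(1) analytic_at by blast
  define h where "h = (\<lambda>x. if x = p then deriv g p else g x / (x - p))"
  have "h holomorphic_on S"
    unfolding h_def using pole_theorem_open[OF S(3,1), of p] assms(2) by (simp cong: if_cong)
  moreover have "\<forall>\<^sub>F x in at p. g x = (x - p) * h x"
    using eventually_neq_at by eventually_elim (auto simp: h_def)
  ultimately show ?thesis
    using that[of h] S analytic_at by (auto simp: h_def)
qed

text \<open>A vanishing leading coefficient lets the numerator be divided by \<open>x - p\<close>;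
  eliminations of principal parts below end with this step.\<close>

lemma polar_lower:
  assumes "polar f p (Suc n) 0"
  shows "\<exists>c. polar f p n c"
proof -
  obtain g where "polar_rep g f p (Suc n) 0" using assms polar_def by blast
  note g = polar_repD[OF this]
  obtain h where h: "h analytic_on {p}" "\<forall>\<^sub>F x in at p. g x = (x - p) * h x"
    using analytic_factor_zero[OF g(1,2)] by metis
  have "\<forall>\<^sub>F x in at p. f x = h x / (x - p) ^ n"
    using g(3) h(2) eventually_neq_at by eventually_elim auto
  then show ?thesis using polarI[OF h(1) refl] by blast
qed

lemma polar_const: "polar (\<lambda>_. c) p 0 c"
  using polar_analytic[of "\<lambda>_. c" p] by simp

lemma polar_mult:
  assumes "polar f p n c" "polar h p m d"
  shows "polar (\<lambda>x. f x * h x) p (n + m) (c * d)"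
proof -
  obtain g where "polar_rep g f p n c" using assms(1) polar_def by blast
  note g = polar_repD[OF this]
  obtain k where "polar_rep k h p m d" using assms(2) polar_def by blast
  note k = polar_repD[OF this]
  have "\<forall>\<^sub>F x in at p. f x * h x = (g x * k x) / (x - p) ^ (n + m)"
    using g(3) k(3) by eventually_elim (auto simp: power_add)
  then show ?thesis
    using g k by (intro polarI[of "\<lambda>x. g x * k x"] analytic_intros) auto
qed

lemma polar_cmult: "polar f p n c \<Longrightarrow> polar (\<lambda>x. a * f x) p n (a * c)"
  using polar_mult[OF polar_const, of f p n c a] by simp

lemma polar_add:
  assumes "polar f p n c" "polar h p n d"
  shows "polar (\<lambda>x. f x + h x) p n (c + d)"
proof -
  obtain g where "polar_rep g f p n c" using assms(1) polar_def by blast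
  note g = polar_repD[OF this]
  obtain k where "polar_rep k h p n d" using assms(2) polar_def by blast
  note k = polar_repD[OF this]
  have "\<forall>\<^sub>F x in at p. f x + h x = (g x + k x) / (x - p) ^ n"
    using g(3) k(3) by eventually_elim (auto simp: add_divide_distrib)
  then show ?thesis
    using g k by (intro polarI[of "\<lambda>x. g x + k x"] analytic_intros) auto
qed

lemma polar_diff:
  assumes "polar f p n c" "polar h p n d"
  shows "polar (\<lambda>x. f x - h x) p n (c - d)"
  using polar_add[OF assms(1) polar_cmult[OF assms(2), of "-1"]] by simp

lemma polar_zero: "polar (\<lambda>_. 0) p n 0"
  using polar_const[of 0 p] polar_raise[of _ p 0 0 n] by (cases "n = 0") auto

lemma polar_sum:
  "(\<And>i. i \<in> A \<Longrightarrow> polar (f i) p n (c i)) \<Longrightarrow> polar (\<lambda>x. \<Sum>i\<in>A. f i x) p n (\<Sum>i\<in>A. c i)"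
proof (induction A rule: infinite_finite_induct)
  case (insert x F)
  have "polar (\<lambda>y. f x y + (\<Sum>i\<in>F. f i y)) p n (c x + (\<Sum>i\<in>F. c i))"
    by (rule polar_add) (use insert in auto)
  then show ?case using insert.hyps by simp
qed (simp_all add: polar_zero)

lemma polar_inverse_simple_zero:
  assumes "f analytic_on {p}" "f p = 0" "deriv f p \<noteq> 0"
  shows "polar (\<lambda>x. 1 / f x) p 1 (1 / deriv f p)"
proof -
  obtain h where h: "h analytic_on {p}" "h p = deriv f p" "\<forall>\<^sub>F x in at p. f x = (x - p) * h x"
    using analytic_factor_zero[OF assms(1,2)] by metis
  show ?thesis
  proof (rule polarI[where g = "\<lambda>x. 1 / h x"])
    show "1 / h p = 1 / deriv f p" using h by simp
    show "(\<lambda>x. 1 / h x) analytic_on {p}"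
      using h assms by (intro analytic_intros) auto
    show "\<forall>\<^sub>F x in at p. 1 / f x = 1 / h x / (x - p) ^ 1"
      using h(3) by eventually_elim auto
  qed
qed

text \<open>By the quotient rule the new numerator is
  \<open>deriv g x * (x - p) - of_nat n * g x\<close>, whose value at \<open>p\<close> is
  \<open>- of_nat n * c\<close>. For \<open>n = 0\<close> the order \<open>Suc n\<close> is a
  generous bound and the coefficient is correctly 0.\<close>

lemma polar_deriv:
  assumes "polar f p n c"
  shows "polar (deriv f) p (Suc n) (- of_nat n * c)"
proof -
  obtain g where "polar_rep g f p n c" using assms polar_def by blast
  note g = polar_repD[OF this]
  let ?k = "\<lambda>x. deriv g x * (x - p) - of_nat n * g x"
  show ?thesis
  proof (rule polarI[where g = ?k])
    show "?k p = - of_nat n * c" using g by simp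
    show "?k analytic_on {p}"
      using g by (intro analytic_intros) auto
    obtain S where S: "open S" "p \<in> S" "g holomorphic_on S"
      using g(1) analytic_at by blast
    \<comment> \<open>Differentiation needs the formula on a neighbourhood of each nearby
      \<open>x\<close>, not only at \<open>x\<close> itself.\<close>
    have 1: "\<forall>\<^sub>F x in at p. \<forall>\<^sub>F y in nhds x. f y = g y / (y - p) ^ n"
    proof -
      obtain T where T: "open T" "p \<in> T" "\<And>x. x \<in> T - {p} \<Longrightarrow> f x = g x / (x - p) ^ n"
        using g(3) by (auto simp: eventually_at_topological)
      then have "\<forall>\<^sub>F y in nhds x. f y = g y / (y - p) ^ n" if "x \<in> T - {p}" for x
        using that by (intro eventually_nhds_in_open[of "T - {p}", THEN eventually_mono]) auto
      then show ?thesis using T by (auto simp: eventually_at_topological)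
    qed
    have 2: "\<forall>\<^sub>F x in at p. x \<in> S"
      using S by (simp add: eventually_at_topological) auto
    show "\<forall>\<^sub>F x in at p. deriv f x = ?k x / (x - p) ^ Suc n"
      using 1 2 eventually_neq_at
    proof eventually_elim
      case (elim x)
      have d: "(g has_field_derivative deriv g x) (at x)"
        using S elim holomorphic_derivI by blast
      have "deriv f x = deriv (\<lambda>y. g y / (y - p) ^ n) x"
        using elim(1) by (intro deriv_cong_ev) auto
      also have "\<dots> = ?k x / (x - p) ^ Suc n"
      proof (rule DERIV_imp_deriv, cases n)
        case 0
        then show "((\<lambda>y. g y / (y - p) ^ n) has_field_derivative ?k x / (x - p) ^ Suc n) (at x)"
          using d elim by auto
      next
        case (Suc m)
        have u: "x - p \<noteq> 0" using elim by simp
        have "((\<lambda>y. g y / (y - p) ^ Suc m) has_field_derivative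
            (deriv g x * (x - p) ^ Suc m - g x * (of_nat (Suc m) * (x - p) ^ m)) /
              ((x - p) ^ Suc m * (x - p) ^ Suc m)) (at x)"
        proof (rule DERIV_divide[OF d])
          show "((\<lambda>y. (y - p) ^ Suc m) has_field_derivative of_nat (Suc m) * (x - p) ^ m) (at x)"
            using DERIV_power[of "\<lambda>y. y - p" 1 x UNIV "Suc m"]
              DERIV_diff[OF DERIV_ident DERIV_const, of p x UNIV]
            by (simp add: ac_simps)
        qed (use u in simp)
        moreover have "(a * (v * t) - b * (N * v)) / ((v * t) * (v * t)) = (a * t - N * b) / (v * t * t)"
          if "v \<noteq> 0" "t \<noteq> 0" for a b v t N :: complex
          using that by (simp add: divide_simps) (simp add: algebra_simps)
        from this[of "(x - p) ^ m" "x - p" "deriv g x" "g x" "of_nat (Suc m)"]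
        have "(deriv g x * (x - p) ^ Suc m - g x * (of_nat (Suc m) * (x - p) ^ m)) /
              ((x - p) ^ Suc m * (x - p) ^ Suc m) = ?k x / (x - p) ^ Suc n"
          using u Suc by (simp only: power_Suc2 power_not_zero not_False_eq_True simp_thms)
        ultimately show "((\<lambda>y. g y / (y - p) ^ n) has_field_derivative ?k x / (x - p) ^ Suc n) (at x)"
          using Suc by metis
      qed
      finally show ?case .
    qed
  qed
qed

text \<open>Positive order is built into \<open>Suc n\<close> so that nonvanishing persists: each
  derivative multiplies the coefficient by \<open>- of_nat (Suc (n + j))\<close>, which is never
  0.\<close>

lemma polar_higher_deriv:
  assumes "polar f p (Suc n) c"
  shows "\<exists>d. polar ((deriv ^^ j) f) p (Suc (n + j)) d \<and> (c \<noteq> 0 \<longrightarrow> d \<noteq> 0)"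
proof (induction j)
  case (Suc j)
  then obtain d where d: "polar ((deriv ^^ j) f) p (Suc (n + j)) d" "c \<noteq> 0 \<longrightarrow> d \<noteq> 0" by blast
  have "polar ((deriv ^^ Suc j) f) p (Suc (n + Suc j)) (- of_nat (Suc (n + j)) * d)"
    using polar_deriv[OF d(1)] by simp
  then show ?case
    using d(2) of_nat_neq_0 by (metis mult_eq_0_iff neg_equal_0_iff_equal)
qed (use assms in auto)

lemma at_shift: "(\<forall>\<^sub>F x in at (p - w). P (x + w)) \<longleftrightarrow> (\<forall>\<^sub>F x in at (p :: complex). P x)"
proof -
  have "at p = filtermap (\<lambda>x. x + w) (at (p - w))"
    using filtermap_at_shift[of "-w" "p - w"] by simp
  then show ?thesis by (simp only: eventually_filtermap)
qed

lemma polar_shift: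
  assumes "polar f p n c"
  shows "polar (\<lambda>x. f (x + w)) (p - w) n c"
proof -
  obtain g where "polar_rep g f p n c" using assms polar_def by blast
  note g = polar_repD[OF this]
  show ?thesis
  proof (rule polarI[where g = "\<lambda>x. g (x + w)"])
    show "g (p - w + w) = c" using g by simp
    show "(\<lambda>x. g (x + w)) analytic_on {p - w}"
      using analytic_on_compose[of "\<lambda>x. x + w" "{p - w}" g] g(1)
      by (simp add: o_def analytic_intros)
    show "\<forall>\<^sub>F x in at (p - w). f (x + w) = g (x + w) / (x - (p - w)) ^ n"
      using g(3) unfolding at_shift[symmetric, of _ p w] by (simp add: algebra_simps)
  qed
qed

lemma polar_meromorphic:
  assumes "polar f p n c"
  shows "f meromorphic_on {p}"
proof -
  obtain g where "polar_rep g f p n c" using assms polar_def by blast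
  note g = polar_repD[OF this]
  have "(\<lambda>x. g x / (x - p) ^ n) meromorphic_on {p}"
    using g(1) by (intro meromorphic_intros analytic_on_imp_meromorphic_on)
  then show ?thesis
    using meromorphic_on_cong[of "{p}" f "\<lambda>x. g x / (x - p) ^ n" "{p}"] g(3) by simp
qed

lemma polar_0_remove_sings:
  assumes "polar f p 0 c"
  shows "remove_sings f analytic_on {p}"
proof -
  have "isolated_singularity_at f p"
    using polar_meromorphic[OF assms] meromorphic_at_iff by blast
  then show ?thesis
    using polar_lim[OF assms] remove_sings_analytic_at by simp
qed

lemma polar_meromorphic_UNIV: "(\<And>p. \<exists>n c. polar f p n c) \<Longrightarrow> f meromorphic_on A"
  unfolding meromorphic_on_meromorphic_at[of f A] by (meson polar_meromorphic)

section \<open>Unordered sums of holomorphic functions\<close>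

lemma Weierstrass_m_test_infsum:
  fixes f :: "'a \<Rightarrow> 'b \<Rightarrow> 'c :: banach"
  assumes bound: "\<And>w z. w \<in> I \<Longrightarrow> z \<in> U \<Longrightarrow> norm (f w z) \<le> M w"
    and M: "M summable_on I"
  shows "uniform_limit U (\<lambda>F z. \<Sum>w\<in>F. f w z) (\<lambda>z. \<Sum>\<^sub>\<infinity>w\<in>I. f w z) (finite_subsets_at_top I)"
proof (rule uniform_limitI)
  fix \<epsilon> :: real assume "\<epsilon> > 0"
  have "(sum M \<longlongrightarrow> infsum M I) (finite_subsets_at_top I)"
    using M infsum_tendsto by blast
  then have "\<forall>\<^sub>F F in finite_subsets_at_top I. dist (sum M F) (infsum M I) < \<epsilon>"
    using \<open>\<epsilon> > 0\<close> tendstoD by blast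
  moreover have "\<forall>\<^sub>F F in finite_subsets_at_top I. finite F \<and> F \<subseteq> I"
    by (rule eventually_finite_subsets_at_top_weakI) auto
  ultimately show "\<forall>\<^sub>F F in finite_subsets_at_top I.
      \<forall>z\<in>U. dist (\<Sum>w\<in>F. f w z) (\<Sum>\<^sub>\<infinity>w\<in>I. f w z) < \<epsilon>"
  proof eventually_elim
    case (elim F)
    have MF: "M summable_on (I - F)"
      using M summable_on_subset_banach by blast
    have "infsum M I = infsum M (F \<union> (I - F))" using elim by (intro arg_cong2[of _ _ _ _ infsum]) auto
    also have "\<dots> = sum M F + infsum M (I - F)"
      using elim MF by (subst infsum_Un_disjoint) auto
    finally have tail: "infsum M (I - F) < \<epsilon>"
      using elim(1) by (auto simp: dist_real_def)
    show ?case
    proof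
      fix z assume z: "z \<in> U"
      have abs: "(\<lambda>w. norm (f w z)) summable_on (I - F)"
        by (rule summable_on_comparison_test[OF MF]) (use bound z in auto)
      then have "(\<lambda>w. f w z) summable_on (I - F)"
        by (rule abs_summable_summable)
      have "(\<Sum>\<^sub>\<infinity>w\<in>I. f w z) = (\<Sum>\<^sub>\<infinity>w\<in>F \<union> (I - F). f w z)"
        using elim by (intro arg_cong2[of _ _ _ _ infsum]) auto
      also have "\<dots> = (\<Sum>w\<in>F. f w z) + (\<Sum>\<^sub>\<infinity>w\<in>I - F. f w z)"
        using elim \<open>(\<lambda>w. f w z) summable_on (I - F)\<close> by (subst infsum_Un_disjoint) auto
      finally have "dist (\<Sum>w\<in>F. f w z) (\<Sum>\<^sub>\<infinity>w\<in>I. f w z) = norm (\<Sum>\<^sub>\<infinity>w\<in>I - F. f w z)"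
        by (simp add: dist_norm)
      also have "\<dots> \<le> infsum M (I - F)"
        by (rule norm_infsum_le[OF has_sum_infsum has_sum_infsum])
          (use MF bound z \<open>(\<lambda>w. f w z) summable_on (I - F)\<close> in auto)
      finally show "dist (\<Sum>w\<in>F. f w z) (\<Sum>\<^sub>\<infinity>w\<in>I. f w z) < \<epsilon>" using tail by simp
    qed
  qed
qed

text \<open>Locally uniform limits of holomorphic functions may be differentiated, so a majorant for
  the terms alone yields both termwise differentiation and summability of the derivatives.\<close>

lemma has_field_derivative_infsum:
  fixes f :: "'a \<Rightarrow> complex \<Rightarrow> complex"
  assumes U: "open U"
    and deriv: "\<And>w z. w \<in> I \<Longrightarrow> z \<in> U \<Longrightarrow> (f w has_field_derivative f' w z) (at z)"
    and bound: "\<And>w z. w \<in> I \<Longrightarrow> z \<in> U \<Longrightarrow> norm (f w z) \<le> M w"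
    and M: "M summable_on I"
    and z: "z \<in> U"
  shows "((\<lambda>z. \<Sum>\<^sub>\<infinity>w\<in>I. f w z) has_field_derivative (\<Sum>\<^sub>\<infinity>w\<in>I. f' w z)) (at z)"
    and "(\<lambda>w. f' w z) summable_on I"
proof -
  obtain r where r: "r > 0" "cball z r \<subseteq> U"
    using U z open_contains_cball by blast
  have ulim: "uniform_limit (cball z r) (\<lambda>F z. \<Sum>w\<in>F. f w z) (\<lambda>z. \<Sum>\<^sub>\<infinity>w\<in>I. f w z)
      (finite_subsets_at_top I)"
    by (rule uniform_limit_on_subset[OF Weierstrass_m_test_infsum r(2)]) (use bound M in auto)
  have cont: "\<forall>\<^sub>F F in finite_subsets_at_top I. continuous_on (cball z r) (\<lambda>z. \<Sum>w\<in>F. f w z) \<and>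
      (\<forall>x\<in>ball z r. ((\<lambda>z. \<Sum>w\<in>F. f w z) has_field_derivative (\<Sum>w\<in>F. f' w x)) (at x))"
  proof (rule eventually_finite_subsets_at_top_weakI, intro conjI ballI)
    fix F assume F: "finite F" "F \<subseteq> I"
    have "continuous_on (cball z r) (f w)" if "w \<in> F" for w
    proof (rule DERIV_continuous_on)
      fix x assume "x \<in> cball z r"
      then show "(f w has_field_derivative f' w x) (at x within cball z r)"
        using deriv[of w x] F that r has_field_derivative_at_within by blast
    qed
    then show "continuous_on (cball z r) (\<lambda>z. \<Sum>w\<in>F. f w z)" by (intro continuous_on_sum)
    show "((\<lambda>z. \<Sum>w\<in>F. f w z) has_field_derivative (\<Sum>w\<in>F. f' w x)) (at x)" if "x \<in> ball z r" for x
      using that r F by (intro DERIV_sum deriv) auto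
  qed
  obtain g' where g': "\<And>w. w \<in> ball z r \<Longrightarrow>
      ((\<lambda>z. \<Sum>\<^sub>\<infinity>w\<in>I. f w z) has_field_derivative (g' w)) (at w) \<and>
      ((\<lambda>F. \<Sum>x\<in>F. f' x w) \<longlongrightarrow> g' w) (finite_subsets_at_top I)"
    using has_complex_derivative_uniform_limit[OF cont ulim] r(1) by (metis finite_subsets_at_top_neq_bot)
  have "((\<lambda>w. f' w z) has_sum g' z) I"
    using g' r(1) by (simp add: has_sum_def)
  then show "((\<lambda>z. \<Sum>\<^sub>\<infinity>w\<in>I. f w z) has_field_derivative (\<Sum>\<^sub>\<infinity>w\<in>I. f' w z)) (at z)"
    and "(\<lambda>w. f' w z) summable_on I"
    using g'[of z] r(1) infsumI[of "\<lambda>w. f' w z"] has_sum_imp_summable by auto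
qed

section \<open>The period lattice\<close>

text \<open>The exponent is half of 3: the lattice sum of inverse cubes will be bounded by a product
  of two such one-dimensional sums, each convergent because 3/2 > 1.\<close>

lemma summable_on_int_powr: "(\<lambda>n :: int. (1 + \<bar>real_of_int n\<bar>) powr (- 3 / 2)) summable_on UNIV"
proof -
  let ?f = "\<lambda>n :: int. (1 + \<bar>real_of_int n\<bar>) powr (- 3 / 2)"
  have "summable (\<lambda>n. real (Suc n) powr (- 3 / 2))"
    by (subst summable_Suc_iff) (simp add: summable_real_powr_iff)
  then have nat: "(\<lambda>n. real (Suc n) powr (- 3 / 2)) summable_on UNIV"
    by (intro norm_summable_imp_summable_on) simp
  have "?f summable_on range int"
    using nat by (subst summable_on_reindex) (auto simp: o_def inj_on_def)
  moreover have "?f summable_on range (\<lambda>n. - int n)"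
    using nat by (subst summable_on_reindex) (auto simp: o_def inj_on_def)
  moreover have "range int \<union> range (\<lambda>n. - int n) = UNIV"
    by (auto simp: image_iff) (metis int_cases2)
  ultimately show ?thesis
    using summable_on_union by metis
qed

text \<open>If the two numbers coincided, \<open>{\<omega>\<^sub>1, \<omega>\<^sub>3}\<close> would
  be a singleton and could still be independent; hence the separate inequality.\<close>

locale complex_lattice =
  fixes \<omega>\<^sub>1 \<omega>\<^sub>3 :: complex
  assumes distinct_periods: "\<omega>\<^sub>1 \<noteq> \<omega>\<^sub>3" and independent_periods: "independent {\<omega>\<^sub>1, \<omega>\<^sub>3}"
begin

abbreviation \<Omega> :: "complex set" where "\<Omega> \<equiv> lattice \<omega>\<^sub>1 \<omega>\<^sub>3"
abbreviation weierstrass_p :: "complex \<Rightarrow> complex" (\<open>\<wp>\<close>) where "\<wp> \<equiv> wp \<omega>\<^sub>1 \<omega>\<^sub>3"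
abbreviation \<zeta> :: "complex \<Rightarrow> complex" where "\<zeta> \<equiv> wzeta \<omega>\<^sub>1 \<omega>\<^sub>3"
abbreviation \<sigma> :: "complex \<Rightarrow> complex" where "\<sigma> \<equiv> wsigma \<omega>\<^sub>1 \<omega>\<^sub>3"

text \<open>Signed area of the parallelogram spanned by \<open>\<omega>\<^sub>1\<close> and
  \<open>\<omega>\<^sub>3\<close>, the determinant in Cramer's rule for real coordinates.\<close>

definition area :: real where "area = Im (cnj \<omega>\<^sub>1 * \<omega>\<^sub>3)"

lemma periods_nonzero: "\<omega>\<^sub>1 \<noteq> 0" "\<omega>\<^sub>3 \<noteq> 0"
  using independent_periods dependent_zero by auto

lemma area_nonzero: "area \<noteq> 0"
proof
  assume "area = 0"
  then have "cnj \<omega>\<^sub>1 * \<omega>\<^sub>3 = of_real (Re (cnj \<omega>\<^sub>1 * \<omega>\<^sub>3))"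
    by (simp add: area_def complex_eq_iff)
  then have "of_real ((norm \<omega>\<^sub>1)\<^sup>2) * \<omega>\<^sub>3 = of_real (Re (cnj \<omega>\<^sub>1 * \<omega>\<^sub>3)) * \<omega>\<^sub>1"
    by (metis complex_norm_square mult.assoc mult.commute)
  then have "(norm \<omega>\<^sub>1)\<^sup>2 *\<^sub>R \<omega>\<^sub>3 = Re (cnj \<omega>\<^sub>1 * \<omega>\<^sub>3) *\<^sub>R \<omega>\<^sub>1"
    by (simp add: scaleR_conv_of_real)
  moreover have "\<omega>\<^sub>3 = inverse ((norm \<omega>\<^sub>1)\<^sup>2) *\<^sub>R ((norm \<omega>\<^sub>1)\<^sup>2 *\<^sub>R \<omega>\<^sub>3)"
    using periods_nonzero by simp
  ultimately have "\<omega>\<^sub>3 = inverse ((norm \<omega>\<^sub>1)\<^sup>2) *\<^sub>R (Re (cnj \<omega>\<^sub>1 * \<omega>\<^sub>3) *\<^sub>R \<omega>\<^sub>1)"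
    by metis
  then have "\<omega>\<^sub>3 \<in> span {\<omega>\<^sub>1}"
    using span_base span_scale singletonI by metis
  moreover have "insert \<omega>\<^sub>3 {\<omega>\<^sub>1} = {\<omega>\<^sub>1, \<omega>\<^sub>3}" by auto
  ultimately show False
    using independent_periods distinct_periods independent_insert[of \<omega>\<^sub>3 "{\<omega>\<^sub>1}"] by simp
qed

lemma period_coordinates:
  assumes "z = of_real a * \<omega>\<^sub>1 + of_real b * \<omega>\<^sub>3"
  shows "a * area = Im (cnj z * \<omega>\<^sub>3)" "b * area = Im (cnj \<omega>\<^sub>1 * z)"
  unfolding assms area_def by (simp_all add: algebra_simps)

lemma period_decomposition:
  obtains a b where "z = of_real a * \<omega>\<^sub>1 + of_real b * \<omega>\<^sub>3"
proof (rule that)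
  define x y where "x = Im (cnj z * \<omega>\<^sub>3)" and "y = Im (cnj \<omega>\<^sub>1 * z)"
  have "of_real area * z = of_real x * \<omega>\<^sub>1 + of_real y * \<omega>\<^sub>3"
    by (simp add: complex_eq_iff area_def x_def y_def algebra_simps)
  then show "z = of_real (x / area) * \<omega>\<^sub>1 + of_real (y / area) * \<omega>\<^sub>3"
    using area_nonzero by (simp add: divide_simps mult.commute)
qed

text \<open>Cramer's rule bounds each coordinate times the area by the norm; the constant is
  \<open>\<bar>area\<bar>\<close> divided by the sum of the norms of both half periods.\<close>

lemma period_norm_bound:
  obtains c where "c > 0" "\<And>a b. c * max \<bar>a\<bar> \<bar>b\<bar> \<le> norm (of_real a * \<omega>\<^sub>1 + of_real b * \<omega>\<^sub>3)"
proof
  let ?s = "norm \<omega>\<^sub>1 + norm \<omega>\<^sub>3"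
  have s: "?s > 0" using periods_nonzero by (simp add: add_pos_pos)
  show "\<bar>area\<bar> / ?s > 0" using s area_nonzero by simp
  fix a b :: real
  define z where "z = of_real a * \<omega>\<^sub>1 + of_real b * \<omega>\<^sub>3"
  have "\<bar>a\<bar> * \<bar>area\<bar> \<le> norm z * norm \<omega>\<^sub>3" "\<bar>b\<bar> * \<bar>area\<bar> \<le> norm \<omega>\<^sub>1 * norm z"
    using period_coordinates[OF z_def] abs_Im_le_cmod[of "cnj z * \<omega>\<^sub>3"] abs_Im_le_cmod[of "cnj \<omega>\<^sub>1 * z"]
    by (simp_all add: abs_mult[symmetric] norm_mult)
  then have "\<bar>a\<bar> * \<bar>area\<bar> \<le> norm z * ?s" "\<bar>b\<bar> * \<bar>area\<bar> \<le> norm z * ?s"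
    by (smt (verit, ccfv_SIG) distrib_left mult.commute mult_nonneg_nonneg norm_ge_zero)+
  then have "max \<bar>a\<bar> \<bar>b\<bar> * \<bar>area\<bar> \<le> norm z * ?s"
    by (simp add: max_def)
  then show "\<bar>area\<bar> / ?s * max \<bar>a\<bar> \<bar>b\<bar> \<le> norm (of_real a * \<omega>\<^sub>1 + of_real b * \<omega>\<^sub>3)"
    using s unfolding z_def[symmetric] by (simp add: field_simps)
qed

definition lattice_point :: "int \<times> int \<Rightarrow> complex" where
  "lattice_point = (\<lambda>(m, n). 2 * of_int m * \<omega>\<^sub>1 + 2 * of_int n * \<omega>\<^sub>3)"

lemma lattice_point_real:
  "lattice_point (m, n) = of_real (2 * of_int m) * \<omega>\<^sub>1 + of_real (2 * of_int n) * \<omega>\<^sub>3"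
  by (simp add: lattice_point_def)

lemma lattice_eq: "\<Omega> = range lattice_point"
  by (auto simp: lattice_def lattice_point_def)

lemma lattice_point_0: "lattice_point (0, 0) = 0"
  by (simp add: lattice_point_def)

lemma inj_lattice_point: "inj lattice_point"
proof (rule injI)
  fix u v assume eq: "lattice_point u = lattice_point v"
  obtain m n m' n' where uv: "u = (m, n)" "v = (m', n')" by (cases u, cases v)
  have "2 * of_int m * area = 2 * of_int m' * area" "2 * of_int n * area = 2 * of_int n' * area"
    using period_coordinates[OF lattice_point_real[of m n]]
      period_coordinates[OF lattice_point_real[of m' n']] eq uv by simp_all
  then show "u = v" using area_nonzero uv by simp
qed

lemma zero_in_lattice [simp]: "0 \<in> \<Omega>"
  using lattice_eq lattice_point_0 by (metis rangeI)

lemma period_in_lattice [simp]: "2 * \<omega>\<^sub>1 \<in> \<Omega>" "2 * \<omega>\<^sub>3 \<in> \<Omega>"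
  unfolding lattice_eq using rangeI[of lattice_point "(1, 0)"] rangeI[of lattice_point "(0, 1)"]
  by (simp_all add: lattice_point_def)

lemma lattice_add:
  assumes "u \<in> \<Omega>" "v \<in> \<Omega>"
  shows "u + v \<in> \<Omega>"
proof -
  obtain m n m' n' where "u = lattice_point (m, n)" "v = lattice_point (m', n')"
    using assms unfolding lattice_eq by auto
  then have "u + v = lattice_point (m + m', n + n')"
    by (simp add: lattice_point_def algebra_simps)
  then show ?thesis unfolding lattice_eq by simp
qed

lemma lattice_uminus:
  assumes "u \<in> \<Omega>"
  shows "- u \<in> \<Omega>"
proof -
  obtain m n where "u = lattice_point (m, n)"
    using assms unfolding lattice_eq by auto
  then have "- u = lattice_point (- m, - n)"
    by (simp add: lattice_point_def algebra_simps)
  then show ?thesis unfolding lattice_eq by simp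
qed

lemma lattice_uminus_iff [simp]: "- u \<in> \<Omega> \<longleftrightarrow> u \<in> \<Omega>"
  using lattice_uminus[of u] lattice_uminus[of "- u"] by auto

lemma lattice_diff: "u \<in> \<Omega> \<Longrightarrow> v \<in> \<Omega> \<Longrightarrow> u - v \<in> \<Omega>"
  using lattice_add[of u "- v"] by simp

lemma lattice_add_iff: "w \<in> \<Omega> \<Longrightarrow> x + w \<in> \<Omega> \<longleftrightarrow> x \<in> \<Omega>"
  using lattice_add[of x w] lattice_diff[of "x + w" w] by auto

lemma lattice_diff_iff: "w \<in> \<Omega> \<Longrightarrow> x - w \<in> \<Omega> \<longleftrightarrow> x \<in> \<Omega>"
  using lattice_add_iff[of "-w" x] by simp

lemma finite_lattice_ball: "finite {w \<in> \<Omega>. norm w \<le> R}"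
proof -
  obtain c where c: "c > 0" "\<And>a b. c * max \<bar>a\<bar> \<bar>b\<bar> \<le> norm (of_real a * \<omega>\<^sub>1 + of_real b * \<omega>\<^sub>3)"
    using period_norm_bound by blast
  define K where "K = \<lceil>R / (2 * c)\<rceil>"
  have "{w \<in> \<Omega>. norm w \<le> R} \<subseteq> lattice_point ` ({-K..K} \<times> {-K..K})"
  proof
    fix w assume w: "w \<in> {w \<in> \<Omega>. norm w \<le> R}"
    then obtain m n where mn: "w = lattice_point (m, n)" unfolding lattice_eq by auto
    have "c * max \<bar>2 * of_int m\<bar> \<bar>2 * of_int n\<bar> \<le> R"
      using c(2)[of "2 * of_int m" "2 * of_int n"] w mn lattice_point_real[of m n] by simp
    then have "max \<bar>2 * real_of_int m\<bar> \<bar>2 * real_of_int n\<bar> \<le> R / c"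
      using c(1) by (simp only: pos_le_divide_eq mult.commute[of c])
    then have "\<bar>real_of_int m\<bar> \<le> R / (2 * c)" "\<bar>real_of_int n\<bar> \<le> R / (2 * c)"
      by (auto simp: abs_mult field_simps)
    then have "\<bar>m\<bar> \<le> K" "\<bar>n\<bar> \<le> K" unfolding K_def by linarith+
    then show "w \<in> lattice_point ` ({-K..K} \<times> {-K..K})"
      using mn by (intro image_eqI[of _ _ "(m, n)"]) auto
  qed
  then show ?thesis using finite_subset by blast
qed

lemma lattice_not_limpt: "\<not> p islimpt \<Omega>"
proof
  assume "p islimpt \<Omega>"
  then have "infinite (\<Omega> \<inter> ball p 1)" by (simp add: islimpt_eq_infinite_ball)
  moreover have "\<Omega> \<inter> ball p 1 \<subseteq> {w \<in> \<Omega>. norm w \<le> norm p + 1}"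
    by (auto simp: dist_norm) (smt (verit) norm_triangle_ineq3 norm_minus_commute)
  ultimately show False using finite_lattice_ball finite_subset by blast
qed

lemma closed_lattice: "closed \<Omega>"
  by (simp add: closed_limpt lattice_not_limpt)

text \<open>With k the larger of |m| and |n|, a lattice point has norm at least 2 c k, and the
  inverse cube of 2 k splits into two factors with exponent 3/2. Away from the origin k is at least
  1, so 1 + |m| and 1 + |n| are at most 2 k, which gives a bound by a product of one-dimensional
  terms.\<close>

lemma lattice_inverse_cube_summable: "(\<lambda>w. 1 / norm w ^ 3) summable_on (\<Omega> - {0})"
proof -
  obtain c where c: "c > 0" "\<And>a b. c * max \<bar>a\<bar> \<bar>b\<bar> \<le> norm (of_real a * \<omega>\<^sub>1 + of_real b * \<omega>\<^sub>3)"
    using period_norm_bound by blast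
  let ?f = "\<lambda>n :: int. (1 + \<bar>real_of_int n\<bar>) powr (- 3 / 2)"
  have "(\<lambda>n. norm (?f n)) summable_on UNIV" using summable_on_int_powr by simp
  then have "(\<lambda>u. norm (?f (fst u) * ?f (snd u))) summable_on (UNIV \<times> UNIV)"
    by (intro Infinite_Sum.abs_summable_on_Sigma_iff[THEN iffD2])
      (auto simp: abs_mult infsum_cmult_right' intro!: summable_on_cmult_right summable_on_cmult_left)
  then have "(\<lambda>u. 1 / c ^ 3 * (?f (fst u) * ?f (snd u))) summable_on (UNIV - {(0, 0)})"
    by (intro summable_on_cmult_right) (auto intro: summable_on_subset_banach)
  then have "(\<lambda>u. 1 / norm (lattice_point u) ^ 3) summable_on (UNIV - {(0, 0)})"
  proof (rule summable_on_comparison_test)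
    fix u :: "int \<times> int" assume u: "u \<in> UNIV - {(0, 0)}"
    obtain m n where mn: "u = (m, n)" by (cases u)
    define k where "k = max \<bar>real_of_int m\<bar> \<bar>real_of_int n\<bar>"
    have k: "k \<ge> 1" using u mn by (auto simp: k_def max_def)
    have "c * (2 * k) \<le> norm (lattice_point u)"
      using c(2)[of "2 * of_int m" "2 * of_int n"] mn lattice_point_real[of m n]
      by (simp add: k_def max_def abs_mult split: if_splits)
    then have "(c * (2 * k)) ^ 3 \<le> norm (lattice_point u) ^ 3"
      using c(1) k by (intro power_mono) auto
    moreover have pos: "(c * (2 * k)) ^ 3 > 0" using c(1) k by simp
    ultimately have "1 / norm (lattice_point u) ^ 3 \<le> 1 / (c * (2 * k)) ^ 3"
      by (intro frac_le) auto
    also have "\<dots> = 1 / c ^ 3 * (1 / (2 * k) ^ 3)" by (simp add: power_mult_distrib)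
    also have "1 / (2 * k) ^ 3 = (2 * k) powr (- 3 / 2) * (2 * k) powr (- 3 / 2)"
      using k by (simp add: powr_add[symmetric] powr_minus_divide powr_realpow)
    also have "\<dots> \<le> ?f m * ?f n"
      using k by (intro mult_mono powr_mono2') (auto simp: k_def)
    finally show "1 / norm (lattice_point u) ^ 3 \<le> 1 / c ^ 3 * (?f (fst u) * ?f (snd u))"
      using c(1) mn by (simp add: divide_right_mono)
  qed auto
  then have "((\<lambda>w. 1 / norm w ^ 3) \<circ> lattice_point) summable_on (UNIV - {(0, 0)})"
    by (simp add: o_def)
  then have "(\<lambda>w. 1 / norm w ^ 3) summable_on (lattice_point ` (UNIV - {(0, 0)}))"
    using inj_lattice_point by (subst summable_on_reindex) (auto intro: inj_on_subset)
  moreover have "lattice_point ` (UNIV - {(0, 0)}) = \<Omega> - {0}"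
    unfolding lattice_eq using image_set_diff[OF inj_lattice_point, of UNIV "{(0, 0)}"] lattice_point_0 by simp
  ultimately show ?thesis by simp
qed

end

section \<open>The Weierstrass functions\<close>

lemma inverse_shift_deriv:
  "z \<noteq> w \<Longrightarrow> ((\<lambda>z :: complex. 1 / (z - w)) has_field_derivative - 1 / (z - w)\<^sup>2) (at z)"
  by (rule derivative_eq_intros refl | simp add: power2_eq_square)+

lemma inverse_square_shift_deriv:
  assumes "z \<noteq> w"
  shows "((\<lambda>z :: complex. 1 / (z - w)\<^sup>2) has_field_derivative - 2 / (z - w) ^ 3) (at z)"
proof -
  have "z - w \<noteq> 0" using assms by simp
  then have "1 / (z - w) * (- 1 / (z - w)\<^sup>2) + - 1 / (z - w)\<^sup>2 * (1 / (z - w)) = - 2 / (z - w) ^ 3"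
    by (simp add: power2_eq_square power3_eq_cube field_simps)
  then show ?thesis
    using DERIV_mult[OF inverse_shift_deriv[OF assms] inverse_shift_deriv[OF assms]]
    by (simp add: power2_eq_square add.commute mult.commute)
qed

context complex_lattice
begin

text \<open>For \<open>norm z < R\<close> the points of \<open>big R\<close> satisfy
  \<open>norm (z - w) \<ge> norm w / 2\<close>, which gives majorants uniform in z; the finitely
  many points of \<open>small R\<close> form an ordinary finite sum or product.\<close>

definition small :: "real \<Rightarrow> complex set" where "small R = {w \<in> \<Omega> - {0}. norm w \<le> 2 * R}"
definition big :: "real \<Rightarrow> complex set" where "big R = {w \<in> \<Omega> - {0}. norm w > 2 * R}"

lemma small_big: "finite (small R)" "small R \<union> big R = \<Omega> - {0}" "small R \<inter> big R = {}"
  "small R \<subseteq> \<Omega> - {0}" "big R \<subseteq> \<Omega> - {0}"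
  using finite_subset[OF _ finite_lattice_ball[of "2 * R"], of "small R"]
  by (auto simp: small_def big_def)

lemma big_bound:
  assumes "R > 0" "w \<in> big R" "norm z < R"
  shows "w \<noteq> 0" "z \<noteq> w" "norm z \<le> norm w / 2" "norm (z - w) \<ge> norm w / 2" "norm (z / w) < 1"
proof -
  have w: "norm w > 2 * R" using assms by (auto simp: big_def)
  then show "w \<noteq> 0" "z \<noteq> w" "norm z \<le> norm w / 2" "norm (z / w) < 1"
    using assms by (auto simp: norm_divide divide_simps)
  show "norm (z - w) \<ge> norm w / 2"
    using w assms norm_triangle_ineq2[of w z] by (simp add: norm_minus_commute)
qed

lemma infsum_lattice_split:
  fixes f :: "complex \<Rightarrow> complex"
  assumes "f summable_on big R"
  shows "(\<Sum>\<^sub>\<infinity>w\<in>\<Omega> - {0}. f w) = (\<Sum>w\<in>small R. f w) + (\<Sum>\<^sub>\<infinity>w\<in>big R. f w)"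
    and "f summable_on (\<Omega> - {0})"
proof -
  have "infsum f (small R \<union> big R) = infsum f (small R) + infsum f (big R)"
    by (intro infsum_Un_disjoint) (use small_big assms in auto)
  then show "(\<Sum>\<^sub>\<infinity>w\<in>\<Omega> - {0}. f w) = (\<Sum>w\<in>small R. f w) + (\<Sum>\<^sub>\<infinity>w\<in>big R. f w)"
    using small_big by simp
  have "f summable_on (small R \<union> big R)"
    by (intro summable_on_Un_disjoint) (use small_big assms in auto)
  then show "f summable_on (\<Omega> - {0})" using small_big by simp
qed

lemma lattice_majorant_summable: "(\<lambda>w. C / norm w ^ 3) summable_on big R"
  using summable_on_subset_banach[OF summable_on_cmult_right[OF lattice_inverse_cube_summable, of C]
      small_big(5)] by simp

text \<open>On the disc of radius \<open>norm z + 1\<close> the series is a finite sum plus a tail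
  dominated by inverse cubes. Only nonzero lattice points are excluded, so the result also applies
  at 0, where the separate terms \<open>1 / z\<close> and \<open>1 / z\<^sup>2\<close> carry the
  poles of \<zeta> and \<wp>.\<close>

lemma lattice_series_deriv:
  assumes deriv: "\<And>w z. w \<in> \<Omega> - {0} \<Longrightarrow> z \<noteq> w \<Longrightarrow> (f w has_field_derivative f' w z) (at z)"
    and bound: "\<And>R w z. R > 0 \<Longrightarrow> w \<in> big R \<Longrightarrow> norm z < R \<Longrightarrow> norm (f w z) \<le> C R / norm w ^ 3"
    and z: "z \<notin> \<Omega> - {0}"
  shows "((\<lambda>z. \<Sum>\<^sub>\<infinity>w\<in>\<Omega> - {0}. f w z) has_field_derivative (\<Sum>\<^sub>\<infinity>w\<in>\<Omega> - {0}. f' w z)) (at z)"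
    and "(\<lambda>w. f w z) summable_on (\<Omega> - {0})" and "(\<lambda>w. f' w z) summable_on (\<Omega> - {0})"
proof -
  define R where "R = norm z + 1"
  have R: "R > 0" "z \<in> ball 0 R" by (auto simp: R_def add_nonneg_pos)
  note big = big_bound[OF R(1)]
  have f_summable: "(\<lambda>w. f w x) summable_on big R" if "x \<in> ball 0 R" for x
    by (rule abs_summable_summable, rule summable_on_comparison_test[OF lattice_majorant_summable[of "C R"]])
      (use that bound[OF R(1)] in auto)
  have tail: "((\<lambda>z. \<Sum>\<^sub>\<infinity>w\<in>big R. f w z) has_field_derivative (\<Sum>\<^sub>\<infinity>w\<in>big R. f' w z)) (at z)"
    "(\<lambda>w. f' w z) summable_on big R"
    using has_field_derivative_infsum[of "ball 0 R" "big R" f f' "\<lambda>w. C R / norm w ^ 3", OF _ _ _ lattice_majorant_summable R(2)]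
      deriv bound[OF R(1)] big small_big(5) by (simp_all add: subset_iff)
  have "((\<lambda>z. (\<Sum>w\<in>small R. f w z) + (\<Sum>\<^sub>\<infinity>w\<in>big R. f w z)) has_field_derivative
      (\<Sum>w\<in>small R. f' w z) + (\<Sum>\<^sub>\<infinity>w\<in>big R. f' w z)) (at z)"
    by (intro DERIV_add DERIV_sum tail deriv) (use small_big z in auto)
  also have "(\<Sum>w\<in>small R. f' w z) + (\<Sum>\<^sub>\<infinity>w\<in>big R. f' w z) = (\<Sum>\<^sub>\<infinity>w\<in>\<Omega> - {0}. f' w z)"
    by (rule infsum_lattice_split(1)[OF tail(2), symmetric])
  finally show "((\<lambda>z. \<Sum>\<^sub>\<infinity>w\<in>\<Omega> - {0}. f w z) has_field_derivative (\<Sum>\<^sub>\<infinity>w\<in>\<Omega> - {0}. f' w z)) (at z)"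
    by (rule has_field_derivative_transform_within_open[OF _ open_ball R(2)])
      (use infsum_lattice_split(1)[OF f_summable] in simp)
  show "(\<lambda>w. f w z) summable_on (\<Omega> - {0})" "(\<lambda>w. f' w z) summable_on (\<Omega> - {0})"
    using infsum_lattice_split(2) tail(2) f_summable[OF R(2)] by auto
qed

definition zeta_term :: "complex \<Rightarrow> complex \<Rightarrow> complex" where
  "zeta_term w z = 1 / (z - w) + 1 / w + z / w\<^sup>2"

definition wp_term :: "complex \<Rightarrow> complex \<Rightarrow> complex" where
  "wp_term w z = 1 / (z - w)\<^sup>2 - 1 / w\<^sup>2"

lemma zeta_term_deriv:
  assumes "z \<noteq> w"
  shows "(zeta_term w has_field_derivative - wp_term w z) (at z)"
proof -
  have "((\<lambda>z. 1 / (z - w) + 1 / w + z / w\<^sup>2) has_field_derivative - 1 / (z - w)\<^sup>2 + 0 + 1 / w\<^sup>2) (at z)"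
    by (intro DERIV_add DERIV_const DERIV_cdivide DERIV_ident inverse_shift_deriv assms)
  then show ?thesis unfolding zeta_term_def[abs_def] wp_term_def by simp
qed

lemma wp_term_deriv:
  assumes "z \<noteq> w"
  shows "(wp_term w has_field_derivative - 2 / (z - w) ^ 3) (at z)"
proof -
  have "((\<lambda>z. 1 / (z - w)\<^sup>2 - 1 / w\<^sup>2) has_field_derivative - 2 / (z - w) ^ 3 - 0) (at z)"
    by (intro DERIV_diff DERIV_const inverse_square_shift_deriv assms)
  then show ?thesis unfolding wp_term_def[abs_def] by simp
qed

text \<open>The terms \<open>1 / w + z / w\<^sup>2\<close> cancel the first two Taylor terms of
  \<open>1 / (z - w)\<close> at 0, leaving third order in 1 / w.\<close>

lemma zeta_term_bound:
  assumes "R > 0" "w \<in> big R" "norm z < R"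
  shows "norm (zeta_term w z) \<le> 2 * R\<^sup>2 / norm w ^ 3"
proof -
  note b = big_bound[OF assms]
  have "zeta_term w z = z\<^sup>2 / (w\<^sup>2 * (z - w))"
    using b(1,2) by (simp add: zeta_term_def divide_simps) (simp add: power2_eq_square algebra_simps)
  then have "norm (zeta_term w z) = (norm z)\<^sup>2 / ((norm w)\<^sup>2 * norm (z - w))"
    by (simp add: norm_divide norm_mult norm_power)
  also have "\<dots> \<le> R\<^sup>2 / ((norm w)\<^sup>2 * (norm w / 2))"
    using b(1,4) assms by (intro frac_le mult_mono power_mono mult_pos_pos) auto
  also have "\<dots> = 2 * R\<^sup>2 / norm w ^ 3"
    by (simp add: power2_eq_square power3_eq_cube)
  finally show ?thesis .
qed

lemma wp_term_bound:
  assumes "R > 0" "w \<in> big R" "norm z < R"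
  shows "norm (wp_term w z) \<le> 12 * R / norm w ^ 3"
proof -
  note b = big_bound[OF assms]
  have "wp_term w z = z * (2 * w - z) / (w\<^sup>2 * (z - w)\<^sup>2)"
    using b(1,2) by (simp add: wp_term_def divide_simps) (simp add: power2_eq_square algebra_simps)
  then have "norm (wp_term w z) = norm z * norm (2 * w - z) / ((norm w)\<^sup>2 * (norm (z - w))\<^sup>2)"
    by (simp add: norm_divide norm_mult norm_power)
  also have "\<dots> \<le> R * (3 * norm w) / ((norm w)\<^sup>2 * (norm w / 2)\<^sup>2)"
  proof (intro frac_le mult_mono power_mono mult_pos_pos)
    have "norm (2 * w - z) \<le> norm (2 * w) + norm z" by (rule norm_triangle_ineq4)
    then show "norm (2 * w - z) \<le> 3 * norm w" using b(3) norm_ge_zero[of w] norm_mult[of 2 w]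
      unfolding norm_numeral by linarith
  qed (use b assms in auto)
  also have "\<dots> = 12 * R / norm w ^ 3"
    using b(1) by (simp add: power2_eq_square power3_eq_cube)
  finally show ?thesis .
qed

definition zeta_series :: "complex \<Rightarrow> complex" where
  "zeta_series z = (\<Sum>\<^sub>\<infinity>w\<in>\<Omega> - {0}. zeta_term w z)"

definition wp_series :: "complex \<Rightarrow> complex" where
  "wp_series z = (\<Sum>\<^sub>\<infinity>w\<in>\<Omega> - {0}. wp_term w z)"

lemma zeta_eq: "\<zeta> z = 1 / z + zeta_series z"
  by (simp add: wzeta_def zeta_series_def zeta_term_def)

lemma wp_eq: "\<wp> z = 1 / z\<^sup>2 + wp_series z"
  by (simp add: wp_def wp_series_def wp_term_def)

lemma zeta_series_deriv:
  "z \<notin> \<Omega> - {0} \<Longrightarrow> (zeta_series has_field_derivative - wp_series z) (at z)"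
  unfolding zeta_series_def wp_series_def
  using lattice_series_deriv(1)[of zeta_term "\<lambda>w z. - wp_term w z" "\<lambda>R. 2 * R\<^sup>2" z]
    zeta_term_deriv zeta_term_bound by (simp add: infsum_uminus)

lemma wp_series_deriv:
  assumes "z \<notin> \<Omega> - {0}"
  shows "(wp_series has_field_derivative (\<Sum>\<^sub>\<infinity>w\<in>\<Omega> - {0}. - 2 / (z - w) ^ 3)) (at z)"
    and "(\<lambda>w. - 2 / (z - w) ^ 3) summable_on (\<Omega> - {0})"
  unfolding wp_series_def
  using lattice_series_deriv(1,3)[of wp_term "\<lambda>w z. - 2 / (z - w) ^ 3" "\<lambda>R. 12 * R" z]
    wp_term_deriv wp_term_bound assms by simp_all

lemma not_lattice_nonzero: "z \<notin> \<Omega> \<Longrightarrow> z \<noteq> 0"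
  using zero_in_lattice by metis

lemma zeta_deriv:
  assumes "z \<notin> \<Omega>"
  shows "(\<zeta> has_field_derivative - \<wp> z) (at z)"
proof -
  have "((\<lambda>z. 1 / (z - 0) + zeta_series z) has_field_derivative - 1 / (z - 0)\<^sup>2 + - wp_series z) (at z)"
    by (intro DERIV_add inverse_shift_deriv zeta_series_deriv) (use assms not_lattice_nonzero in auto)
  then show ?thesis unfolding zeta_eq[abs_def] wp_eq by simp
qed

text \<open>The derivative of \<open>1 / z\<^sup>2\<close> supplies the missing term at w = 0: the
  total is a sum over the whole lattice without convergence corrections, so its periodicity is mere
  reindexing.\<close>

lemma wp_deriv:
  assumes "z \<notin> \<Omega>"
  shows "(\<wp> has_field_derivative (\<Sum>\<^sub>\<infinity>w\<in>\<Omega>. - 2 / (z - w) ^ 3)) (at z)"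
proof -
  have z: "z \<noteq> 0" using assms not_lattice_nonzero by simp
  have "insert 0 (\<Omega> - {0}) = \<Omega>" by auto
  moreover have "(\<Sum>\<^sub>\<infinity>w\<in>insert 0 (\<Omega> - {0}). - 2 / (z - w) ^ 3) =
      - 2 / (z - 0) ^ 3 + (\<Sum>\<^sub>\<infinity>w\<in>\<Omega> - {0}. - 2 / (z - w) ^ 3)"
    by (rule infsum_insert) (use wp_series_deriv(2)[of z] assms in auto)
  ultimately have eq: "(\<Sum>\<^sub>\<infinity>w\<in>\<Omega>. - 2 / (z - w) ^ 3) = - 2 / z ^ 3 + (\<Sum>\<^sub>\<infinity>w\<in>\<Omega> - {0}. - 2 / (z - w) ^ 3)"
    by simp
  have "((\<lambda>z. 1 / z\<^sup>2) has_field_derivative - 2 / z ^ 3) (at z)"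
    using inverse_square_shift_deriv[OF z] by simp
  from DERIV_add[OF this wp_series_deriv(1)] show ?thesis
    unfolding eq wp_eq[abs_def] using assms by simp
qed

lemma wp_deriv_shift:
  assumes "v \<in> \<Omega>"
  shows "(\<Sum>\<^sub>\<infinity>w\<in>\<Omega>. - 2 / (z + v - w) ^ 3) = (\<Sum>\<^sub>\<infinity>w\<in>\<Omega>. - 2 / (z - w) ^ 3)"
  by (rule infsum_reindex_bij_witness[of _ "\<lambda>w. w + v" "\<lambda>w. w - v"])
    (use assms in \<open>auto simp: lattice_add_iff lattice_diff_iff algebra_simps\<close>)

lemma lattice_infsum_uminus:
  "(\<Sum>\<^sub>\<infinity>w\<in>\<Omega> - {0}. f (- w)) = (\<Sum>\<^sub>\<infinity>w\<in>\<Omega> - {0}. f w)"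
  by (rule infsum_reindex_bij_witness[of _ "\<lambda>w. - w" "\<lambda>w. - w"]) auto

lemma wp_even: "\<wp> (- z) = \<wp> z"
proof -
  have "wp_term w (- z) = wp_term (- w) z" for w
    using power2_minus[of "z + w"] by (simp add: wp_term_def)
  then show ?thesis
    unfolding wp_eq wp_series_def using lattice_infsum_uminus[of "\<lambda>w. wp_term w z"] by simp
qed

lemma zeta_odd: "\<zeta> (- z) = - \<zeta> z"
proof -
  have "zeta_term w (- z) = - zeta_term (- w) z" for w
    using minus_divide_right[of 1 "z + w"] by (simp add: zeta_term_def)
  then have "zeta_series (- z) = - zeta_series z"
    unfolding zeta_series_def using lattice_infsum_uminus[of "\<lambda>w. zeta_term w z"]
    by (simp add: infsum_uminus)
  then show ?thesis
    unfolding zeta_eq by simp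
qed

end

text \<open>Derivatives are recorded as function times logarithmic derivative, so that products add
  and quotients subtract; in the product rule zeros of the factors do no harm.\<close>

lemma DERIV_mult_log:
  fixes f g :: "complex \<Rightarrow> complex"
  assumes "(f has_field_derivative f x * a) (at x)" "(g has_field_derivative g x * b) (at x)"
  shows "((\<lambda>x. f x * g x) has_field_derivative f x * g x * (a + b)) (at x)"
  using DERIV_mult[OF assms] by (simp add: algebra_simps)

lemma DERIV_divide_log:
  fixes f g :: "complex \<Rightarrow> complex"
  assumes "(f has_field_derivative f x * a) (at x)" "(g has_field_derivative g x * b) (at x)" "g x \<noteq> 0"
  shows "((\<lambda>x. f x / g x) has_field_derivative f x / g x * (a - b)) (at x)"
proof -
  have "(f x * a * g x - f x * (g x * b)) / (g x * g x) = f x / g x * (a - b)"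
    using assms(3) by (simp add: divide_simps) (simp add: algebra_simps)
  then show ?thesis using DERIV_divide[OF assms] by simp
qed

lemma has_field_derivative_prod_log:
  fixes f :: "'a \<Rightarrow> complex \<Rightarrow> complex"
  assumes "finite A" "\<And>i. i \<in> A \<Longrightarrow> (f i has_field_derivative f i z * g i) (at z)"
  shows "((\<lambda>z. \<Prod>i\<in>A. f i z) has_field_derivative (\<Prod>i\<in>A. f i z) * (\<Sum>i\<in>A. g i)) (at z)"
  using assms
proof (induction A)
  case (insert i A)
  have "((\<lambda>z. f i z * (\<Prod>i\<in>A. f i z)) has_field_derivative
      f i z * g i * (\<Prod>i\<in>A. f i z) + (\<Prod>i\<in>A. f i z) * (\<Sum>i\<in>A. g i) * f i z) (at z)"
    by (intro DERIV_mult) (use insert in auto)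
  then show ?case using insert.hyps by (simp add: algebra_simps)
qed auto

context complex_lattice
begin

section \<open>Periodicity of \<wp> and quasi-periodicity of \<zeta>\<close>

lemma lattice_sparse: "\<Omega> sparse_in UNIV"
  using lattice_not_limpt by (simp add: sparse_in_open)

lemma connected_minus_lattice: "connected (- \<Omega>)"
  using sparse_imp_connected[OF _ connected_UNIV open_UNIV lattice_sparse]
  by (simp add: Compl_eq_Diff_UNIV)

lemma open_minus_lattice: "open (- \<Omega>)"
  using closed_lattice by (simp add: open_Compl)

lemma constant_off_lattice:
  assumes "\<And>z. z \<notin> \<Omega> \<Longrightarrow> (f has_field_derivative 0) (at z)"
  obtains c where "\<And>z. z \<notin> \<Omega> \<Longrightarrow> f z = c"
proof -
  have "f constant_on (- \<Omega>)"
    by (rule has_field_derivative_0_imp_constant_on)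
      (use assms connected_minus_lattice open_minus_lattice in auto)
  then show ?thesis using that by (auto simp: constant_on_def)
qed

lemma lattice_coordinates:
  assumes "of_real a * \<omega>\<^sub>1 + of_real b * \<omega>\<^sub>3 \<in> \<Omega>"
  shows "\<exists>m n :: int. a = 2 * of_int m \<and> b = 2 * of_int n"
proof -
  define z where "z = of_real a * \<omega>\<^sub>1 + of_real b * \<omega>\<^sub>3"
  obtain m n where mn: "z = lattice_point (m, n)"
    using assms unfolding z_def lattice_eq by auto
  have "a * area = 2 * of_int m * area" "b * area = 2 * of_int n * area"
    using period_coordinates[OF z_def] period_coordinates[OF mn[unfolded lattice_point_real]] by simp_all
  then show ?thesis using area_nonzero by auto
qed

lemma half_period_not_in_lattice: "\<omega>\<^sub>1 \<notin> \<Omega>" "\<omega>\<^sub>3 \<notin> \<Omega>" "\<omega>\<^sub>1 + \<omega>\<^sub>3 \<notin> \<Omega>" "\<omega>\<^sub>1 - \<omega>\<^sub>3 \<notin> \<Omega>"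
proof -
  have odd: "(1 :: real) \<noteq> 2 * of_int m" for m :: int
  proof
    assume "(1 :: real) = 2 * of_int m"
    then have "(1 :: int) = 2 * m" by linarith
    then show False by presburger
  qed
  show "\<omega>\<^sub>1 \<notin> \<Omega>" using lattice_coordinates[of 1 0] odd by auto
  show "\<omega>\<^sub>3 \<notin> \<Omega>" using lattice_coordinates[of 0 1] odd by auto
  show "\<omega>\<^sub>1 + \<omega>\<^sub>3 \<notin> \<Omega>" using lattice_coordinates[of 1 1] odd by auto
  show "\<omega>\<^sub>1 - \<omega>\<^sub>3 \<notin> \<Omega>" using lattice_coordinates[of 1 "-1"] odd by auto
qed

text \<open>Invariance is demanded as an equivalence at every point, so that negative multiples of
  the generators are covered too.\<close>

lemma lattice_invariant:
  assumes "Q p" "\<And>x. Q (x + 2 * \<omega>\<^sub>1) \<longleftrightarrow> Q x" "\<And>x. Q (x + 2 * \<omega>\<^sub>3) \<longleftrightarrow> Q x" "w \<in> \<Omega>"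
  shows "Q (p + w)"
proof -
  have *: "Q (x + of_int m * v) \<longleftrightarrow> Q x" if v: "\<And>x. Q (x + v) \<longleftrightarrow> Q x" for m :: int and v x
  proof (induction m rule: int_induct[where k = 0])
    case (step1 i)
    then show ?case using v[of "x + of_int i * v"] by (simp add: algebra_simps)
  next
    case (step2 i)
    then show ?case using v[of "x + of_int (i - 1) * v"] by (simp add: algebra_simps)
  qed simp
  obtain m n where "w = of_int m * (2 * \<omega>\<^sub>1) + of_int n * (2 * \<omega>\<^sub>3)"
    using assms(4) unfolding lattice_def by (auto simp: algebra_simps)
  then show ?thesis
    using *[OF assms(2), of p m] *[OF assms(3), of "p + of_int m * (2 * \<omega>\<^sub>1)" n] assms(1)
    by (simp add: add.assoc)
qed

text \<open>The derivative is periodic, hence the difference is constant, and evenness makes it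
  vanish at \<open>- v\<close>. This point has to avoid the poles, whence
  \<open>v \<notin> \<Omega>\<close>.\<close>

lemma wp_shift_half:
  assumes "2 * v \<in> \<Omega>" "v \<notin> \<Omega>" "z \<notin> \<Omega>"
  shows "\<wp> (z + 2 * v) = \<wp> z"
proof -
  have "((\<lambda>z. \<wp> (z + 2 * v) - \<wp> z) has_field_derivative 0) (at z)" if z: "z \<notin> \<Omega>" for z
  proof -
    have "(\<wp> has_field_derivative (\<Sum>\<^sub>\<infinity>w\<in>\<Omega>. - 2 / (z + 2 * v - w) ^ 3)) (at (z + 2 * v))"
      using wp_deriv[of "z + 2 * v"] z assms(1) by (simp add: lattice_add_iff)
    then have "((\<lambda>z. \<wp> (z + 2 * v)) has_field_derivative (\<Sum>\<^sub>\<infinity>w\<in>\<Omega>. - 2 / (z - w) ^ 3)) (at z)"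
      unfolding DERIV_shift wp_deriv_shift[OF assms(1)] .
    from DERIV_diff[OF this wp_deriv[OF z]] show ?thesis by simp
  qed
  then obtain c where c: "\<And>z. z \<notin> \<Omega> \<Longrightarrow> \<wp> (z + 2 * v) - \<wp> z = c"
    using constant_off_lattice[of "\<lambda>z. \<wp> (z + 2 * v) - \<wp> z"] by blast
  have "c = 0" using c[of "- v"] assms(2) by (simp add: wp_even)
  then show ?thesis using c[OF assms(3)] by simp
qed

text \<open>Periods whose half is again a period escape the evaluation at minus the half; they are
  reached by composing shifts by the two generators.\<close>

lemma wp_shift:
  assumes "w \<in> \<Omega>" "z \<notin> \<Omega>"
  shows "\<wp> (z + w) = \<wp> z"
proof -
  define P where "P w \<longleftrightarrow> w \<in> \<Omega> \<and> (\<forall>z. z \<notin> \<Omega> \<longrightarrow> \<wp> (z + w) = \<wp> z)" for w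
  have *: "P (x + 2 * v) \<longleftrightarrow> P x" if v: "2 * v \<in> \<Omega>" "v \<notin> \<Omega>" for x v
    unfolding P_def using wp_shift_half[OF v, of "_ + x"] v by (auto simp: lattice_add_iff add.assoc)
  have "P (0 + w)"
    by (rule lattice_invariant[of P]) (use assms * half_period_not_in_lattice in \<open>auto simp: P_def\<close>)
  then show ?thesis using assms(2) by (simp add: P_def)
qed

text \<open>The constant difference is found at \<open>- v\<close>, where oddness turns
  \<open>\<zeta> v - \<zeta> (- v)\<close> into \<open>2 * \<zeta> v\<close>.\<close>

lemma zeta_shift_half:
  assumes "2 * v \<in> \<Omega>" "v \<notin> \<Omega>" "z \<notin> \<Omega>"
  shows "\<zeta> (z + 2 * v) = \<zeta> z + 2 * \<zeta> v"
proof -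
  have "((\<lambda>z. \<zeta> (z + 2 * v) - \<zeta> z) has_field_derivative 0) (at z)" if z: "z \<notin> \<Omega>" for z
  proof -
    have "(\<zeta> has_field_derivative - \<wp> (z + 2 * v)) (at (z + 2 * v))"
      using zeta_deriv[of "z + 2 * v"] z assms(1) by (simp add: lattice_add_iff)
    then have "((\<lambda>z. \<zeta> (z + 2 * v)) has_field_derivative - \<wp> z) (at z)"
      by (simp add: DERIV_shift wp_shift assms(1) z)
    from DERIV_diff[OF this zeta_deriv[OF z]] show ?thesis by simp
  qed
  then obtain c where c: "\<And>z. z \<notin> \<Omega> \<Longrightarrow> \<zeta> (z + 2 * v) - \<zeta> z = c"
    using constant_off_lattice[of "\<lambda>z. \<zeta> (z + 2 * v) - \<zeta> z"] by blast
  have "c = 2 * \<zeta> v" using c[of "- v"] assms(2) by (simp add: zeta_odd)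
  then show ?thesis using c[OF assms(3)] by (simp add: algebra_simps)
qed

section \<open>The sigma function as a product over the lattice\<close>

definition sigma_factor :: "complex \<Rightarrow> complex \<Rightarrow> complex" where
  "sigma_factor w z = (1 - z / w) * exp (z / w + z\<^sup>2 / (2 * w\<^sup>2))"

text \<open>A logarithm of \<open>sigma_factor w\<close> for w far from z; it turns the infinite
  product into the exponential of an infinite sum.\<close>

definition ln_sigma_factor :: "complex \<Rightarrow> complex \<Rightarrow> complex" where
  "ln_sigma_factor w z = Ln (1 - z / w) + z / w + z\<^sup>2 / (2 * w\<^sup>2)"

lemma sigma_factor_exponent_deriv:
  assumes "w \<noteq> 0"
  shows "((\<lambda>z :: complex. z / w + z\<^sup>2 / (2 * w\<^sup>2)) has_field_derivative 1 / w + z / w\<^sup>2) (at z)"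
proof -
  have "((\<lambda>z. z / w + z\<^sup>2 / (2 * w\<^sup>2)) has_field_derivative 1 / w + (2 * z) / (2 * w\<^sup>2)) (at z)"
    by (intro DERIV_add DERIV_cdivide DERIV_ident) (auto intro!: derivative_eq_intros)
  then show ?thesis by simp
qed

lemma sigma_factor_deriv:
  assumes "w \<noteq> 0" "z \<noteq> w"
  shows "(sigma_factor w has_field_derivative sigma_factor w z * zeta_term w z) (at z)"
proof -
  let ?e = "exp (z / w + z\<^sup>2 / (2 * w\<^sup>2))"
  have e: "((\<lambda>z. exp (z / w + z\<^sup>2 / (2 * w\<^sup>2))) has_field_derivative ?e * (1 / w + z / w\<^sup>2)) (at z)"
    by (rule DERIV_fun_exp[OF sigma_factor_exponent_deriv[OF assms(1)]])
  have l: "((\<lambda>z. 1 - z / w) has_field_derivative - (1 / w)) (at z)"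
    using assms by (auto intro!: derivative_eq_intros)
  have eq: "- u * E + E * (u + s) * A = A * E * (t + u + s)" if "A * t = - u" for A t u E s :: complex
    unfolding distrib_left using that by (metis (no_types, opaque_lifting) add.assoc mult.assoc mult.commute distrib_left)
  have "(1 - z / w) * (1 / (z - w)) = - (1 / w)"
    using assms by (simp add: divide_simps)
  then have "- (1 / w) * ?e + ?e * (1 / w + z / w\<^sup>2) * (1 - z / w) = sigma_factor w z * zeta_term w z"
    using eq[of "1 - z / w" "1 / (z - w)" "1 / w" ?e "z / w\<^sup>2"]
    unfolding sigma_factor_def zeta_term_def by simp
  then show ?thesis
    using DERIV_mult[OF l e] unfolding sigma_factor_def[abs_def] by simp
qed

lemma ln_sigma_factor_deriv:
  assumes "R > 0" "w \<in> big R" "norm z < R"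
  shows "(ln_sigma_factor w has_field_derivative zeta_term w z) (at z)"
    and "exp (ln_sigma_factor w z) = sigma_factor w z"
proof -
  note b = big_bound[OF assms]
  have "Re (z / w) < 1" using b(5) complex_Re_le_cmod[of "z / w"] by linarith
  then have ln: "1 - z / w \<notin> \<real>\<^sub>\<le>\<^sub>0" "1 - z / w \<noteq> 0"
    by (auto simp: complex_nonpos_Reals_iff)
  have l: "((\<lambda>z. 1 - z / w) has_field_derivative - (1 / w)) (at z)"
    using b by (auto intro!: derivative_eq_intros)
  have "((\<lambda>z. Ln (1 - z / w)) has_field_derivative inverse (1 - z / w) * - (1 / w)) (at z)"
    by (rule DERIV_chain2[OF has_field_derivative_Ln[OF ln(1)] l])
  also have "inverse (1 - z / w) * - (1 / w) = 1 / (z - w)"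
    using ln(2) b by (simp add: divide_simps)
  finally have "((\<lambda>z. Ln (1 - z / w) + (z / w + z\<^sup>2 / (2 * w\<^sup>2))) has_field_derivative
      1 / (z - w) + (1 / w + z / w\<^sup>2)) (at z)"
    by (intro DERIV_add sigma_factor_exponent_deriv b)
  then show "(ln_sigma_factor w has_field_derivative zeta_term w z) (at z)"
    unfolding ln_sigma_factor_def[abs_def] zeta_term_def by (simp add: add.assoc)
  show "exp (ln_sigma_factor w z) = sigma_factor w z"
    using ln(2) by (simp add: ln_sigma_factor_def sigma_factor_def add.assoc exp_add)
qed

text \<open>The function vanishes at 0 and has derivative \<open>zeta_term w\<close>, so the mean
  value inequality on the disc multiplies the bound for \<open>zeta_term\<close> by R.\<close>

lemma ln_sigma_factor_bound:
  assumes "R > 0" "w \<in> big R" "norm z < R"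
  shows "norm (ln_sigma_factor w z) \<le> (2 * R ^ 3) / norm w ^ 3"
proof -
  have "norm (ln_sigma_factor w z - ln_sigma_factor w 0) \<le> 2 * R\<^sup>2 / norm w ^ 3 * norm (z - 0)"
  proof (rule field_differentiable_bound[of "ball 0 R" _ "zeta_term w"])
    fix x assume "x \<in> ball (0 :: complex) R"
    then have x: "norm x < R" by simp
    show "(ln_sigma_factor w has_field_derivative zeta_term w x) (at x within ball 0 R)"
      by (rule has_field_derivative_at_within[OF ln_sigma_factor_deriv(1)[OF assms(1,2) x]])
    show "norm (zeta_term w x) \<le> 2 * R\<^sup>2 / norm w ^ 3"
      by (rule zeta_term_bound[OF assms(1,2) x])
  qed (use assms in auto)
  also have "\<dots> \<le> 2 * R\<^sup>2 / norm w ^ 3 * R"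
    using assms by (intro mult_left_mono) auto
  finally show ?thesis by (simp add: ln_sigma_factor_def power2_eq_square power3_eq_cube mult.assoc)
qed

definition sigma_tail :: "real \<Rightarrow> complex \<Rightarrow> complex" where
  "sigma_tail R z = (\<Sum>\<^sub>\<infinity>w\<in>big R. ln_sigma_factor w z)"

lemma sigma_tail_deriv:
  assumes "R > 0" "norm z < R"
  shows "(sigma_tail R has_field_derivative (\<Sum>\<^sub>\<infinity>w\<in>big R. zeta_term w z)) (at z)"
    and "(\<lambda>w. zeta_term w z) summable_on big R" "(\<lambda>w. ln_sigma_factor w z) summable_on big R"
proof -
  show "(sigma_tail R has_field_derivative (\<Sum>\<^sub>\<infinity>w\<in>big R. zeta_term w z)) (at z)"
    "(\<lambda>w. zeta_term w z) summable_on big R"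
    unfolding sigma_tail_def
    using has_field_derivative_infsum[of "ball 0 R" "big R" ln_sigma_factor zeta_term
        "\<lambda>w. (2 * R ^ 3) / norm w ^ 3" z, OF _ _ _ lattice_majorant_summable]
      ln_sigma_factor_deriv(1)[OF assms(1)] ln_sigma_factor_bound[OF assms(1)] assms(2) by simp_all
  show "(\<lambda>w. ln_sigma_factor w z) summable_on big R"
    by (rule abs_summable_summable, rule summable_on_comparison_test[OF lattice_majorant_summable[of "2 * R ^ 3"]])
      (use assms ln_sigma_factor_bound[OF assms(1)] in auto)
qed

text \<open>Factors with w in \<open>small R\<close> can vanish and stay a finite product; the
  others have logarithms. The corresponding splitting holds for every finite set containing
  \<open>small R\<close>, hence also in the limit that defines \<sigma>.\<close>

lemma sigma_local:
  assumes "R > 0" "norm z < R"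
  shows "\<sigma> z = z * (\<Prod>w\<in>small R. sigma_factor w z) * exp (sigma_tail R z)"
proof -
  let ?F = "finite_subsets_at_top (\<Omega> - {0})"
  define g where "g w = (if w \<in> big R then ln_sigma_factor w z else 0)" for w
  have "((\<lambda>w. ln_sigma_factor w z) has_sum sigma_tail R z) (big R)"
    unfolding sigma_tail_def using sigma_tail_deriv(3)[OF assms] by simp
  then have "(g has_sum sigma_tail R z) (\<Omega> - {0})"
    by (rule has_sum_cong_neutral[THEN iffD1, rotated -1]) (use small_big in \<open>auto simp: g_def\<close>)
  then have "(sum g \<longlongrightarrow> sigma_tail R z) ?F" by (simp add: has_sum_def)
  then have "((\<lambda>F. (\<Prod>w\<in>small R. sigma_factor w z) * exp (sum g F)) \<longlongrightarrow>
      (\<Prod>w\<in>small R. sigma_factor w z) * exp (sigma_tail R z)) ?F"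
    by (intro tendsto_intros)
  moreover have "\<forall>\<^sub>F F in ?F. (\<Prod>w\<in>small R. sigma_factor w z) * exp (sum g F) = (\<Prod>w\<in>F. sigma_factor w z)"
  proof -
    have "(\<Prod>w\<in>small R. sigma_factor w z) * exp (sum g F) = (\<Prod>w\<in>F. sigma_factor w z)"
      if F: "finite F" "small R \<subseteq> F" "F \<subseteq> \<Omega> - {0}" for F
    proof -
      have "sum g F = (\<Sum>w\<in>F - small R. ln_sigma_factor w z)"
        by (rule sum.mono_neutral_cong_right) (use F small_big[of R] in \<open>auto simp: g_def\<close>)
      then have "exp (sum g F) = (\<Prod>w\<in>F - small R. exp (ln_sigma_factor w z))"
        using F by (simp add: exp_sum)
      also have "\<dots> = (\<Prod>w\<in>F - small R. sigma_factor w z)"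
        by (rule prod.cong[OF refl], rule ln_sigma_factor_deriv(2)[OF assms(1) _ assms(2)])
          (use F small_big(2)[of R] in blast)
      finally show ?thesis
        using prod.subset_diff[OF F(2,1), of "\<lambda>w. sigma_factor w z"] by (simp add: mult.commute)
    qed
    then show ?thesis
      unfolding eventually_finite_subsets_at_top using small_big(1,4)[of R] by blast
  qed
  ultimately have "((\<lambda>F. \<Prod>w\<in>F. sigma_factor w z) \<longlongrightarrow>
      (\<Prod>w\<in>small R. sigma_factor w z) * exp (sigma_tail R z)) ?F"
    by (rule Lim_transform_eventually)
  then have "Lim ?F (\<lambda>F. \<Prod>w\<in>F. sigma_factor w z) =
      (\<Prod>w\<in>small R. sigma_factor w z) * exp (sigma_tail R z)"
    by (rule tendsto_Lim[OF finite_subsets_at_top_neq_bot])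
  then show ?thesis
    by (simp add: wsigma_def sigma_factor_def)
qed

lemma sigma_factor_holomorphic: "w \<noteq> 0 \<Longrightarrow> sigma_factor w holomorphic_on A"
  unfolding sigma_factor_def[abs_def] by (intro holomorphic_intros) auto

lemma sigma_tail_holomorphic: "R > 0 \<Longrightarrow> sigma_tail R holomorphic_on ball 0 R"
  unfolding holomorphic_on_open[OF open_ball] using sigma_tail_deriv(1) by (intro ballI exI) auto

lemma sigma_holomorphic: "\<sigma> holomorphic_on UNIV"
proof -
  have "\<sigma> field_differentiable (at z)" for z
  proof -
    define R where "R = norm z + 1"
    have R: "R > 0" "z \<in> ball 0 R" by (auto simp: R_def add_nonneg_pos)
    have "(\<lambda>z. z * (\<Prod>w\<in>small R. sigma_factor w z) * exp (sigma_tail R z)) holomorphic_on ball 0 R"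
      by (intro holomorphic_intros sigma_factor_holomorphic sigma_tail_holomorphic)
        (use R small_big in auto)
    then have "\<sigma> holomorphic_on ball 0 R"
      by (rule holomorphic_transform) (use sigma_local[OF R(1)] in auto)
    then show ?thesis using R(2) holomorphic_on_imp_differentiable_at by blast
  qed
  then show ?thesis by (simp add: holomorphic_on_def field_differentiable_at_within)
qed

lemma sigma_eq_0_iff: "\<sigma> z = 0 \<longleftrightarrow> z \<in> \<Omega>"
proof -
  define R where "R = norm z + 1"
  have R: "R > 0" "norm z < R" by (auto simp: R_def add_nonneg_pos)
  have "z \<in> \<Omega> \<longleftrightarrow> z = 0 \<or> z \<in> small R"
    using R by (auto simp: small_def)
  moreover have "sigma_factor w z = 0 \<longleftrightarrow> z = w" if "w \<in> small R" for w
    using that by (auto simp: sigma_factor_def small_def)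
  ultimately show ?thesis
    using sigma_local[OF R] small_big(1)[of R] by auto
qed

text \<open>In \<open>sigma_local\<close> with \<open>R = norm z + 1\<close> the three factors have
  as logarithmic derivatives \<open>1 / z\<close>, the near part and the far part of the zeta
  series.\<close>

lemma sigma_deriv:
  assumes "z \<notin> \<Omega>"
  shows "(\<sigma> has_field_derivative \<sigma> z * \<zeta> z) (at z)"
proof -
  define R where "R = norm z + 1"
  have R: "R > 0" "norm z < R" "z \<in> ball 0 R" by (auto simp: R_def add_nonneg_pos)
  let ?P = "\<lambda>z. \<Prod>w\<in>small R. sigma_factor w z" and ?T = "\<lambda>z. exp (sigma_tail R z)"
  have z: "z \<noteq> 0" using assms not_lattice_nonzero by blast
  have P: "(?P has_field_derivative ?P z * (\<Sum>w\<in>small R. zeta_term w z)) (at z)"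
    by (intro has_field_derivative_prod_log sigma_factor_deriv) (use small_big[of R] assms in auto)
  have T: "(?T has_field_derivative ?T z * (\<Sum>\<^sub>\<infinity>w\<in>big R. zeta_term w z)) (at z)"
    by (rule DERIV_fun_exp[OF sigma_tail_deriv(1)[OF R(1,2)]])
  have "((\<lambda>z. z) has_field_derivative z * (1 / z)) (at z)"
    using z DERIV_ident by simp
  from DERIV_mult_log[OF DERIV_mult_log[OF this P] T]
  have "((\<lambda>z. z * ?P z * ?T z) has_field_derivative z * ?P z * ?T z *
      (1 / z + (\<Sum>w\<in>small R. zeta_term w z) + (\<Sum>\<^sub>\<infinity>w\<in>big R. zeta_term w z))) (at z)" .
  also have "z * ?P z * ?T z * (1 / z + (\<Sum>w\<in>small R. zeta_term w z) + (\<Sum>\<^sub>\<infinity>w\<in>big R. zeta_term w z)) =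
      \<sigma> z * \<zeta> z"
    unfolding sigma_local[OF R(1,2)] zeta_eq zeta_series_def
      infsum_lattice_split(1)[OF sigma_tail_deriv(2)[OF R(1,2)]] by (simp add: add.assoc)
  finally show ?thesis
    by (rule has_field_derivative_transform_within_open[OF _ open_ball R(3)])
      (use sigma_local[OF R(1)] in simp)
qed

lemma sigma_deriv_0: "(\<sigma> has_field_derivative 1) (at 0)"
proof -
  let ?g = "\<lambda>z. (\<Prod>w\<in>small 1. sigma_factor w z) * exp (sigma_tail 1 z)"
  have "?g holomorphic_on ball 0 1"
    by (intro holomorphic_intros sigma_factor_holomorphic sigma_tail_holomorphic) (use small_big in auto)
  then have "(?g has_field_derivative deriv ?g 0) (at 0)"
    by (intro holomorphic_derivI[of _ "ball 0 1"]) auto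
  from DERIV_mult[OF DERIV_ident this]
  have "((\<lambda>z. z * ?g z) has_field_derivative 1 * ?g 0 + deriv ?g 0 * 0) (at 0)" by simp
  moreover have "?g 0 = 1"
    by (simp add: sigma_factor_def sigma_tail_def ln_sigma_factor_def)
  ultimately have "((\<lambda>z. z * ?g z) has_field_derivative 1) (at 0)" by simp
  then show ?thesis
    by (rule has_field_derivative_transform_within_open[OF _ open_ball, of _ _ _ 0 1])
      (use sigma_local[of 1] in \<open>auto simp: mult.assoc\<close>)
qed

text \<open>Oddness of \<zeta> makes the quotient \<open>\<sigma> (- z) / \<sigma> z\<close> locally
  constant; the constant follows from the derivative of \<sigma> at 0, which is 1.\<close>

lemma sigma_odd: "\<sigma> (- z) = - \<sigma> z"
proof -
  have "((\<lambda>z. \<sigma> (- z) / \<sigma> z) has_field_derivative 0) (at z)" if z: "z \<notin> \<Omega>" for z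
  proof -
    have s: "\<sigma> z \<noteq> 0" using z sigma_eq_0_iff by simp
    have m: "((\<lambda>z. \<sigma> (- z)) has_field_derivative \<sigma> (- z) * \<zeta> (- z) * - 1) (at z)"
      by (rule DERIV_chain2[OF sigma_deriv]) (use z in \<open>auto intro!: derivative_eq_intros\<close>)
    from DERIV_divide[OF this sigma_deriv[OF z] s] show ?thesis
      by (simp add: zeta_odd mult_ac)
  qed
  then obtain c where c: "\<And>z. z \<notin> \<Omega> \<Longrightarrow> \<sigma> (- z) / \<sigma> z = c"
    using constant_off_lattice[of "\<lambda>z. \<sigma> (- z) / \<sigma> z"] by blast
  have eq: "\<sigma> (- z) = c * \<sigma> z" for z
    using c[of z] sigma_eq_0_iff[of z] sigma_eq_0_iff[of "- z"] by (cases "z \<in> \<Omega>") auto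
  have "((\<lambda>z. \<sigma> (- z)) has_field_derivative 1 * - 1) (at 0)"
    by (rule DERIV_chain2[of \<sigma>]) (use sigma_deriv_0 in \<open>auto intro!: derivative_eq_intros\<close>)
  moreover have "((\<lambda>z. \<sigma> (- z)) has_field_derivative c * 1) (at 0)"
    unfolding eq by (rule DERIV_cmult[OF sigma_deriv_0])
  ultimately have "c = - 1" using DERIV_unique by fastforce
  then show ?thesis using eq by simp
qed

text \<open>Since \<zeta> grows by \<open>2 * \<zeta> v\<close>, the factor
  \<open>exp (2 * \<zeta> v * z)\<close> corrects the logarithmic derivative and
  \<open>\<sigma> (z + 2 * v) / g z\<close> is constant. Its value is found at \<open>- v\<close>,
  where oddness compares \<open>\<sigma> v\<close> with \<open>\<sigma> (- v)\<close>.\<close>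

lemma sigma_shift_half:
  assumes "2 * v \<in> \<Omega>" "v \<notin> \<Omega>"
  shows "\<sigma> (z + 2 * v) = - exp (2 * \<zeta> v * (z + v)) * \<sigma> z"
proof -
  define g where "g z = \<sigma> z * exp (2 * \<zeta> v * z)" for z
  have gd: "(g has_field_derivative g z * (\<zeta> z + 2 * \<zeta> v)) (at z)" if z: "z \<notin> \<Omega>" for z
  proof -
    have "((\<lambda>z. exp (2 * \<zeta> v * z)) has_field_derivative exp (2 * \<zeta> v * z) * (2 * \<zeta> v)) (at z)"
      by (auto intro!: derivative_eq_intros)
    from DERIV_mult[OF sigma_deriv[OF z] this] show ?thesis
      unfolding g_def[abs_def] by (simp add: algebra_simps)
  qed
  have g0: "g z \<noteq> 0" if "z \<notin> \<Omega>" for z using that by (simp add: g_def sigma_eq_0_iff)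
  have "((\<lambda>z. \<sigma> (z + 2 * v) / g z) has_field_derivative 0) (at z)" if z: "z \<notin> \<Omega>" for z
  proof -
    have "(\<sigma> has_field_derivative \<sigma> (z + 2 * v) * \<zeta> (z + 2 * v)) (at (z + 2 * v))"
      using sigma_deriv z assms(1) by (simp add: lattice_add_iff)
    then have "((\<lambda>z. \<sigma> (z + 2 * v)) has_field_derivative \<sigma> (z + 2 * v) * (\<zeta> z + 2 * \<zeta> v)) (at z)"
      by (simp add: DERIV_shift zeta_shift_half assms z)
    from DERIV_divide[OF this gd[OF z] g0[OF z]] show ?thesis by (simp add: mult_ac)
  qed
  then obtain c where c: "\<And>z. z \<notin> \<Omega> \<Longrightarrow> \<sigma> (z + 2 * v) / g z = c"
    using constant_off_lattice[of "\<lambda>z. \<sigma> (z + 2 * v) / g z"] by blast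
  have "\<sigma> v \<noteq> 0" using assms sigma_eq_0_iff by simp
  then have "c = - exp (2 * \<zeta> v * v)"
    using c[of "- v"] assms by (simp add: g_def sigma_odd exp_minus field_simps)
  moreover have "\<sigma> (z + 2 * v) = c * g z"
    using c[of z] g0[of z] sigma_eq_0_iff[of z] sigma_eq_0_iff[of "z + 2 * v"] assms(1)
    by (cases "z \<in> \<Omega>") (auto simp: lattice_add_iff g_def)
  ultimately show ?thesis
    by (simp add: g_def exp_add[symmetric] algebra_simps)
qed

end

section \<open>Elliptic functions\<close>

lemma analytic_eq_at:
  fixes f g :: "complex \<Rightarrow> complex"
  assumes "f analytic_on {p}" "g analytic_on {p}" "\<forall>\<^sub>F x in at p. f x = g x"
  shows "f p = g p"
  using polar_unique[OF polar_cong[OF polar_analytic[OF assms(1)] assms(3)] polar_analytic[OF assms(2)]] .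

lemma polar_shift_iff: "polar (\<lambda>x. f (x + w)) p n c \<longleftrightarrow> polar f (p + w) n c"
  using polar_shift[of f "p + w" n c w] polar_shift[of "\<lambda>x. f (x + w)" p n c "- w"] by auto

lemma polar_const_ex: "\<exists>d. polar (\<lambda>_. a) p n d"
  using polar_raise_le[OF polar_const] by simp

text \<open>The constant \<open>a\<close> lets the statement cover functions such as \<zeta> that
  are periodic up to constants. A constant may change the coefficient but not the existence of a
  bound on the order.\<close>

lemma polar_shift_transfer:
  assumes "B \<noteq> 0" "\<forall>\<^sub>F y in at x. f (y + v) = B * f y + a"
  shows "(\<exists>d. polar f (x + v) n d) \<longleftrightarrow> (\<exists>d. polar f x n d)"
proof -
  obtain k where k: "polar (\<lambda>_. a) x n k" using polar_const_ex by blast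
  have "\<exists>d. polar f x n d" if "polar (\<lambda>y. f (y + v)) x n d" for d
  proof -
    have "polar (\<lambda>y. (1 / B) * (f (y + v) - a)) x n ((1 / B) * (d - k))"
      by (intro polar_cmult polar_diff that k)
    then have "polar f x n ((1 / B) * (d - k))"
      by (rule polar_cong) (use assms(2) in eventually_elim, use assms(1) in simp)
    then show ?thesis by blast
  qed
  moreover have "\<exists>d. polar (\<lambda>y. f (y + v)) x n d" if "polar f x n d" for d
  proof -
    have "polar (\<lambda>y. B * f y + a) x n (B * d + k)"
      by (intro polar_add polar_cmult that k)
    then have "polar (\<lambda>y. f (y + v)) x n (B * d + k)"
      by (rule polar_cong) (use assms(2) in eventually_elim, simp)
    then show ?thesis by blast
  qed
  ultimately show ?thesis unfolding polar_shift_iff by blast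
qed

text \<open>For positive n a constant has coefficient 0, so here the coefficient itself is
  preserved.\<close>

lemma polar_shift_exact:
  assumes "n > 0" "\<forall>\<^sub>F y in at x. f (y + v) = f y + a"
  shows "polar f (x + v) n c \<longleftrightarrow> polar f x n c"
proof -
  have k: "polar (\<lambda>_. a) x n 0" "polar (\<lambda>_. - a) x n 0"
    using polar_raise[OF polar_const] assms(1) by auto
  have "polar f x n c" if "polar (\<lambda>y. f (y + v)) x n c"
  proof -
    have "polar f x n (c + 0)"
      by (rule polar_cong[OF polar_add[OF that k(2)]]) (use assms(2) in eventually_elim, simp)
    then show ?thesis by simp
  qed
  moreover have "polar (\<lambda>y. f (y + v)) x n c" if "polar f x n c"
  proof -
    have "polar (\<lambda>y. f (y + v)) x n (c + 0)"
      by (rule polar_cong[OF polar_add[OF that k(1)]]) (use assms(2) in eventually_elim, simp)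
    then show ?thesis by simp
  qed
  ultimately show ?thesis unfolding polar_shift_iff by blast
qed

lemma deriv_imp_analytic:
  assumes "open S" "p \<in> S" "\<And>z. z \<in> S \<Longrightarrow> (f has_field_derivative f' z) (at z)"
  shows "f analytic_on {p}"
  using assms unfolding analytic_at holomorphic_on_open[OF assms(1)]
  by (intro exI[of _ S]) (auto simp: holomorphic_on_open)

context complex_lattice
begin

lemma eventually_off_lattice: "\<forall>\<^sub>F x in at p. x \<notin> \<Omega>"
  using lattice_sparse by (simp add: sparse_in_eventually_iff)

lemma zeta_analytic: "p \<notin> \<Omega> \<Longrightarrow> \<zeta> analytic_on {p}"
  by (rule deriv_imp_analytic[OF open_minus_lattice _ zeta_deriv]) auto

lemma wp_analytic: "p \<notin> \<Omega> \<Longrightarrow> \<wp> analytic_on {p}"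
  by (rule deriv_imp_analytic[OF open_minus_lattice _ wp_deriv]) auto

lemma open_minus_nonzero_lattice: "open (- (\<Omega> - {0}))"
  by (rule open_Compl) (use islimpt_subset[of _ "\<Omega> - {0}" \<Omega>] lattice_not_limpt in \<open>auto simp: closed_limpt\<close>)

lemma sigma_analytic: "\<sigma> analytic_on A"
  using sigma_holomorphic by (metis analytic_on_open analytic_on_subset open_UNIV subset_UNIV)

lemma sigma_comp_analytic: "f analytic_on A \<Longrightarrow> (\<lambda>x. \<sigma> (f x)) analytic_on A"
  using analytic_on_compose[of f A \<sigma>] sigma_analytic by (simp add: o_def)

lemma zeta_shift:
  assumes "z \<notin> \<Omega>"
  shows "\<zeta> (z + 2 * \<omega>\<^sub>1) = \<zeta> z + 2 * \<zeta> \<omega>\<^sub>1" "\<zeta> (z + 2 * \<omega>\<^sub>3) = \<zeta> z + 2 * \<zeta> \<omega>\<^sub>3"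
  using zeta_shift_half assms half_period_not_in_lattice by simp_all

lemma sigma_shift:
  "\<sigma> (z + 2 * \<omega>\<^sub>1) = - exp (2 * \<zeta> \<omega>\<^sub>1 * (z + \<omega>\<^sub>1)) * \<sigma> z"
  "\<sigma> (z + 2 * \<omega>\<^sub>3) = - exp (2 * \<zeta> \<omega>\<^sub>3 * (z + \<omega>\<^sub>3)) * \<sigma> z"
  using sigma_shift_half half_period_not_in_lattice by simp_all

lemma zeta_polar:
  assumes "p \<in> \<Omega>"
  shows "polar \<zeta> p 1 1"
proof -
  have "zeta_series analytic_on {0}"
    by (rule deriv_imp_analytic[OF open_minus_nonzero_lattice _ zeta_series_deriv]) auto
  then have "polar \<zeta> 0 1 1"
    by (intro polarI[of "\<lambda>z. 1 + z * zeta_series z"] analytic_intros)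
      (use eventually_neq_at[of 0] in \<open>auto elim!: eventually_mono simp: zeta_eq field_simps\<close>)
  then have "polar \<zeta> (0 + p) 1 1"
  proof (rule lattice_invariant[of "\<lambda>p. polar \<zeta> p 1 1"])
    show "polar \<zeta> (x + 2 * \<omega>\<^sub>1) 1 1 \<longleftrightarrow> polar \<zeta> x 1 1" for x
      by (rule polar_shift_exact)
        (use eventually_off_lattice[of x] zeta_shift in \<open>auto elim!: eventually_mono\<close>)
    show "polar \<zeta> (x + 2 * \<omega>\<^sub>3) 1 1 \<longleftrightarrow> polar \<zeta> x 1 1" for x
      by (rule polar_shift_exact)
        (use eventually_off_lattice[of x] zeta_shift in \<open>auto elim!: eventually_mono\<close>)
  qed (rule assms)
  then show ?thesis by simp
qed

lemma eventually_wp_shift: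
  "w \<in> \<Omega> \<Longrightarrow> \<forall>\<^sub>F y in at x. \<wp> (y + w) = \<wp> y"
  using eventually_off_lattice[of x] wp_shift by (auto elim!: eventually_mono)

lemma wp_polar:
  assumes "p \<in> \<Omega>"
  shows "polar \<wp> p 2 1"
proof -
  have "wp_series analytic_on {0}"
    by (rule deriv_imp_analytic[OF open_minus_nonzero_lattice _ wp_series_deriv(1)]) auto
  then have "polar \<wp> 0 2 1"
    by (intro polarI[of "\<lambda>z. 1 + z\<^sup>2 * wp_series z"] analytic_intros)
      (use eventually_neq_at[of 0] in \<open>auto elim!: eventually_mono simp: wp_eq field_simps\<close>)
  then have "polar (\<lambda>x. \<wp> (x + - p)) p 2 1"
    unfolding polar_shift_iff by simp
  then show ?thesis
    by (rule polar_cong) (use eventually_wp_shift[of "- p"] assms in simp)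
qed

text \<open>The relations are imposed near, not at, each point, since the functions concerned may
  have arbitrary values at their poles. Nonzero multipliers make the shifts reversible.\<close>

definition quasi_periodic :: "(complex \<Rightarrow> complex) \<Rightarrow> complex \<Rightarrow> complex \<Rightarrow> bool" where
  "quasi_periodic f B C \<longleftrightarrow> B \<noteq> 0 \<and> C \<noteq> 0 \<and>
     (\<forall>p. \<forall>\<^sub>F x in at p. f (x + 2 * \<omega>\<^sub>1) = B * f x) \<and>
     (\<forall>p. \<forall>\<^sub>F x in at p. f (x + 2 * \<omega>\<^sub>3) = C * f x)"

lemma quasi_periodicD:
  assumes "quasi_periodic f B C"
  shows "B \<noteq> 0" "C \<noteq> 0" "\<forall>\<^sub>F x in at p. f (x + 2 * \<omega>\<^sub>1) = B * f x"
    "\<forall>\<^sub>F x in at p. f (x + 2 * \<omega>\<^sub>3) = C * f x"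
  using assms by (auto simp: quasi_periodic_def)

lemma quasi_periodicI:
  assumes "B \<noteq> 0" "C \<noteq> 0" "\<And>p. \<forall>\<^sub>F x in at p. f (x + 2 * \<omega>\<^sub>1) = B * f x"
    "\<And>p. \<forall>\<^sub>F x in at p. f (x + 2 * \<omega>\<^sub>3) = C * f x"
  shows "quasi_periodic f B C"
  using assms by (auto simp: quasi_periodic_def)

lemma quasi_periodic_add:
  assumes "quasi_periodic f B C" "quasi_periodic g B C"
  shows "quasi_periodic (\<lambda>x. f x + g x) B C"
proof (rule quasi_periodicI)
  note f = quasi_periodicD[OF assms(1)] and g = quasi_periodicD[OF assms(2)]
  show "\<forall>\<^sub>F x in at p. f (x + 2 * \<omega>\<^sub>1) + g (x + 2 * \<omega>\<^sub>1) = B * (f x + g x)" for p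
    using f(3)[of p] g(3)[of p] by eventually_elim (simp add: distrib_left)
  show "\<forall>\<^sub>F x in at p. f (x + 2 * \<omega>\<^sub>3) + g (x + 2 * \<omega>\<^sub>3) = C * (f x + g x)" for p
    using f(4)[of p] g(4)[of p] by eventually_elim (simp add: distrib_left)
qed (use assms quasi_periodicD in auto)

lemma quasi_periodic_cmult: "quasi_periodic f B C \<Longrightarrow> quasi_periodic (\<lambda>x. a * f x) B C"
  unfolding quasi_periodic_def by (auto elim: eventually_mono)

lemma quasi_periodic_diff:
  "quasi_periodic f B C \<Longrightarrow> quasi_periodic g B C \<Longrightarrow> quasi_periodic (\<lambda>x. f x - g x) B C"
  using quasi_periodic_add[of f B C "\<lambda>x. - 1 * g x"] quasi_periodic_cmult[of g B C "- 1"] by simp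

lemma quasi_periodic_mult:
  assumes "quasi_periodic f B C" "quasi_periodic g B' C'"
  shows "quasi_periodic (\<lambda>x. f x * g x) (B * B') (C * C')"
proof (rule quasi_periodicI)
  note f = quasi_periodicD[OF assms(1)] and g = quasi_periodicD[OF assms(2)]
  show "\<forall>\<^sub>F x in at p. f (x + 2 * \<omega>\<^sub>1) * g (x + 2 * \<omega>\<^sub>1) = B * B' * (f x * g x)" for p
    using f(3)[of p] g(3)[of p] by eventually_elim simp
  show "\<forall>\<^sub>F x in at p. f (x + 2 * \<omega>\<^sub>3) * g (x + 2 * \<omega>\<^sub>3) = C * C' * (f x * g x)" for p
    using f(4)[of p] g(4)[of p] by eventually_elim simp
qed (use assms quasi_periodicD in auto)

lemma quasi_periodic_polar:
  assumes "quasi_periodic f B C" "polar f p n c" "w \<in> \<Omega>"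
  shows "\<exists>d. polar f (p + w) n d"
proof (rule lattice_invariant[of "\<lambda>p. \<exists>d. polar f p n d"])
  note f = quasi_periodicD[OF assms(1)]
  show "(\<exists>d. polar f (x + 2 * \<omega>\<^sub>1) n d) \<longleftrightarrow> (\<exists>d. polar f x n d)" for x
    by (rule polar_shift_transfer[where B = B and a = 0]) (use f in auto)
  show "(\<exists>d. polar f (x + 2 * \<omega>\<^sub>3) n d) \<longleftrightarrow> (\<exists>d. polar f x n d)" for x
    by (rule polar_shift_transfer[where B = C and a = 0]) (use f in auto)
qed (use assms in auto)

text \<open>The maximum over a closed period parallelogram bounds the modulus everywhere, and
  Liouville's theorem applies. Only the modulus has to be periodic, which admits functions that
  change sign under a period.\<close>

lemma entire_periodic_norm_constant:
  assumes h: "h holomorphic_on UNIV"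
    and "\<And>x. norm (h (x + 2 * \<omega>\<^sub>1)) = norm (h x)" "\<And>x. norm (h (x + 2 * \<omega>\<^sub>3)) = norm (h x)"
  obtains c where "\<And>x. h x = c"
proof -
  let ?K = "(\<lambda>u. of_real (2 * fst u) * \<omega>\<^sub>1 + of_real (2 * snd u) * \<omega>\<^sub>3) ` ({0..1} \<times> {0..1 :: real})"
  have "compact ?K"
    by (intro compact_continuous_image compact_Times continuous_intros) auto
  moreover have "continuous_on ?K h"
    using continuous_on_subset[OF holomorphic_on_imp_continuous_on[OF h]] by simp
  ultimately have "bounded (h ` ?K)"
    using compact_imp_bounded[OF compact_continuous_image[of ?K h]] by simp
  then obtain B where "\<forall>y\<in>h ` ?K. norm y \<le> B"
    unfolding bounded_iff by (elim exE)
  then have B: "norm (h x) \<le> B" if "x \<in> ?K" for x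
    by (rule bspec) (rule imageI[OF that])
  have "norm (h x) \<le> B" for x
  proof -
    obtain a b where x: "x = of_real a * \<omega>\<^sub>1 + of_real b * \<omega>\<^sub>3" using period_decomposition by blast
    define p where "p = of_real (2 * frac (a / 2)) * \<omega>\<^sub>1 + of_real (2 * frac (b / 2)) * \<omega>\<^sub>3"
    define w where "w = lattice_point (\<lfloor>a / 2\<rfloor>, \<lfloor>b / 2\<rfloor>)"
    have p: "p \<in> ?K"
      unfolding p_def by (rule image_eqI[of _ _ "(frac (a / 2), frac (b / 2))"])
        (auto simp: frac_ge_0 less_imp_le[OF frac_lt_1])
    have "x = p + w"
      by (simp add: x p_def w_def lattice_point_def frac_def algebra_simps)
    moreover have "w \<in> \<Omega>" unfolding lattice_eq w_def by simp
    ultimately have "norm (h x) = norm (h p)"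
      using lattice_invariant[of "\<lambda>y. norm (h y) = norm (h p)" p w] assms(2,3) by simp
    then show ?thesis using B[OF p] by simp
  qed
  then have "bounded (range h)" by (auto simp: bounded_iff)
  then have "h constant_on UNIV" using Liouville_theorem h by blast
  then show ?thesis using that by (auto simp: constant_on_def)
qed

text \<open>
  Otherwise some \<open>\<sigma> z * exp (- c * z\<^sup>2 / 2)\<close> would be a nonconstant entire function with bounded modulus.
\<close>

lemma eta_nondegenerate: "\<zeta> \<omega>\<^sub>1 * \<omega>\<^sub>3 \<noteq> \<zeta> \<omega>\<^sub>3 * \<omega>\<^sub>1"
proof
  assume eq: "\<zeta> \<omega>\<^sub>1 * \<omega>\<^sub>3 = \<zeta> \<omega>\<^sub>3 * \<omega>\<^sub>1"
  \<comment> \<open>Proportionality gives both quasi-periods as the same multiple c of the half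
    periods, so a single Gaussian factor cancels both exponential multipliers of \<sigma> and leaves
    the sign -1.\<close>
  define c where "c = \<zeta> \<omega>\<^sub>1 / \<omega>\<^sub>1"
  have c: "\<zeta> \<omega>\<^sub>1 = c * \<omega>\<^sub>1" "\<zeta> \<omega>\<^sub>3 = c * \<omega>\<^sub>3"
    using eq periods_nonzero by (auto simp: c_def field_simps)
  define f where "f z = \<sigma> z * exp (- c * z\<^sup>2 / 2)" for z
  have shift: "f (z + 2 * v) = - f z" if "\<sigma> (z + 2 * v) = - exp (2 * (c * v) * (z + v)) * \<sigma> z" for z v
  proof -
    have "2 * (c * v) * (z + v) + - c * (z + 2 * v)\<^sup>2 / 2 = - c * z\<^sup>2 / 2"
      by (simp add: power2_eq_square field_simps)
    then have "exp (2 * (c * v) * (z + v)) * exp (- c * (z + 2 * v)\<^sup>2 / 2) = exp (- c * z\<^sup>2 / 2)"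
      unfolding exp_add[symmetric] by simp
    then have "\<sigma> z * (exp (2 * (c * v) * (z + v)) * exp (- c * (z + 2 * v)\<^sup>2 / 2)) = \<sigma> z * exp (- c * z\<^sup>2 / 2)"
      by (rule arg_cong)
    then show ?thesis unfolding f_def that by (simp only: mult_minus_left mult_minus_right mult_ac)
  qed
  have "f holomorphic_on UNIV"
    unfolding f_def by (intro holomorphic_intros sigma_holomorphic) auto
  then obtain k where k: "\<And>x. f x = k"
    by (rule entire_periodic_norm_constant) (use shift sigma_shift c in auto)
  have "f 0 = 0" "f \<omega>\<^sub>1 \<noteq> 0"
    using half_period_not_in_lattice by (auto simp: f_def sigma_eq_0_iff)
  then show False using k by simp
qed

text \<open>The value of \<sigma> at \<open>\<omega>\<^sub>1 + 2 * \<omega>\<^sub>1 + 2 *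
  \<omega>\<^sub>3\<close> is computed by shifting in either order. This gives the Legendre
  determinant modulo periods of exp, the form in which multipliers use it.\<close>

lemma legendre_relation: "exp (4 * (\<zeta> \<omega>\<^sub>1 * \<omega>\<^sub>3 - \<zeta> \<omega>\<^sub>3 * \<omega>\<^sub>1)) = 1"
proof -
  have s: "\<sigma> \<omega>\<^sub>1 \<noteq> 0" using half_period_not_in_lattice by (simp add: sigma_eq_0_iff)
  have "\<sigma> (\<omega>\<^sub>1 + 2 * \<omega>\<^sub>1 + 2 * \<omega>\<^sub>3) = \<sigma> (\<omega>\<^sub>1 + 2 * \<omega>\<^sub>3 + 2 * \<omega>\<^sub>1)" by (simp add: add_ac)
  then have "exp (2 * \<zeta> \<omega>\<^sub>3 * (\<omega>\<^sub>1 + 2 * \<omega>\<^sub>1 + \<omega>\<^sub>3)) * exp (2 * \<zeta> \<omega>\<^sub>1 * (\<omega>\<^sub>1 + \<omega>\<^sub>1)) =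
      exp (2 * \<zeta> \<omega>\<^sub>1 * (\<omega>\<^sub>1 + 2 * \<omega>\<^sub>3 + \<omega>\<^sub>1)) * exp (2 * \<zeta> \<omega>\<^sub>3 * (\<omega>\<^sub>1 + \<omega>\<^sub>3))"
    unfolding sigma_shift using s by simp
  then have "exp (2 * \<zeta> \<omega>\<^sub>1 * (\<omega>\<^sub>1 + 2 * \<omega>\<^sub>3 + \<omega>\<^sub>1) + 2 * \<zeta> \<omega>\<^sub>3 * (\<omega>\<^sub>1 + \<omega>\<^sub>3) -
      (2 * \<zeta> \<omega>\<^sub>3 * (\<omega>\<^sub>1 + 2 * \<omega>\<^sub>1 + \<omega>\<^sub>3) + 2 * \<zeta> \<omega>\<^sub>1 * (\<omega>\<^sub>1 + \<omega>\<^sub>1))) = 1"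
    by (simp add: exp_diff exp_add)
  then show ?thesis by (simp add: algebra_simps)
qed

text \<open>Subtracting \<open>c * \<zeta> x\<close> removes the pole at the cost of additive
  periods. The derivative of the resulting entire function is elliptic, so the function is affine
  with slope a, and comparing periods gives a \<omega>_j = - c \<zeta>(\<omega>_j) for j = 1, 3. By
  \<open>eta_nondegenerate\<close>, c = 0 and then a = 0.\<close>

lemma elliptic_single_simple_pole:
  assumes f: "quasi_periodic f 1 1"
    and reg: "\<And>p. p \<notin> \<Omega> \<Longrightarrow> \<exists>d. polar f p 0 d"
    and pole: "polar f 0 1 c"
  obtains b where "\<And>p. \<forall>\<^sub>F x in at p. f x = b"
proof -
  define g where "g x = f x - c * \<zeta> x" for x
  have shift: "\<forall>\<^sub>F x in at p. g (x + 2 * v) = g x - c * (2 * \<zeta> v)"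
    if "\<forall>\<^sub>F x in at p. f (x + 2 * v) = 1 * f x" "2 * v \<in> \<Omega>" "v \<notin> \<Omega>" for p v
    using that(1) eventually_off_lattice[of p]
    by eventually_elim (simp add: g_def zeta_shift_half[OF that(2,3)] distrib_left)
  note g_shift = shift[OF quasi_periodicD(3)[OF f] period_in_lattice(1) half_period_not_in_lattice(1)]
    shift[OF quasi_periodicD(4)[OF f] period_in_lattice(2) half_period_not_in_lattice(2)]
  have g0: "\<exists>d. polar g p 0 d" for p
  proof (cases "p \<in> \<Omega>")
    case True
    have "polar g 0 (Suc 0) (c - c * 1)"
      unfolding g_def using polar_diff[OF pole polar_cmult[OF zeta_polar[of 0], of c]] by simp
    then have "\<exists>d. polar g 0 0 d" by (intro polar_lower) simp
    then have "\<exists>d. polar g (0 + p) 0 d"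
    proof (rule lattice_invariant[of "\<lambda>p. \<exists>d. polar g p 0 d"])
      show "(\<exists>d. polar g (x + 2 * \<omega>\<^sub>1) 0 d) \<longleftrightarrow> (\<exists>d. polar g x 0 d)" for x
        by (rule polar_shift_transfer[where B = 1 and a = "- (c * (2 * \<zeta> \<omega>\<^sub>1))"]) (use g_shift in auto)
      show "(\<exists>d. polar g (x + 2 * \<omega>\<^sub>3) 0 d) \<longleftrightarrow> (\<exists>d. polar g x 0 d)" for x
        by (rule polar_shift_transfer[where B = 1 and a = "- (c * (2 * \<zeta> \<omega>\<^sub>3))"]) (use g_shift in auto)
    qed (use True in simp)
    then show ?thesis by simp
  next
    case False
    obtain d where "polar f p 0 d" using reg[OF False] by blast
    from polar_diff[OF this polar_cmult[OF polar_analytic[OF zeta_analytic[OF False]]]]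
    show ?thesis unfolding g_def by blast
  qed
  define h where "h = remove_sings g"
  have han: "h analytic_on {p}" for p
    unfolding h_def using g0 polar_0_remove_sings by blast
  then have hol: "h holomorphic_on UNIV"
    using analytic_imp_holomorphic[of h UNIV] analytic_on_analytic_at[of h UNIV] by simp
  have hg: "\<forall>\<^sub>F x in at p. h x = g x" for p
  proof -
    obtain d where "polar g p 0 d" using g0 by blast
    then have "isolated_singularity_at g p" using polar_meromorphic meromorphic_at_iff by blast
    then show ?thesis unfolding h_def by (rule eventually_remove_sings_eq_at)
  qed
  have h_comp: "(\<lambda>x. h (x + v)) analytic_on {p}" for v p
    using analytic_on_compose[of "\<lambda>x. x + v" "{p}" h] han by (simp add: o_def analytic_intros)
  have shift: "h (x + v) = h x - a" if "\<And>p. \<forall>\<^sub>F x in at p. g (x + v) = g x - a" for x v a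
  proof (rule analytic_eq_at[of "\<lambda>x. h (x + v)" x "\<lambda>x. h x - a"])
    have "\<forall>\<^sub>F y in at x. h (y + v) = g (y + v)"
      using hg[of "x + v"] at_shift[where P = "\<lambda>y. h y = g y" and p = "x + v" and w = v] by simp
    then show "\<forall>\<^sub>F y in at x. h (y + v) = h y - a"
      using that[of x] hg[of x] by eventually_elim simp
    show "(\<lambda>x. h x - a) analytic_on {x}" using han by (intro analytic_intros)
  qed (rule h_comp)
  have s1: "h (x + 2 * \<omega>\<^sub>1) = h x - c * (2 * \<zeta> \<omega>\<^sub>1)" and s3: "h (x + 2 * \<omega>\<^sub>3) = h x - c * (2 * \<zeta> \<omega>\<^sub>3)" for x
    using shift g_shift by blast+
  have dh: "(h has_field_derivative deriv h x) (at x)" for x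
    using hol holomorphic_derivI by blast
  have d_shift: "deriv h (x + v) = deriv h x" if "\<And>x. h (x + v) = h x - a" for x v a
  proof -
    have "((\<lambda>x. h (x + v)) has_field_derivative deriv h (x + v)) (at x)"
      using dh[of "x + v"] by (simp add: DERIV_shift)
    moreover have "((\<lambda>x. h (x + v)) has_field_derivative deriv h x - 0) (at x)"
      unfolding that by (intro DERIV_diff dh DERIV_const)
    ultimately show ?thesis using DERIV_unique by fastforce
  qed
  have "deriv h holomorphic_on UNIV" using hol by (intro holomorphic_deriv) auto
  then obtain a where a: "\<And>x. deriv h x = a"
    by (rule entire_periodic_norm_constant) (use d_shift[OF s1] d_shift[OF s3] in auto)
  have "((\<lambda>x. h x - a * x) has_field_derivative a - a * 1) (at x)" for x
    by (intro DERIV_diff DERIV_cmult DERIV_ident) (use dh[of x] a in simp)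
  then obtain b where b: "\<And>x. x \<notin> \<Omega> \<Longrightarrow> h x - a * x = b"
    using constant_off_lattice[of "\<lambda>x. h x - a * x"] by auto
  \<comment> \<open>The affine formula was obtained off the lattice, so the periods are compared at
    the base point \<open>\<omega>\<^sub>1\<close>.\<close>
  have n: "\<omega>\<^sub>1 \<notin> \<Omega>" "\<omega>\<^sub>1 + 2 * \<omega>\<^sub>1 \<notin> \<Omega>" "\<omega>\<^sub>1 + 2 * \<omega>\<^sub>3 \<notin> \<Omega>"
    using half_period_not_in_lattice(1) lattice_add_iff[OF period_in_lattice(1), of \<omega>\<^sub>1]
      lattice_add_iff[OF period_in_lattice(2), of \<omega>\<^sub>1] by blast+
  have "2 * (a * \<omega>\<^sub>1 + c * \<zeta> \<omega>\<^sub>1) = 0" "2 * (a * \<omega>\<^sub>3 + c * \<zeta> \<omega>\<^sub>3) = 0"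
    using b[OF n(1)] b[OF n(2)] b[OF n(3)] s1[of \<omega>\<^sub>1] s3[of \<omega>\<^sub>1] by (simp_all add: algebra_simps)
  then have e1: "a * \<omega>\<^sub>1 = - c * \<zeta> \<omega>\<^sub>1" and e3: "a * \<omega>\<^sub>3 = - c * \<zeta> \<omega>\<^sub>3"
    by (simp_all only: eq_neg_iff_add_eq_0 mult_minus_left mult_eq_0_iff zero_neq_numeral[symmetric] simp_thms)
  have "c * (\<zeta> \<omega>\<^sub>1 * \<omega>\<^sub>3 - \<zeta> \<omega>\<^sub>3 * \<omega>\<^sub>1) = (a * \<omega>\<^sub>3) * \<omega>\<^sub>1 - (a * \<omega>\<^sub>1) * \<omega>\<^sub>3"
    unfolding e1 e3 by (simp add: algebra_simps)
  then have c: "c = 0" using eta_nondegenerate by simp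
  then have "a = 0" using e1 periods_nonzero by simp
  have "\<forall>\<^sub>F x in at p. f x = b" for p
    using hg[of p] eventually_off_lattice[of p]
    by eventually_elim (use b c \<open>a = 0\<close> in \<open>auto simp: g_def\<close>)
  then show ?thesis by (rule that)
qed

section \<open>Factorization of \<wp>(x) - \<wp>(d) by sigma functions\<close>

lemma sigma_quotient_shift:
  assumes "2 * v \<in> \<Omega>" "v \<notin> \<Omega>"
  shows "\<sigma> (x + 2 * v - d) * \<sigma> (x + 2 * v + d) / (\<sigma> (x + 2 * v))\<^sup>2 = \<sigma> (x - d) * \<sigma> (x + d) / (\<sigma> x)\<^sup>2"
proof -
  have 1: "\<sigma> (x + 2 * v - d) = - exp (2 * \<zeta> v * (x - d + v)) * \<sigma> (x - d)"
    using sigma_shift_half[OF assms, of "x - d"] by (simp add: algebra_simps)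
  have 2: "\<sigma> (x + 2 * v + d) = - exp (2 * \<zeta> v * (x + d + v)) * \<sigma> (x + d)"
    using sigma_shift_half[OF assms, of "x + d"] by (simp add: algebra_simps)
  have "exp (2 * \<zeta> v * (x - d + v)) * exp (2 * \<zeta> v * (x + d + v)) = (exp (2 * \<zeta> v * (x + v)))\<^sup>2"
    unfolding exp_double[symmetric] exp_add[symmetric] by (simp add: algebra_simps)
  then have "\<sigma> (x + 2 * v - d) * \<sigma> (x + 2 * v + d) =
      (exp (2 * \<zeta> v * (x + v)))\<^sup>2 * (\<sigma> (x - d) * \<sigma> (x + d))"
    unfolding 1 2 by simp
  moreover have "(\<sigma> (x + 2 * v))\<^sup>2 = (exp (2 * \<zeta> v * (x + v)))\<^sup>2 * (\<sigma> x)\<^sup>2"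
    unfolding sigma_shift_half[OF assms, of x] by (simp add: power_mult_distrib)
  ultimately show ?thesis by simp
qed

lemma inverse_sigma_polar: "polar (\<lambda>x. 1 / \<sigma> x) 0 1 1"
  using polar_inverse_simple_zero[OF sigma_analytic, of 0] DERIV_imp_deriv[OF sigma_deriv_0]
  by (simp add: sigma_eq_0_iff)

text \<open>The sum \<open>D\<close> of the difference and the normalized sigma quotient is elliptic
  and regular off the lattice. The double poles at 0 cancel, so at most a simple one is left and
  \<open>D\<close> is constant; it vanishes at d.\<close>

lemma wp_diff_factorization:
  assumes "d \<notin> \<Omega>" "x \<notin> \<Omega>"
  shows "\<wp> x - \<wp> d = - (\<sigma> (x - d) * \<sigma> (x + d) / (\<sigma> x)\<^sup>2) / (\<sigma> d)\<^sup>2"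
proof -
  define D where "D x = \<wp> x - \<wp> d + \<sigma> (x - d) * \<sigma> (x + d) / (\<sigma> x)\<^sup>2 / (\<sigma> d)\<^sup>2" for x
  have sd: "\<sigma> d \<noteq> 0" using assms(1) sigma_eq_0_iff by simp
  have an: "D analytic_on {p}" if "p \<notin> \<Omega>" for p
    unfolding D_def[abs_def]
    by (intro analytic_intros wp_analytic sigma_comp_analytic sigma_analytic) (use that sd sigma_eq_0_iff in auto)
  have "quasi_periodic D 1 1"
  proof (rule quasi_periodicI)
    have *: "\<forall>\<^sub>F x in at p. D (x + 2 * v) = 1 * D x" if "2 * v \<in> \<Omega>" "v \<notin> \<Omega>" for p v
      using eventually_wp_shift[OF that(1), of p]
      by eventually_elim (simp add: D_def sigma_quotient_shift[OF that])
    show "\<forall>\<^sub>F x in at p. D (x + 2 * \<omega>\<^sub>1) = 1 * D x" "\<forall>\<^sub>F x in at p. D (x + 2 * \<omega>\<^sub>3) = 1 * D x" for p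
      by (rule *; simp add: half_period_not_in_lattice)+
  qed auto
  moreover have "\<exists>c. polar D 0 1 c"
  proof -
    let ?q = "\<lambda>x. \<sigma> (x - d) * \<sigma> (x + d) / (\<sigma> d)\<^sup>2"
    have "?q analytic_on {0}"
      by (intro analytic_intros sigma_comp_analytic) (use sd in auto)
    \<comment> \<open>By oddness
      \<open>\<sigma> (- d) * \<sigma> d = - (\<sigma> d)\<^sup>2\<close>; this -1 cancels the
      leading coefficient 1 of \<wp>.\<close>
    moreover have "?q 0 = - 1"
      using sd by (simp add: sigma_odd power2_eq_square)
    ultimately have "polar ?q 0 0 (- 1)" using polar_analytic[of ?q 0] by simp
    from polar_mult[OF this polar_mult[OF inverse_sigma_polar inverse_sigma_polar]]
    have "polar (\<lambda>x. ?q x * (1 / \<sigma> x * (1 / \<sigma> x))) 0 2 (- 1)"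
      by (simp add: numeral_2_eq_2)
    moreover have "polar (\<lambda>_. \<wp> d) 0 2 0" using polar_raise[OF polar_const] by simp
    ultimately have "polar (\<lambda>x. \<wp> x - \<wp> d + ?q x * (1 / \<sigma> x * (1 / \<sigma> x))) 0 2 (1 - 0 + - 1)"
      by (intro polar_add polar_diff wp_polar) auto
    then have "polar D 0 (Suc 1) 0"
      by (simp add: D_def[abs_def] power2_eq_square numeral_2_eq_2 mult_ac)
    then show ?thesis by (rule polar_lower)
  qed
  ultimately obtain b where b: "\<And>p. \<forall>\<^sub>F x in at p. D x = b"
    using elliptic_single_simple_pole[of D] an polar_analytic by blast
  have val: "D p = b" if "p \<notin> \<Omega>" for p
    using analytic_eq_at[OF an[OF that] _ b] by simp
  have "D d = 0" by (simp add: D_def sigma_eq_0_iff)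
  then have "D x = 0" using val[OF assms(1)] val[OF assms(2)] by simp
  then show ?thesis by (simp add: D_def eq_neg_iff_add_eq_0)
qed

end

section \<open>Quasi-periodic functions with poles at the half periods\<close>

text \<open>Triangular elimination from the top: \<open>G k\<close> has exact order
  \<open>k + 1 + lo\<close>, so the available orders start at \<open>lo + 1\<close> and a remainder
  of order \<open>min n lo\<close> is left. The value lo = 0 serves the functions \<Phi>_i with
  their simple poles, lo = 1 serves \<wp> with its double pole.\<close>

lemma polar_reduce:
  assumes G: "\<And>k. \<exists>d. d \<noteq> 0 \<and> polar (G k) p (Suc (k + lo)) d"
    and f: "polar f p n c"
  shows "\<exists>b d. polar (\<lambda>x. f x - (\<Sum>j<n - lo. b j * G j x)) p (min n lo) d"
  using f
proof (induction n arbitrary: f c)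
  case (Suc m)
  show ?case
  proof (cases "m < lo")
    case True
    then show ?thesis using Suc.prems by (auto simp: min_def)
  next
    case False
    then have m: "m - lo + lo = m" "Suc m - lo = Suc (m - lo)" "min (Suc m) lo = min m lo" by auto
    obtain d where d: "d \<noteq> 0" "polar (G (m - lo)) p (Suc m) d"
      using G[of "m - lo"] m by auto
    have "polar (\<lambda>x. f x - c / d * G (m - lo) x) p (Suc m) (c - c / d * d)"
      by (intro polar_diff polar_cmult Suc.prems d)
    then have "polar (\<lambda>x. f x - c / d * G (m - lo) x) p (Suc m) 0" using d(1) by simp
    then obtain c' where "polar (\<lambda>x. f x - c / d * G (m - lo) x) p m c'"
      using polar_lower by blast
    from Suc.IH[OF this] obtain b k where
      b: "polar (\<lambda>x. f x - c / d * G (m - lo) x - (\<Sum>j<m - lo. b j * G j x)) p (min m lo) k" by blast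
    have "(\<Sum>j<Suc (m - lo). (b(m - lo := c / d)) j * G j x) = (\<Sum>j<m - lo. b j * G j x) + c / d * G (m - lo) x" for x
    proof -
      have "(\<Sum>j<m - lo. (b(m - lo := c / d)) j * G j x) = (\<Sum>j<m - lo. b j * G j x)"
        by (rule sum.cong) auto
      then show ?thesis by simp
    qed
    then have "polar (\<lambda>x. f x - (\<Sum>j<Suc m - lo. (b(m - lo := c / d)) j * G j x)) p (min (Suc m) lo) k"
      using b unfolding m by (simp add: algebra_simps)
    then show ?thesis by blast
  qed
qed auto

lemma higher_deriv_quasi_periodic:
  fixes f :: "complex \<Rightarrow> complex"
  assumes "open U" "f holomorphic_on U" "\<And>x. x \<in> U \<Longrightarrow> x + v \<in> U" "\<And>x. x \<in> U \<Longrightarrow> f (x + v) = B * f x"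
    and "x \<in> U"
  shows "(deriv ^^ j) f (x + v) = B * (deriv ^^ j) f x"
  using assms(5)
proof (induction j arbitrary: x)
  case (Suc j)
  let ?D = "(deriv ^^ j) f"
  have hol: "?D holomorphic_on U" using assms(1,2) by (intro holomorphic_higher_deriv)
  have d: "(?D has_field_derivative deriv ?D y) (at y)" if "y \<in> U" for y
    using hol assms(1) that holomorphic_derivI by blast
  have "((\<lambda>x. ?D (x + v)) has_field_derivative deriv ?D (x + v)) (at x)"
    using d[of "x + v"] assms(3) Suc.prems by (simp add: DERIV_shift)
  moreover have "((\<lambda>x. ?D (x + v)) has_field_derivative B * deriv ?D x) (at x)"
    by (rule has_field_derivative_transform_within_open[OF DERIV_cmult[OF d[OF Suc.prems], of B] assms(1) Suc.prems])
      (use Suc.IH in auto)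
  ultimately show ?case using DERIV_unique by (simp) blast
qed (use assms in auto)

context complex_lattice
begin

section \<open>The four classes of half periods\<close>

abbreviation half_period :: "nat \<Rightarrow> complex" where "half_period \<equiv> \<omega> \<omega>\<^sub>1 \<omega>\<^sub>3"
abbreviation H :: "complex set" where "H \<equiv> half_periods \<omega>\<^sub>1 \<omega>\<^sub>3"
abbreviation Phi :: "nat \<Rightarrow> complex \<Rightarrow> complex \<Rightarrow> complex" where "Phi i \<alpha> x \<equiv> \<Phi> \<omega>\<^sub>1 \<omega>\<^sub>3 i x \<alpha>"

lemma half_period_simps:
  "half_period 0 = 0" "half_period 1 = \<omega>\<^sub>1" "half_period (Suc 0) = \<omega>\<^sub>1" "half_period 2 = - \<omega>\<^sub>1 - \<omega>\<^sub>3" "half_period 3 = \<omega>\<^sub>3"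
  by (simp_all add: \<omega>_def)

lemma atMost_3: "i \<in> {0..3} \<longleftrightarrow> i = 0 \<or> i = 1 \<or> i = 2 \<or> i = (3 :: nat)"
  by auto

lemma half_period_double: "2 * half_period i \<in> \<Omega>"
proof -
  have "- (2 * \<omega>\<^sub>1 + 2 * \<omega>\<^sub>3) \<in> \<Omega>" using lattice_add[OF period_in_lattice] by (simp only: lattice_uminus_iff)
  then have "2 * (- \<omega>\<^sub>1 - \<omega>\<^sub>3) \<in> \<Omega>" by (simp add: algebra_simps)
  then show ?thesis using period_in_lattice zero_in_lattice unfolding \<omega>_def by (simp split: if_split)
qed

lemma half_period_diff:
  assumes "i \<in> {0..3}" "j \<in> {0..3}" "i \<noteq> j"
  shows "half_period j - half_period i \<notin> \<Omega>"
proof -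
  have n: "- \<omega>\<^sub>1 \<notin> \<Omega>" "- \<omega>\<^sub>3 \<notin> \<Omega>" "- (\<omega>\<^sub>1 + \<omega>\<^sub>3) \<notin> \<Omega>" "- (\<omega>\<^sub>1 - \<omega>\<^sub>3) \<notin> \<Omega>"
    "\<omega>\<^sub>3 + 2 * \<omega>\<^sub>1 \<notin> \<Omega>" "\<omega>\<^sub>1 + 2 * \<omega>\<^sub>3 \<notin> \<Omega>" "- (\<omega>\<^sub>3 + 2 * \<omega>\<^sub>1) \<notin> \<Omega>" "- (\<omega>\<^sub>1 + 2 * \<omega>\<^sub>3) \<notin> \<Omega>"
    unfolding lattice_uminus_iff lattice_add_iff[OF period_in_lattice(1)] lattice_add_iff[OF period_in_lattice(2)]
    by (rule half_period_not_in_lattice)+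
  show ?thesis
    using assms n half_period_not_in_lattice unfolding atMost_3
    by (elim disjE; simp add: \<omega>_def algebra_simps)
qed

text \<open>The parities of the two integer coordinates of x single out its class; both odd
  corresponds to \<open>half_period 2\<close>.\<close>

lemma half_periods_iff: "x \<in> H \<longleftrightarrow> (\<exists>i\<in>{0..3}. x + half_period i \<in> \<Omega>)"
proof
  assume "x \<in> H"
  then obtain m n where mn: "2 * x = 2 * of_int m * \<omega>\<^sub>1 + 2 * of_int n * \<omega>\<^sub>3"
    unfolding half_periods_def lattice_def by auto
  have "2 * x = 2 * (of_int m * \<omega>\<^sub>1 + of_int n * \<omega>\<^sub>3)" unfolding mn by (simp add: algebra_simps)
  then have x: "x = of_int m * \<omega>\<^sub>1 + of_int n * \<omega>\<^sub>3"
    by (rule mult_left_cancel[THEN iffD1, rotated]) simp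
  have mem: "of_int (2 * k) * \<omega>\<^sub>1 + of_int (2 * k') * \<omega>\<^sub>3 \<in> \<Omega>" for k k'
    unfolding lattice_def by auto
  consider k k' where "m = 2 * k" "n = 2 * k'" | k k' where "m = 2 * k + 1" "n = 2 * k'"
    | k k' where "m = 2 * k" "n = 2 * k' + 1" | k k' where "m = 2 * k + 1" "n = 2 * k' + 1"
    by (metis evenE oddE)
  then show "\<exists>i\<in>{0..3}. x + half_period i \<in> \<Omega>"
  proof cases
    case 1
    then have "x + half_period 0 \<in> \<Omega>" using mem[of k k'] x by (simp add: half_period_simps)
    then show ?thesis by force
  next
    case 2
    then have "x + half_period 1 \<in> \<Omega>" using mem[of "k + 1" k'] x by (simp add: half_period_simps algebra_simps)
    then show ?thesis by force
  next
    case 3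
    then have "x + half_period 3 \<in> \<Omega>" using mem[of k "k' + 1"] x by (simp add: half_period_simps algebra_simps)
    then show ?thesis by force
  next
    case 4
    then have "x + half_period 2 \<in> \<Omega>" using mem[of k k'] x by (simp add: half_period_simps algebra_simps)
    then show ?thesis by force
  qed
next
  assume "\<exists>i\<in>{0..3}. x + half_period i \<in> \<Omega>"
  then obtain i where i: "x + half_period i \<in> \<Omega>" by blast
  have "(x + half_period i) + (x + half_period i) - 2 * half_period i \<in> \<Omega>"
    by (intro lattice_diff lattice_add i half_period_double)
  then show "x \<in> H" by (simp add: half_periods_def)
qed

lemma half_periods_shift:
  assumes "w \<in> \<Omega>"
  shows "x + w \<in> H \<longleftrightarrow> x \<in> H"
proof -
  have "x + w + a \<in> \<Omega> \<longleftrightarrow> x + a \<in> \<Omega>" for a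
    using lattice_add_iff[OF assms, of "x + a"] by (simp only: add.assoc add.commute[of w])
  then show ?thesis unfolding half_periods_iff by simp
qed

lemma lattice_subset_half_periods: "\<Omega> \<subseteq> H"
  by (rule subsetI) (simp only: half_periods_def mem_Collect_eq mult_2 lattice_add)

lemma sparse_shift_lattice: "{x. x + a \<in> \<Omega>} sparse_in UNIV"
proof -
  have "{x. x + a \<in> \<Omega>} = (+) (- a) ` \<Omega>" by (auto simp: image_iff algebra_simps)
  then show ?thesis using sparse_in_translate_UNIV[OF lattice_sparse, of "- a"] by metis
qed

lemma half_periods_sparse: "H sparse_in UNIV"
proof -
  have "H = (\<Union>i\<in>{0..3}. {x. x + half_period i \<in> \<Omega>})" using half_periods_iff by blast
  then show ?thesis by (simp add: sparse_in_UN_finite sparse_shift_lattice)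
qed

lemma eventually_off_half_periods: "\<forall>\<^sub>F x in at p. x \<notin> H"
  using half_periods_sparse by (simp add: sparse_in_eventually_iff)

lemma eventually_off_shifted_lattice: "\<forall>\<^sub>F x in at p. x + a \<notin> \<Omega>"
  using sparse_shift_lattice[of a] by (simp add: sparse_in_eventually_iff)

lemma wp_eq_iff:
  assumes "d \<notin> \<Omega>" "x \<notin> \<Omega>"
  shows "\<wp> x = \<wp> d \<longleftrightarrow> x - d \<in> \<Omega> \<or> x + d \<in> \<Omega>"
proof -
  have "\<wp> x = \<wp> d \<longleftrightarrow> \<wp> x - \<wp> d = 0" by simp
  also have "\<dots> \<longleftrightarrow> x - d \<in> \<Omega> \<or> x + d \<in> \<Omega>"
    unfolding wp_diff_factorization[OF assms] using assms by (simp add: sigma_eq_0_iff)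
  finally show ?thesis .
qed

text \<open>Logarithmic differentiation of the sigma factorization. Through it the order of
  \<open>\<wp> x - \<wp> d\<close> at a point becomes a sum of residues of shifted zeta
  functions.\<close>

lemma wp_log_deriv:
  assumes "d \<notin> \<Omega>" "x \<notin> \<Omega>" "x - d \<notin> \<Omega>" "x + d \<notin> \<Omega>"
  shows "((\<lambda>x. \<wp> x - \<wp> d) has_field_derivative
      (\<wp> x - \<wp> d) * (\<zeta> (x - d) + \<zeta> (x + d) - 2 * \<zeta> x)) (at x)"
proof -
  have 1: "((\<lambda>x. \<sigma> (x + a)) has_field_derivative \<sigma> (x + a) * \<zeta> (x + a)) (at x)" if "x + a \<notin> \<Omega>" for a
    using sigma_deriv[OF that] by (simp add: DERIV_shift)
  have sx: "\<sigma> x \<noteq> 0" using assms sigma_eq_0_iff by simp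
  let ?q = "\<lambda>x. \<sigma> (x + - d) * \<sigma> (x + d) / (\<sigma> x * \<sigma> x)"
  have "(?q has_field_derivative ?q x * (\<zeta> (x + - d) + \<zeta> (x + d) - (\<zeta> x + \<zeta> x))) (at x)"
    by (intro DERIV_divide_log DERIV_mult_log 1 sigma_deriv) (use assms sx in auto)
  then have "((\<lambda>x. - ?q x / (\<sigma> d)\<^sup>2) has_field_derivative
      - (?q x * (\<zeta> (x + - d) + \<zeta> (x + d) - (\<zeta> x + \<zeta> x))) / (\<sigma> d)\<^sup>2) (at x)"
    by (intro DERIV_cdivide DERIV_minus)
  also have "- (?q x * (\<zeta> (x + - d) + \<zeta> (x + d) - (\<zeta> x + \<zeta> x))) / (\<sigma> d)\<^sup>2 =
      (\<wp> x - \<wp> d) * (\<zeta> (x - d) + \<zeta> (x + d) - 2 * \<zeta> x)"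
    unfolding wp_diff_factorization[OF assms(1,2)] by (simp add: power2_eq_square)
  finally show ?thesis
    by (rule has_field_derivative_transform_within_open[OF _ open_minus_lattice])
      (use assms wp_diff_factorization[OF assms(1)] in \<open>auto simp: power2_eq_square\<close>)
qed

text \<open>Complex-valued because, at \<open>p + a\<close>, it is at once the residue of
  \<open>\<zeta> (x + a)\<close> at \<open>p\<close> and the coefficient of order 2 of
  \<open>\<wp> (x + a)\<close> there; orders are assembled from it by addition.\<close>

definition lattice_indicator :: "complex \<Rightarrow> complex" where
  "lattice_indicator x = (if x \<in> \<Omega> then 1 else 0)"

lemma zeta_comp_polar: "polar (\<lambda>x. \<zeta> (x + a)) p 1 (lattice_indicator (p + a))"
  using zeta_polar[of "p + a"] polar_raise[OF polar_analytic[OF zeta_analytic[of "p + a"]], of 1]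
  by (auto simp: polar_shift_iff lattice_indicator_def)

lemma wp_comp_polar: "polar (\<lambda>x. \<wp> (x + a)) p 2 (lattice_indicator (p + a))"
  using wp_polar[of "p + a"] polar_raise[OF polar_analytic[OF wp_analytic[of "p + a"]], of 2]
  by (auto simp: polar_shift_iff lattice_indicator_def)

lemma comp_shift_analytic: "f analytic_on {p + a} \<Longrightarrow> (\<lambda>x. f (x + a)) analytic_on {p}"
  using analytic_on_compose[of "\<lambda>x. x + a" "{p}" f] by (simp add: o_def analytic_intros)

text \<open>The factor acquired by \<open>Phi i \<alpha>\<close> under the shift
  \<open>2 * v\<close>: the sigma quotient contributes the first term of the exponent,
  \<open>exp (\<zeta> \<alpha> * x)\<close> the second. The half period cancels in the quotient, so
  all four functions share it.\<close>

definition multiplier :: "complex \<Rightarrow> complex \<Rightarrow> complex" where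
  "multiplier \<alpha> v = exp (- 2 * \<zeta> v * \<alpha> + 2 * v * \<zeta> \<alpha>)"

lemma Phi_shift:
  assumes "2 * v \<in> \<Omega>" "v \<notin> \<Omega>"
  shows "Phi i \<alpha> (x + 2 * v) = multiplier \<alpha> v * Phi i \<alpha> x"
proof -
  let ?u = "x + half_period i"
  have 1: "\<sigma> (x + 2 * v + half_period i - \<alpha>) = - exp (2 * \<zeta> v * (?u - \<alpha> + v)) * \<sigma> (?u - \<alpha>)"
    using sigma_shift_half[OF assms, of "?u - \<alpha>"] by (simp add: algebra_simps)
  have 2: "\<sigma> (x + 2 * v + half_period i) = - exp (2 * \<zeta> v * (?u + v)) * \<sigma> ?u"
    using sigma_shift_half[OF assms, of ?u] by (simp add: algebra_simps)
  have "exp (2 * \<zeta> v * (?u - \<alpha> + v)) * exp (\<zeta> \<alpha> * (x + 2 * v)) =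
      multiplier \<alpha> v * exp (\<zeta> \<alpha> * x) * exp (2 * \<zeta> v * (?u + v))"
    unfolding multiplier_def exp_add[symmetric] by (simp add: algebra_simps)
  then have 3: "exp (2 * \<zeta> v * (?u - \<alpha> + v)) / exp (2 * \<zeta> v * (?u + v)) * exp (\<zeta> \<alpha> * (x + 2 * v)) =
      multiplier \<alpha> v * exp (\<zeta> \<alpha> * x)"
    by (simp add: field_simps)
  have "Phi i \<alpha> (x + 2 * v) = \<sigma> (?u - \<alpha>) / \<sigma> ?u *
      (exp (2 * \<zeta> v * (?u - \<alpha> + v)) / exp (2 * \<zeta> v * (?u + v)) * exp (\<zeta> \<alpha> * (x + 2 * v)))"
    unfolding \<Phi>_def 1 2 by (simp add: mult_ac)
  then show ?thesis unfolding 3 by (simp add: \<Phi>_def)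
qed

lemma Phi_analytic: "p + half_period i \<notin> \<Omega> \<Longrightarrow> Phi i \<alpha> analytic_on {p}"
  unfolding \<Phi>_def by (intro analytic_intros sigma_comp_analytic) (auto simp: sigma_eq_0_iff)

text \<open>The leading coefficient is \<open>\<sigma> (- \<alpha>)\<close> times an exponential,
  hence nonzero exactly when \<alpha> is not a period.\<close>

lemma Phi_polar:
  assumes "\<alpha> \<notin> \<Omega>"
  shows "\<exists>d. d \<noteq> 0 \<and> polar (Phi i \<alpha>) (- half_period i) 1 d"
proof -
  let ?u = "half_period i" and ?g = "\<lambda>x. \<sigma> (x + half_period i - \<alpha>) * exp (\<zeta> \<alpha> * x)"
  have "polar (\<lambda>x. 1 / \<sigma> (x + ?u)) (- ?u) 1 1"
    using polar_shift_iff[of "\<lambda>x. 1 / \<sigma> x" ?u "- ?u" 1 1] inverse_sigma_polar by simp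
  moreover have "?g analytic_on {- ?u}" by (intro analytic_intros sigma_comp_analytic)
  ultimately have "polar (\<lambda>x. ?g x * (1 / \<sigma> (x + ?u))) (- ?u) 1 (?g (- ?u))"
    using polar_mult[OF polar_analytic] by fastforce
  moreover have "(\<lambda>x. ?g x * (1 / \<sigma> (x + ?u))) = Phi i \<alpha>" by (auto simp: \<Phi>_def)
  moreover have "?g (- ?u) \<noteq> 0" using assms by (simp add: sigma_eq_0_iff)
  ultimately show ?thesis by (intro exI[of _ "?g (- ?u)"] conjI) (simp_all only: not_False_eq_True)
qed

lemma open_off_shifted_lattice: "open {x. x + a \<notin> \<Omega>}"
  using open_diff_sparse_pts[OF open_UNIV sparse_shift_lattice[of a]]
  by (simp add: Collect_neg_eq Compl_eq_Diff_UNIV)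

lemma higher_deriv_shift_lattice:
  assumes an: "\<And>p. p + a \<notin> \<Omega> \<Longrightarrow> f analytic_on {p}" and v: "v \<in> \<Omega>"
    and shift: "\<And>x. x + a \<notin> \<Omega> \<Longrightarrow> f (x + v) = B * f x" and x: "x + a \<notin> \<Omega>"
  shows "(deriv ^^ j) f (x + v) = B * (deriv ^^ j) f x"
proof (rule higher_deriv_quasi_periodic[OF open_off_shifted_lattice])
  show "f holomorphic_on {x. x + a \<notin> \<Omega>}"
    using an analytic_on_analytic_at analytic_imp_holomorphic by blast
  have *: "x + v + a = x + a + v" for x by simp
  show "x + v \<in> {x. x + a \<notin> \<Omega>}" if "x \<in> {x. x + a \<notin> \<Omega>}" for x
    using that lattice_add_iff[OF v, of "x + a"] unfolding * mem_Collect_eq by simp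
qed (use shift x in auto)

lemma higher_deriv_Phi_shift:
  assumes "2 * v \<in> \<Omega>" "v \<notin> \<Omega>" "x \<notin> H" "i \<in> {0..3}"
  shows "(deriv ^^ j) (Phi i \<alpha>) (x + 2 * v) = multiplier \<alpha> v * (deriv ^^ j) (Phi i \<alpha>) x"
  by (rule higher_deriv_shift_lattice[of "half_period i"])
    (use assms Phi_analytic Phi_shift half_periods_iff in auto)

lemma higher_deriv_wp_shift:
  assumes "w \<in> \<Omega>" "x + a \<notin> \<Omega>"
  shows "(deriv ^^ j) (\<lambda>x. \<wp> (x + a)) (x + w) = (deriv ^^ j) (\<lambda>x. \<wp> (x + a)) x"
proof -
  have "\<wp> (y + w + a) = 1 * \<wp> (y + a)" if "y + a \<notin> \<Omega>" for y
    using wp_shift[OF assms(1) that] by (simp add: add_ac)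
  then have "(deriv ^^ j) (\<lambda>x. \<wp> (x + a)) (x + w) = 1 * (deriv ^^ j) (\<lambda>x. \<wp> (x + a)) x"
    by (intro higher_deriv_shift_lattice[of a])
      (use assms in \<open>auto intro!: comp_shift_analytic wp_analytic\<close>)
  then show ?thesis by simp
qed

section \<open>Removal of principal parts at the half periods\<close>

lemma polar_half_period_basis:
  assumes "quasi_periodic f B C" "\<And>i. i \<in> {0..3} \<Longrightarrow> \<exists>c. polar f (- half_period i) (n i) c"
    "p + half_period i \<in> \<Omega>" "i \<in> {0..3}"
  shows "\<exists>c. polar f p (n i) c"
proof -
  obtain c where "polar f (- half_period i) (n i) c" using assms(2,4) by blast
  from quasi_periodic_polar[OF assms(1) this assms(3)] show ?thesis by simp
qed

lemma quasi_periodic_sum: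
  assumes "finite A" "\<And>i. i \<in> A \<Longrightarrow> quasi_periodic (f i) B C" "B \<noteq> 0" "C \<noteq> 0"
  shows "quasi_periodic (\<lambda>x. \<Sum>i\<in>A. f i x) B C"
  using assms
proof (induction A)
  case empty
  then show ?case by (simp add: quasi_periodic_def)
next
  case (insert i A)
  have "quasi_periodic (\<lambda>x. f i x + (\<Sum>i\<in>A. f i x)) B C"
    by (rule quasi_periodic_add) (use insert in auto)
  then show ?case using insert by simp
qed

text \<open>The base points are \<open>- half_period i\<close> because there
  \<open>x + half_period i\<close> vanishes, the argument in which \<open>Phi i \<alpha>\<close> and
  the shifted \<wp> become singular.\<close>

definition half_period_poles :: "(complex \<Rightarrow> complex) \<Rightarrow> (nat \<Rightarrow> nat) \<Rightarrow> bool" where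
  "half_period_poles f n \<longleftrightarrow>
     (\<forall>i\<in>{0..3}. \<exists>c. polar f (- half_period i) (n i) c) \<and> (\<forall>p. p \<notin> H \<longrightarrow> (\<exists>c. polar f p 0 c))"

lemma half_period_polesI:
  assumes "\<And>i. i \<in> {0..3} \<Longrightarrow> \<exists>c. polar f (- half_period i) (n i) c" "\<And>p. p \<notin> H \<Longrightarrow> \<exists>c. polar f p 0 c"
  shows "half_period_poles f n"
  using assms by (simp add: half_period_poles_def)

lemma half_period_polesD:
  assumes "half_period_poles f n"
  shows "i \<in> {0..3} \<Longrightarrow> \<exists>c. polar f (- half_period i) (n i) c" "p \<notin> H \<Longrightarrow> \<exists>c. polar f p 0 c"
  using assms by (simp_all add: half_period_poles_def)

text \<open>The four classes do not interact: functions with index k are regular at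
  \<open>- half_period i\<close> for k different from i, so the eliminations by
  \<open>polar_reduce\<close> at the four points are independent and their corrections can be
  subtracted together.\<close>

lemma half_period_reduce:
  assumes f: "quasi_periodic f B C"
    and f_poles: "half_period_poles f n"
    and G: "\<And>i j. i \<in> {0..3} \<Longrightarrow> quasi_periodic (G i j) B C"
      "\<And>i j. i \<in> {0..3} \<Longrightarrow> \<exists>d. d \<noteq> 0 \<and> polar (G i j) (- half_period i) (Suc (j + lo)) d"
      "\<And>i j p. i \<in> {0..3} \<Longrightarrow> p + half_period i \<notin> \<Omega> \<Longrightarrow> \<exists>c. polar (G i j) p 0 c"
  shows "\<exists>b F. F = (\<lambda>x. f x - (\<Sum>i=0..3. \<Sum>j<n i - lo. b i j * G i j x)) \<and>
    quasi_periodic F B C \<and> half_period_poles F (\<lambda>i. min (n i) lo)"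
proof -
  let ?s = "\<lambda>b i x. \<Sum>j<n i - lo. b i j * G i j x"
  let ?F = "\<lambda>b x. f x - (\<Sum>i=0..3. ?s b i x)"
  note poles = half_period_polesD(1)[OF f_poles] and reg = half_period_polesD(2)[OF f_poles]
  have "\<exists>b d. polar (\<lambda>x. f x - (\<Sum>j<n i - lo. b j * G i j x)) (- half_period i) (min (n i) lo) d"
    if "i \<in> {0..3}" for i
  proof -
    obtain c where "polar f (- half_period i) (n i) c" using poles \<open>i \<in> {0..3}\<close> by blast
    from polar_reduce[of "G i", OF G(2)[OF that] this] show ?thesis .
  qed
  then obtain b where b: "\<And>i. i \<in> {0..3} \<Longrightarrow>
      \<exists>d. polar (\<lambda>x. f x - (\<Sum>j<n i - lo. b i j * G i j x)) (- half_period i) (min (n i) lo) d"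
    by metis
  have Gsum: "\<exists>c. polar (?s b i) p m c"
    if "i \<in> {0..3}" "p + half_period i \<notin> \<Omega>" for i p m
  proof -
    have "\<exists>c. polar (G i j) p m c" for j
      using G(3)[OF that, of j] polar_raise_le by blast
    then obtain c where "\<And>j. polar (G i j) p m (c j)" by metis
    then have "polar (?s b i) p m (\<Sum>j<n i - lo. b i j * c j)"
      by (intro polar_sum polar_cmult)
    then show ?thesis by blast
  qed
  show ?thesis
  proof (intro exI[of _ b] exI[of _ "?F b"] conjI half_period_polesI refl)
    have BC: "B \<noteq> 0" "C \<noteq> 0" using quasi_periodicD[OF f] by auto
    show "quasi_periodic (?F b) B C"
      by (intro quasi_periodic_diff f quasi_periodic_sum quasi_periodic_cmult G BC) auto
    show "\<exists>c. polar (?F b) p 0 c" if "p \<notin> H" for p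
    proof -
      obtain c where c: "polar f p 0 c" using reg \<open>p \<notin> H\<close> by blast
      have "\<exists>c. polar (?s b i) p 0 c" if "i \<in> {0..3}" for i
        using Gsum[OF that] \<open>p \<notin> H\<close> that half_periods_iff by blast
      then obtain d where d: "\<And>i. i \<in> {0..3} \<Longrightarrow> polar (?s b i) p 0 (d i)" by metis
      show ?thesis by (rule exI, rule polar_diff[OF c], rule polar_sum, rule d)
    qed
    show "\<exists>c. polar (?F b) (- half_period i) (min (n i) lo) c"
      if i: "i \<in> {0..3}" for i
    proof -
      let ?p = "- half_period i" and ?m = "min (n i) lo"
      obtain c where c: "polar (\<lambda>x. f x - ?s b i x) ?p ?m c" using b[OF i] by blast
      have "\<exists>c. polar (?s b k) ?p ?m c" if "k \<in> {0..3} - {i}" for k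
        using Gsum[of k ?p ?m] half_period_diff[of i k] i that by simp
      then obtain d where d: "\<And>k. k \<in> {0..3} - {i} \<Longrightarrow> polar (?s b k) ?p ?m (d k)" by metis
      have "\<exists>c. polar (\<lambda>x. f x - ?s b i x - (\<Sum>k\<in>{0..3} - {i}. ?s b k x)) ?p ?m c"
        by (rule exI, rule polar_diff[OF c], rule polar_sum, rule d)
      moreover have "f x - ?s b i x - (\<Sum>k\<in>{0..3} - {i}. ?s b k x) = f x - (\<Sum>k=0..3. ?s b k x)" for x
        using i by (subst sum.remove[of "{0..3}" i "\<lambda>k. ?s b k x"]) auto
      ultimately show ?thesis by simp
    qed
  qed
qed

lemma quasi_periodic_pointwise:
  assumes "\<And>x. x \<notin> H \<Longrightarrow> f (x + 2 * \<omega>\<^sub>1) = B * f x" "\<And>x. x \<notin> H \<Longrightarrow> f (x + 2 * \<omega>\<^sub>3) = C * f x"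
    "B \<noteq> 0" "C \<noteq> 0"
  shows "quasi_periodic f B C"
  by (rule quasi_periodicI[OF assms(3,4) eventually_mono[OF eventually_off_half_periods]
        eventually_mono[OF eventually_off_half_periods]]) (rule assms(1,2), assumption)+

text \<open>
  Dividing by \<open>Phi 0 \<alpha>\<close> would give an elliptic function with a single simple pole at \<open>\<alpha>\<close> and
  a zero at \<open>0\<close>.
\<close>

lemma quasi_periodic_entire_zero:
  assumes F: "quasi_periodic F (multiplier \<alpha> \<omega>\<^sub>1) (multiplier \<alpha> \<omega>\<^sub>3)" and \<alpha>: "\<alpha> \<notin> \<Omega>"
    and reg: "\<And>p. \<exists>c. polar F p 0 c"
  shows "\<forall>\<^sub>F x in at p. F x = 0"
proof -
  \<comment> \<open>The reciprocal of \<open>Phi 0 \<alpha>\<close> translated by \<alpha>; the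
    translation places the possible pole of the product at 0, where
    \<open>elliptic_single_simple_pole\<close> expects it.\<close>
  define k where "k x = \<sigma> (x + \<alpha>) * exp (- \<zeta> \<alpha> * (x + \<alpha>)) * (1 / \<sigma> x)" for x
  define K where "K x = F (x + \<alpha>) * k x" for x
  have k_shift: "k (x + 2 * v) = k x / multiplier \<alpha> v" if "2 * v \<in> \<Omega>" "v \<notin> \<Omega>" for x v
  proof -
    have 1: "\<sigma> (x + 2 * v + \<alpha>) = - exp (2 * \<zeta> v * (x + \<alpha> + v)) * \<sigma> (x + \<alpha>)"
      using sigma_shift_half[OF that, of "x + \<alpha>"] by (simp add: algebra_simps)
    have "exp (2 * \<zeta> v * (x + \<alpha> + v)) * exp (- \<zeta> \<alpha> * (x + 2 * v + \<alpha>)) * multiplier \<alpha> v =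
        exp (- \<zeta> \<alpha> * (x + \<alpha>)) * exp (2 * \<zeta> v * (x + v))"
      unfolding multiplier_def exp_add[symmetric] by (simp add: algebra_simps)
    then have "exp (2 * \<zeta> v * (x + \<alpha> + v)) * exp (- \<zeta> \<alpha> * (x + 2 * v + \<alpha>)) / exp (2 * \<zeta> v * (x + v)) =
        exp (- \<zeta> \<alpha> * (x + \<alpha>)) / multiplier \<alpha> v"
      by (simp add: divide_simps multiplier_def)
    moreover have "k (x + 2 * v) = \<sigma> (x + \<alpha>) * (1 / \<sigma> x) *
        (exp (2 * \<zeta> v * (x + \<alpha> + v)) * exp (- \<zeta> \<alpha> * (x + 2 * v + \<alpha>)) / exp (2 * \<zeta> v * (x + v)))"
      unfolding k_def 1 sigma_shift_half[OF that, of x] by (simp add: mult_ac)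
    ultimately show ?thesis by (simp add: k_def mult_ac)
  qed
  have mult0: "multiplier \<alpha> v \<noteq> 0" for v by (simp add: multiplier_def)
  have K: "quasi_periodic K 1 1"
  proof (rule quasi_periodicI)
    have *: "\<forall>\<^sub>F x in at p. K (x + 2 * v) = 1 * K x"
      if F_v: "\<And>p. \<forall>\<^sub>F x in at p. F (x + 2 * v) = multiplier \<alpha> v * F x" and v: "2 * v \<in> \<Omega>" "v \<notin> \<Omega>" for v p
    proof -
      have "\<forall>\<^sub>F x in at p. F (x + \<alpha> + 2 * v) = multiplier \<alpha> v * F (x + \<alpha>)"
        using F_v[of "p + \<alpha>"]
          at_shift[where P = "\<lambda>x. F (x + 2 * v) = multiplier \<alpha> v * F x" and p = "p + \<alpha>" and w = \<alpha>]
        by simp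
      then show ?thesis
        by eventually_elim (use mult0 v in \<open>simp add: K_def k_shift add_ac\<close>)
    qed
    show "\<forall>\<^sub>F x in at p. K (x + 2 * \<omega>\<^sub>1) = 1 * K x" "\<forall>\<^sub>F x in at p. K (x + 2 * \<omega>\<^sub>3) = 1 * K x" for p
      by (rule *; simp add: half_period_not_in_lattice quasi_periodicD[OF F])+
  qed auto
  have F_shift: "\<exists>c. polar (\<lambda>x. F (x + \<alpha>)) q 0 c" for q
    using reg by (simp add: polar_shift_iff)
  have k_an: "k analytic_on {q}" if "q \<notin> \<Omega>" for q
    unfolding k_def[abs_def] by (intro analytic_intros sigma_comp_analytic sigma_analytic)
      (use that sigma_eq_0_iff in auto)
  have Kreg: "\<exists>c. polar K q 0 c" if "q \<notin> \<Omega>" for q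
  proof -
    obtain c where "polar (\<lambda>x. F (x + \<alpha>)) q 0 c" using F_shift by blast
    from polar_mult[OF this polar_analytic[OF k_an[OF that]]] show ?thesis unfolding K_def by auto
  qed
  have "\<exists>c. polar K 0 1 c"
  proof -
    obtain c where c: "polar (\<lambda>x. F (x + \<alpha>)) 0 0 c" using F_shift by blast
    have "(\<lambda>x. \<sigma> (x + \<alpha>) * exp (- \<zeta> \<alpha> * (x + \<alpha>))) analytic_on {0}"
      by (intro analytic_intros sigma_comp_analytic)
    from polar_mult[OF polar_analytic[OF this] inverse_sigma_polar]
    obtain d where "polar k 0 (0 + 1) d"
      unfolding k_def[abs_def] by blast
    from polar_mult[OF c this] show ?thesis unfolding K_def by auto
  qed
  then obtain b where b: "\<And>p. \<forall>\<^sub>F x in at p. K x = b"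
    using elliptic_single_simple_pole[OF K Kreg] by blast
  \<comment> \<open>At \<open>- \<alpha>\<close> the factor \<open>\<sigma> (x + \<alpha>)\<close>
    vanishes, the translate of F is regular, and \<open>\<sigma> x\<close> in the denominator is
    nonzero.\<close>
  have "b = 0"
  proof -
    obtain c where "polar (\<lambda>x. F (x + \<alpha>)) (- \<alpha>) 0 c" using F_shift by blast
    moreover have "- \<alpha> \<notin> \<Omega>" using \<alpha> by simp
    ultimately have "polar (\<lambda>x. F (x + \<alpha>) * k x) (- \<alpha>) (0 + 0) (c * k (- \<alpha>))"
      by (intro polar_mult polar_analytic k_an)
    moreover have "k (- \<alpha>) = 0" by (simp add: k_def sigma_eq_0_iff)
    ultimately have "polar K (- \<alpha>) 0 0" unfolding K_def by simp
    from polar_unique[OF polar_cong[OF this b] polar_const] show ?thesis by simp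
  qed
  have "\<forall>\<^sub>F x in at (p - \<alpha>). F (x + \<alpha>) = 0"
    using b[of "p - \<alpha>"] eventually_off_lattice[of "p - \<alpha>"] eventually_off_shifted_lattice[of \<alpha> "p - \<alpha>"]
    by eventually_elim (use \<open>b = 0\<close> in \<open>auto simp: K_def k_def sigma_eq_0_iff\<close>)
  then show ?thesis using at_shift[where P = "\<lambda>x. F x = 0" and p = p and w = \<alpha>] by simp
qed

end

section \<open>Pointwise identities and the representations (a) and (b)\<close>

lemma nicely_meromorphic_polar_analytic:
  assumes "f nicely_meromorphic_on UNIV" "polar f p 0 c"
  shows "f analytic_on {p}"
proof -
  have "f \<midarrow>p\<rightarrow> c" using polar_lim[OF assms(2)] by simp
  then have "\<not> is_pole f p"
    unfolding is_pole_def using not_tendsto_and_filterlim_at_infinity[OF trivial_limit_at] by blast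
  then show ?thesis using nicely_meromorphic_on_imp_analytic_at[OF assms(1)] by simp
qed

text \<open>The value of a nicely meromorphic function is its limit, or 0 at a pole, so it is
  determined by punctured neighbourhoods. Hence the shift relation holds at every point, poles
  included.\<close>

lemma nicely_meromorphic_shift_eq:
  assumes f: "f nicely_meromorphic_on UNIV" and ev: "\<forall>\<^sub>F x in at p. f (x + v) = B * f x"
  shows "f (p + v) = B * f p"
proof -
  let ?g = "\<lambda>x. B * f x"
  have g: "?g nicely_meromorphic_on UNIV" using f by (rule nicely_meromorphic_on_cmult_left)
  have g_cases: "is_pole ?g p \<and> ?g p = 0 \<or> ?g \<midarrow>p\<rightarrow> ?g p"
    using g by (auto simp: nicely_meromorphic_on_def)
  have at: "at (p + v) = filtermap (\<lambda>x. x + v) (at p)"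
    using filtermap_at_shift[of "- v" p] by simp
  have no: False if "is_pole ?g p" "?g \<midarrow>p\<rightarrow> c" for c
    using that unfolding is_pole_def
    using not_tendsto_and_filterlim_at_infinity[OF trivial_limit_at] by blast
  have "is_pole f (p + v) \<and> f (p + v) = 0 \<or> f \<midarrow>p + v\<rightarrow> f (p + v)"
    using f by (auto simp: nicely_meromorphic_on_def)
  then show ?thesis
  proof (elim disjE conjE)
    assume pole: "is_pole f (p + v)" and 0: "f (p + v) = 0"
    from pole have "filterlim (\<lambda>x. f (x + v)) at_infinity (at p)"
      unfolding is_pole_def at filterlim_filtermap .
    then have "filterlim ?g at_infinity (at p)"
      by (rule filterlim_cong[OF refl refl ev, THEN iffD1])
    then show ?thesis using no g_cases 0 unfolding is_pole_def by metis
  next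
    assume "f \<midarrow>p + v\<rightarrow> f (p + v)"
    then have "((\<lambda>x. f (x + v)) \<longlongrightarrow> f (p + v)) (at p)"
      unfolding at filterlim_filtermap .
    then have lim: "?g \<midarrow>p\<rightarrow> f (p + v)"
      by (rule Lim_transform_eventually[OF _ ev])
    then have "?g \<midarrow>p\<rightarrow> ?g p" using no g_cases by metis
    from tendsto_unique[OF trivial_limit_at lim this] show ?thesis .
  qed
qed

context complex_lattice
begin

lemma quasi_periodic_exp: "quasi_periodic (\<lambda>x. exp (k * x)) (exp (2 * k * \<omega>\<^sub>1)) (exp (2 * k * \<omega>\<^sub>3))"
  by (rule quasi_periodicI) (auto simp: exp_add[symmetric] algebra_simps)

lemma exp_polar_mult:
  assumes "\<exists>c. polar f p n c"
  shows "\<exists>c. polar (\<lambda>x. exp (k * x) * f x) p n c"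
proof -
  obtain c where "polar f p n c" using assms by blast
  moreover have "(\<lambda>x. exp (k * x)) analytic_on {p}" by (intro analytic_intros)
  ultimately have "polar (\<lambda>x. exp (k * x) * f x) p (0 + n) (exp (k * p) * c)"
    by (intro polar_mult polar_analytic)
  then show ?thesis by auto
qed

text \<open>Division by \<open>exp (\<kappa> * x)\<close> leaves exactly the multipliers of
  \<open>Phi i \<alpha>\<close>. As their poles are simple (lo = 0), their derivatives exhaust all
  principal parts, and \<open>quasi_periodic_entire_zero\<close> disposes of the remainder.\<close>

lemma representation_a:
  assumes f: "f nicely_meromorphic_on UNIV" and \<alpha>: "\<alpha> \<notin> \<Omega>"
    and qp: "quasi_periodic f (exp (2 * \<kappa> * \<omega>\<^sub>1) * multiplier \<alpha> \<omega>\<^sub>1) (exp (2 * \<kappa> * \<omega>\<^sub>3) * multiplier \<alpha> \<omega>\<^sub>3)"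
    and poles: "half_period_poles f n"
  shows "\<exists>b. \<forall>x. x \<notin> H \<longrightarrow>
    f x = exp (\<kappa> * x) * (\<Sum>i=0..3. \<Sum>j<n i. b i j * (deriv ^^ j) (Phi i \<alpha>) x)"
proof -
  define g where "g x = exp (- \<kappa> * x) * f x" for x
  define G where "G i j = (deriv ^^ j) (Phi i \<alpha>)" for i j
  have G_an: "G i j analytic_on {p}" if "p + half_period i \<notin> \<Omega>" for i j p
    unfolding G_def using analytic_higher_deriv[OF Phi_analytic[OF that]] .
  have g: "quasi_periodic g (multiplier \<alpha> \<omega>\<^sub>1) (multiplier \<alpha> \<omega>\<^sub>3)"
    using quasi_periodic_mult[OF quasi_periodic_exp[of "- \<kappa>"] qp]
    unfolding g_def[abs_def] mult.assoc[symmetric] exp_add[symmetric] by simp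
  have "\<exists>b F. F = (\<lambda>x. g x - (\<Sum>i=0..3. \<Sum>j<n i - 0. b i j * G i j x)) \<and>
      quasi_periodic F (multiplier \<alpha> \<omega>\<^sub>1) (multiplier \<alpha> \<omega>\<^sub>3) \<and> half_period_poles F (\<lambda>i. min (n i) 0)"
  proof (rule half_period_reduce[OF g, of n G 0])
    show "half_period_poles g n"
      unfolding g_def by (intro half_period_polesI exp_polar_mult half_period_polesD[OF poles])
    show "quasi_periodic (G i j) (multiplier \<alpha> \<omega>\<^sub>1) (multiplier \<alpha> \<omega>\<^sub>3)" if "i \<in> {0..3}" for i j
      unfolding G_def
      by (rule quasi_periodic_pointwise)
        (use that higher_deriv_Phi_shift half_period_not_in_lattice in \<open>auto simp: multiplier_def\<close>)
    show "\<exists>d. d \<noteq> 0 \<and> polar (G i j) (- half_period i) (Suc (j + 0)) d" for i j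
    proof -
      obtain d where "d \<noteq> 0" "polar (Phi i \<alpha>) (- half_period i) (Suc 0) d"
        using Phi_polar[OF \<alpha>, of i] by auto
      with polar_higher_deriv[OF this(2), of j] show ?thesis unfolding G_def by auto
    qed
    show "\<exists>c. polar (G i j) p 0 c" if "p + half_period i \<notin> \<Omega>" for i j p
      using polar_analytic[OF G_an[OF that]] by blast
  qed
  then obtain b F where F_def: "F = (\<lambda>x. g x - (\<Sum>i=0..3. \<Sum>j<n i. b i j * G i j x))"
    and F_qp: "quasi_periodic F (multiplier \<alpha> \<omega>\<^sub>1) (multiplier \<alpha> \<omega>\<^sub>3)"
    and F_poles: "half_period_poles F (\<lambda>_. 0)"
    by auto
  note F = F_qp half_period_polesD[OF F_poles]
  have "\<exists>c. polar F p 0 c" for p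
    using polar_half_period_basis[OF F(1), of "\<lambda>_. 0" p] F(2,3) half_periods_iff by blast
  from quasi_periodic_entire_zero[OF F(1) \<alpha> this] have F0: "\<forall>\<^sub>F x in at p. F x = 0" for p .
  show ?thesis
  proof (intro exI allI impI)
    fix x assume x: "x \<notin> H"
    have x': "x + half_period i \<notin> \<Omega>" if "i \<in> {0..3}" for i using x that half_periods_iff by blast
    obtain c where "polar f x 0 c" using half_period_polesD(2)[OF poles x] by blast
    then have "f analytic_on {x}" by (rule nicely_meromorphic_polar_analytic[OF f])
    then have "F analytic_on {x}"
      unfolding F_def g_def by (intro analytic_intros G_an x')
    then have "F x = 0"
      using analytic_eq_at[of F x "\<lambda>_. 0"] F0 by simp
    then have "exp (- \<kappa> * x) * f x = (\<Sum>i=0..3. \<Sum>j<n i. b i j * G i j x)" (is "_ = ?r")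
      by (simp add: F_def g_def)
    then have "f x = exp (\<kappa> * x) * ?r" by (simp add: exp_minus field_simps)
    then show "f x = exp (\<kappa> * x) * (\<Sum>i=0..3. \<Sum>j<n i. b i j * (deriv ^^ j) (Phi i \<alpha>) x)"
      by (simp add: G_def)
  qed
qed

lemma half_period_notin: "i \<in> {1..3} \<Longrightarrow> half_period i \<notin> \<Omega>"
  using half_period_diff[of 0 i] by (auto simp: half_period_simps)

text \<open>The quotient is the logarithmic derivative of \<wp>(x) - \<wp>(d) for d a nonzero half
  period. The first two zeta terms then have their poles at congruent points, so the residue there
  is 2.\<close>

lemma wp_quotient_eq:
  assumes "i \<in> {1..3}" "x \<notin> H"
  shows "deriv \<wp> x / (\<wp> x - e \<omega>\<^sub>1 \<omega>\<^sub>3 i) =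
    \<zeta> (x + - half_period i) + \<zeta> (x + half_period i) + - 2 * \<zeta> (x + 0)"
    and "\<wp> x \<noteq> e \<omega>\<^sub>1 \<omega>\<^sub>3 i"
proof -
  let ?u = "half_period i"
  have x: "x \<notin> \<Omega>" "x + ?u \<notin> \<Omega>"
    using assms half_periods_iff lattice_subset_half_periods by auto
  have "x - ?u \<notin> \<Omega>"
    using x(2) lattice_diff_iff[OF half_period_double[of i], of "x + ?u"] by (simp add: algebra_simps)
  note x = x this and u = half_period_notin[OF assms(1)]
  show ne: "\<wp> x \<noteq> e \<omega>\<^sub>1 \<omega>\<^sub>3 i"
    using wp_eq_iff[OF u x(1)] x by (simp add: e_def)
  have "((\<lambda>x. \<wp> x - \<wp> ?u) has_field_derivative deriv \<wp> x - 0) (at x)"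
    using DERIV_imp_deriv[OF wp_deriv[OF x(1)]] wp_deriv[OF x(1)] by (intro DERIV_diff DERIV_const) simp
  from DERIV_unique[OF this wp_log_deriv[OF u x(1) x(3) x(2)]]
  have "deriv \<wp> x = (\<wp> x - \<wp> ?u) * (\<zeta> (x - ?u) + \<zeta> (x + ?u) - 2 * \<zeta> x)" by simp
  then show "deriv \<wp> x / (\<wp> x - e \<omega>\<^sub>1 \<omega>\<^sub>3 i) = \<zeta> (x + - ?u) + \<zeta> (x + ?u) + - 2 * \<zeta> (x + 0)"
    using ne by (simp add: e_def)
qed

lemma wp_quotient_polar:
  assumes "i \<in> {1..3}"
  shows "polar (\<lambda>x. deriv \<wp> x / (\<wp> x - e \<omega>\<^sub>1 \<omega>\<^sub>3 i)) p 1
    (lattice_indicator (p + - half_period i) + lattice_indicator (p + half_period i) + - 2 * lattice_indicator (p + 0))"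
proof (rule polar_cong)
  show "polar (\<lambda>x. \<zeta> (x + - half_period i) + \<zeta> (x + half_period i) + - 2 * \<zeta> (x + 0)) p 1
    (lattice_indicator (p + - half_period i) + lattice_indicator (p + half_period i) + - 2 * lattice_indicator (p + 0))"
    by (intro polar_add polar_cmult zeta_comp_polar)
  show "\<forall>\<^sub>F x in at p. \<zeta> (x + - half_period i) + \<zeta> (x + half_period i) + - 2 * \<zeta> (x + 0) =
      deriv \<wp> x / (\<wp> x - e \<omega>\<^sub>1 \<omega>\<^sub>3 i)"
    using eventually_off_half_periods by (rule eventually_mono) (rule wp_quotient_eq(1)[OF assms, symmetric])
qed

lemma wp_quotient_analytic:
  assumes "i \<in> {1..3}" "x \<notin> H"
  shows "(\<lambda>x. deriv \<wp> x / (\<wp> x - e \<omega>\<^sub>1 \<omega>\<^sub>3 i)) analytic_on {x}"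
proof -
  have "\<wp> analytic_on {x}" using assms lattice_subset_half_periods by (intro wp_analytic) auto
  then show ?thesis
    using wp_quotient_eq(2)[OF assms] by (intro analytic_intros analytic_deriv) auto
qed

lemma deriv_wp_shift:
  assumes "w \<in> \<Omega>" "x \<notin> \<Omega>"
  shows "deriv \<wp> (x + w) = deriv \<wp> x"
  using higher_deriv_wp_shift[OF assms(1), of x 0 1] assms(2) by simp

lemma wp_quotient_shift:
  assumes "w \<in> \<Omega>" "x \<notin> \<Omega>"
  shows "deriv \<wp> (x + w) / (\<wp> (x + w) - a) = deriv \<wp> x / (\<wp> x - a)"
  using deriv_wp_shift[OF assms] wp_shift[OF assms] by simp

text \<open>Derivatives of \<wp> start with a double pole (lo = 1), so simple poles may survive in
  all four classes. The quotients by \<open>\<wp> x - e \<omega>\<^sub>1 \<omega>\<^sub>3 i\<close>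
  transfer those at the three nonzero half periods to the class of 0, where a lone simple pole is
  impossible.\<close>

lemma representation_b:
  assumes f: "f nicely_meromorphic_on UNIV"
    and qp: "quasi_periodic f (exp (2 * \<kappa> * \<omega>\<^sub>1)) (exp (2 * \<kappa> * \<omega>\<^sub>3))"
    and poles: "half_period_poles f n"
  shows "\<exists>c0 c b. \<forall>x. x \<notin> H \<longrightarrow>
    f x = exp (\<kappa> * x) * (c0 +
      (\<Sum>i=0..3. \<Sum>j<n i - 1. b i j * (deriv ^^ j) (\<lambda>y. \<wp> (y + half_period i)) x) +
      (\<Sum>i=1..3. c i * (deriv \<wp> x / (\<wp> x - e \<omega>\<^sub>1 \<omega>\<^sub>3 i))))"
proof -
  define g where "g x = exp (- \<kappa> * x) * f x" for x
  define G where "G i j = (deriv ^^ j) (\<lambda>y. \<wp> (y + half_period i))" for i j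
  define q where "q i x = deriv \<wp> x / (\<wp> x - e \<omega>\<^sub>1 \<omega>\<^sub>3 i)" for i x
  have G_an: "G i j analytic_on {p}" if "p + half_period i \<notin> \<Omega>" for i j p
    unfolding G_def by (intro analytic_higher_deriv comp_shift_analytic wp_analytic that)
  have q_an: "q i analytic_on {p}" if "i \<in> {1..3}" "p \<notin> H" for i p
    unfolding q_def[abs_def] by (rule wp_quotient_analytic[OF that])
  have g: "quasi_periodic g 1 1"
    using quasi_periodic_mult[OF quasi_periodic_exp[of "- \<kappa>"] qp]
    unfolding g_def[abs_def] mult.assoc[symmetric] exp_add[symmetric] by simp
  have "\<exists>b F. F = (\<lambda>x. g x - (\<Sum>i=0..3. \<Sum>j<n i - 1. b i j * G i j x)) \<and>
      quasi_periodic F 1 1 \<and> half_period_poles F (\<lambda>i. min (n i) 1)"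
  proof (rule half_period_reduce[OF g, of n G 1])
    show "half_period_poles g n"
      unfolding g_def by (intro half_period_polesI exp_polar_mult half_period_polesD[OF poles])
    show "quasi_periodic (G i j) 1 1" if "i \<in> {0..3}" for i j
      unfolding G_def
      by (rule quasi_periodic_pointwise) (use that higher_deriv_wp_shift half_periods_iff in auto)
    show "\<exists>d. d \<noteq> 0 \<and> polar (G i j) (- half_period i) (Suc (j + 1)) d" for i j
    proof -
      have "polar (\<lambda>y. \<wp> (y + half_period i)) (- half_period i) (Suc 1) 1"
        using wp_comp_polar[of "half_period i" "- half_period i"] by (simp add: numeral_2_eq_2 lattice_indicator_def)
      from polar_higher_deriv[OF this, of j] show ?thesis unfolding G_def by (auto simp: add.commute)
    qed
    show "\<exists>c. polar (G i j) p 0 c" if "p + half_period i \<notin> \<Omega>" for i j p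
      using polar_analytic[OF G_an[OF that]] by blast
  qed
  then obtain b F where F_def: "F = (\<lambda>x. g x - (\<Sum>i=0..3. \<Sum>j<n i - 1. b i j * G i j x))"
    and F_qp: "quasi_periodic F 1 1" and F_poles: "half_period_poles F (\<lambda>i. min (n i) 1)"
    by blast
  have F: "quasi_periodic F 1 1" "\<And>p. p \<notin> H \<Longrightarrow> \<exists>c. polar F p 0 c"
    using F_qp half_period_polesD(2)[OF F_poles] by auto
  have "\<exists>c. polar F (- half_period i) 1 c" if "i \<in> {0..3}" for i
    using half_period_polesD(1)[OF F_poles that] polar_raise_le[of F _ "min (n i) 1" _ 1] by auto
  then obtain d where d: "\<And>i. i \<in> {0..3} \<Longrightarrow> polar F (- half_period i) 1 (d i)"
    by metis
  \<comment> \<open>The residue of \<open>q i\<close> at \<open>- half_period i\<close> is 2, whence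
    \<open>d i / 2\<close>; the compensating residue -2 sits on the lattice.\<close>
  define R where "R x = F x - (\<Sum>i=1..3. d i / 2 * q i x)" for x
  have q_polar: "polar (q i) (- half_period k) 1 (if k = 0 then - 2 else if k = i then 2 else 0)"
    if "i \<in> {1..3}" "k \<in> {0..3}" for i k
  proof -
    have "- half_period k + half_period i \<in> \<Omega> \<longleftrightarrow> k = i"
      using half_period_diff[of k i] that by auto
    moreover have "- half_period k + - half_period i \<in> \<Omega> \<longleftrightarrow> - half_period k + half_period i \<in> \<Omega>"
      using lattice_diff_iff[OF half_period_double[of i], of "- half_period k + half_period i"]
      by (simp add: algebra_simps)
    moreover have "- half_period k + 0 \<in> \<Omega> \<longleftrightarrow> k = 0"
      using half_period_notin[of k] that by (cases "k = 0") (auto simp: half_period_simps)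
    ultimately show ?thesis
      using wp_quotient_polar[OF that(1), of "- half_period k"] that
      unfolding q_def[abs_def] lattice_indicator_def by (auto split: if_splits)
  qed
  have R_qp: "quasi_periodic R 1 1"
    unfolding R_def[abs_def]
  proof (intro quasi_periodic_diff F(1) quasi_periodic_sum quasi_periodic_cmult)
    show "quasi_periodic (q i) 1 1" for i
      unfolding q_def[abs_def]
      by (rule quasi_periodic_pointwise) (simp_all add: wp_quotient_shift contra_subsetD[OF lattice_subset_half_periods])
  qed auto
  have R0: "polar R (- half_period k) 1 (d k - (\<Sum>i=1..3. d i / 2 * (if k = 0 then - 2 else if k = i then 2 else 0)))"
    if "k \<in> {0..3}" for k
    unfolding R_def[abs_def] by (intro polar_diff d polar_sum polar_cmult q_polar that)
  have R_half: "\<exists>c. polar R (- half_period k) (if k = 0 then 1 else 0) c" if k: "k \<in> {0..3}" for k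
  proof (cases "k = 0")
    case True
    then show ?thesis using R0[OF k] by auto
  next
    case False
    have "(\<Sum>i=1..3. d i / 2 * (if k = 0 then - 2 else if k = i then 2 else 0)) = (\<Sum>i=1..3. if i = k then d i else 0)"
      using False by (intro sum.cong) auto
    also have "\<dots> = d k" using False k by (simp add: sum.delta)
    finally have "polar R (- half_period k) (Suc 0) 0" using R0[OF k] by simp
    then show ?thesis using polar_lower False by simp
  qed
  have R_reg: "\<exists>c. polar R p 0 c" if "p \<notin> \<Omega>" for p
  proof (cases "p \<in> H")
    case True
    then obtain k where k: "k \<in> {0..3}" "p + half_period k \<in> \<Omega>" using half_periods_iff by blast
    then have "k \<noteq> 0" using that by (cases "k = 0") (auto simp: half_period_simps)
    then show ?thesis
      using polar_half_period_basis[OF R_qp R_half k(2,1)] by simp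
  next
    case False
    obtain c where "polar F p 0 c" using F(2)[OF False] by blast
    from polar_diff[OF this polar_sum[OF polar_cmult[OF polar_analytic[OF q_an[OF _ False]]]], of "{1..3}" "\<lambda>i. i" "\<lambda>i. d i / 2"]
    show ?thesis unfolding R_def[abs_def] by blast
  qed
  have "\<exists>c. polar R 0 1 c" using R_half[of 0] by (simp add: half_period_simps)
  then obtain c0 where c0: "\<And>p. \<forall>\<^sub>F x in at p. R x = c0"
    using elliptic_single_simple_pole[OF R_qp R_reg] by blast
  show ?thesis
  proof (rule exI[of _ c0], rule exI[of _ "\<lambda>i. d i / 2"], rule exI[of _ b], intro allI impI)
    fix x assume x: "x \<notin> H"
    have x': "x + half_period i \<notin> \<Omega>" if "i \<in> {0..3}" for i using x that half_periods_iff by blast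
    obtain c where "polar f x 0 c" using half_period_polesD(2)[OF poles x] by blast
    then have "f analytic_on {x}" by (rule nicely_meromorphic_polar_analytic[OF f])
    then have "R analytic_on {x}"
      unfolding R_def[abs_def] F_def g_def by (intro analytic_intros G_an x' q_an x) auto
    then have "R x = c0"
      using analytic_eq_at[of R x "\<lambda>_. c0"] c0 by simp
    then have "exp (- \<kappa> * x) * f x = c0 + (\<Sum>i=0..3. \<Sum>j<n i - 1. b i j * G i j x) + (\<Sum>i=1..3. d i / 2 * q i x)"
      (is "_ = ?r") by (simp add: R_def F_def g_def algebra_simps)
    then have "f x = exp (\<kappa> * x) * ?r" by (simp add: exp_minus field_simps)
    then show "f x = exp (\<kappa> * x) * (c0 +
      (\<Sum>i=0..3. \<Sum>j<n i - 1. b i j * (deriv ^^ j) (\<lambda>y. \<wp> (y + half_period i)) x) +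
      (\<Sum>i=1..3. d i / 2 * (deriv \<wp> x / (\<wp> x - e \<omega>\<^sub>1 \<omega>\<^sub>3 i))))"
      unfolding G_def q_def .
  qed
qed

text \<open>All terms of the sum share the factor \<open>multiplier \<alpha> v\<close>, so the law
  follows from the shape of the formula, whatever the coefficients \<open>b\<close> are;
  \<open>nicely_meromorphic_shift_eq\<close> extends it to the half periods.\<close>

lemma representation_a_shift:
  assumes f: "f nicely_meromorphic_on UNIV"
    and rep: "\<And>x. x \<notin> H \<Longrightarrow>
      f x = exp (\<kappa> * x) * (\<Sum>i=0..3. \<Sum>j<n i. b i j * (deriv ^^ j) (Phi i \<alpha>) x)"
    and v: "2 * v \<in> \<Omega>" "v \<notin> \<Omega>"
  shows "f (x + 2 * v) = exp (- 2 * \<zeta> v * \<alpha> + 2 * v * \<zeta> \<alpha> + 2 * \<kappa> * v) * f x"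
proof (rule nicely_meromorphic_shift_eq[OF f])
  show "\<forall>\<^sub>F y in at x. f (y + 2 * v) = exp (- 2 * \<zeta> v * \<alpha> + 2 * v * \<zeta> \<alpha> + 2 * \<kappa> * v) * f y"
    using eventually_off_half_periods
  proof eventually_elim
    case (elim y)
    have "(\<Sum>i=0..3. \<Sum>j<n i. b i j * (deriv ^^ j) (Phi i \<alpha>) (y + 2 * v)) =
        (\<Sum>i=0..3. \<Sum>j<n i. multiplier \<alpha> v * (b i j * (deriv ^^ j) (Phi i \<alpha>) y))"
      by (intro sum.cong refl) (simp add: higher_deriv_Phi_shift[OF v elim])
    also have "\<dots> = multiplier \<alpha> v * (\<Sum>i=0..3. \<Sum>j<n i. b i j * (deriv ^^ j) (Phi i \<alpha>) y)"
      by (simp only: sum_distrib_left)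
    finally have "f (y + 2 * v) = exp (\<kappa> * (y + 2 * v)) *
        (multiplier \<alpha> v * (\<Sum>i=0..3. \<Sum>j<n i. b i j * (deriv ^^ j) (Phi i \<alpha>) y))"
      using rep[of "y + 2 * v"] elim half_periods_shift[OF v(1)] by simp
    also have "\<dots> = exp (\<kappa> * (y + 2 * v)) * multiplier \<alpha> v / exp (\<kappa> * y) * f y"
      using rep[OF elim] by simp
    also have "exp (\<kappa> * (y + 2 * v)) * multiplier \<alpha> v / exp (\<kappa> * y) =
        exp (- 2 * \<zeta> v * \<alpha> + 2 * v * \<zeta> \<alpha> + 2 * \<kappa> * v)"
      unfolding multiplier_def exp_add[symmetric] exp_diff[symmetric] by (simp add: algebra_simps)
    finally show ?case .
  qed
qed

lemma representation_b_shift: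
  assumes f: "f nicely_meromorphic_on UNIV"
    and rep: "\<And>x. x \<notin> H \<Longrightarrow> f x = exp (\<kappa> * x) * (c0 +
      (\<Sum>i=0..3. \<Sum>j<n i - 1. b i j * (deriv ^^ j) (\<lambda>y. \<wp> (y + half_period i)) x) +
      (\<Sum>i=1..3. c i * (deriv \<wp> x / (\<wp> x - e \<omega>\<^sub>1 \<omega>\<^sub>3 i))))"
    and v: "2 * v \<in> \<Omega>"
  shows "f (x + 2 * v) = exp (2 * \<kappa> * v) * f x"
proof (rule nicely_meromorphic_shift_eq[OF f])
  show "\<forall>\<^sub>F y in at x. f (y + 2 * v) = exp (2 * \<kappa> * v) * f y"
    using eventually_off_half_periods
  proof eventually_elim
    case (elim y)
    have y: "y \<notin> \<Omega>" "y + half_period i \<notin> \<Omega>" if "i \<in> {0..3}" for i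
      using elim that half_periods_iff lattice_subset_half_periods by auto
    have 1: "(\<Sum>i=0..3. \<Sum>j<n i - 1. b i j * (deriv ^^ j) (\<lambda>y. \<wp> (y + half_period i)) (y + 2 * v)) =
        (\<Sum>i=0..3. \<Sum>j<n i - 1. b i j * (deriv ^^ j) (\<lambda>y. \<wp> (y + half_period i)) y)"
      by (intro sum.cong refl) (simp only: higher_deriv_wp_shift[OF v y(2)])
    have 2: "(\<Sum>i=1..3. c i * (deriv \<wp> (y + 2 * v) / (\<wp> (y + 2 * v) - e \<omega>\<^sub>1 \<omega>\<^sub>3 i))) =
        (\<Sum>i=1..3. c i * (deriv \<wp> y / (\<wp> y - e \<omega>\<^sub>1 \<omega>\<^sub>3 i)))"
      using y(1)[of 0] by (simp add: wp_quotient_shift[OF v])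
    have 3: "exp (\<kappa> * (y + 2 * v)) = exp (2 * \<kappa> * v) * exp (\<kappa> * y)"
      unfolding exp_add[symmetric] by (simp add: algebra_simps)
    have "y + 2 * v \<notin> H" using elim half_periods_shift[OF v] by simp
    then show ?case
      unfolding rep[OF elim] using rep[of "y + 2 * v"] unfolding 1 2 3 by simp
  qed
qed

end

section \<open>The function \<open>\<Lambda>\<^sub>g\<close>\<close>

text \<open>Identity theorem in the form used for continuation: a meromorphic function on the plane
  vanishes near every point or is nonzero near every point, always in punctured neighbourhoods, and
  one disc decides which.\<close>

lemma meromorphic_dichotomy_on_ball:
  assumes "f meromorphic_on UNIV" "\<epsilon> > 0"
  shows "(\<And>x. x \<in> ball x0 \<epsilon> \<Longrightarrow> f x = 0) \<Longrightarrow> \<forall>\<^sub>F x in at p. f x = 0"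
    and "(\<And>x. x \<in> ball x0 \<epsilon> \<Longrightarrow> f x \<noteq> 0) \<Longrightarrow> \<forall>\<^sub>F x in at p. f x \<noteq> 0"
proof -
  have ball: "\<forall>\<^sub>F x in at x0. x \<in> ball x0 \<epsilon>" using assms(2) by (intro eventually_at_in_open') auto
  have cases: "(\<forall>p. \<forall>\<^sub>F x in at p. f x = 0) \<or> (\<forall>p. \<forall>\<^sub>F x in at p. f x \<noteq> 0)"
    using meromorphic_imp_constant_or_avoid[OF assms(1) open_UNIV connected_UNIV, of 0]
      eventually_cosparse_imp_eventually_at by blast
  show "\<forall>\<^sub>F x in at p. f x = 0" if "\<And>x. x \<in> ball x0 \<epsilon> \<Longrightarrow> f x = 0"
    using cases eventually_happens[OF eventually_conj[OF ball, of "\<lambda>x. f x \<noteq> 0"]] that by auto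
  show "\<forall>\<^sub>F x in at p. f x \<noteq> 0" if "\<And>x. x \<in> ball x0 \<epsilon> \<Longrightarrow> f x \<noteq> 0"
    using cases eventually_happens[OF eventually_conj[OF ball, of "\<lambda>x. f x = 0"]] that by auto
qed

text \<open>The exceptional set is sparse, so its complement is open and still connected.\<close>

lemma eventually_zero_derivative_constant:
  fixes h :: "complex \<Rightarrow> complex"
  assumes "\<And>p. \<forall>\<^sub>F x in at p. (h has_field_derivative 0) (at x)"
  obtains c where "\<And>p. \<forall>\<^sub>F x in at p. h x = c"
proof -
  define S where "S = {x. \<not> (h has_field_derivative 0) (at x)}"
  have S: "S sparse_in UNIV"
    using assms by (simp add: sparse_in_eventually_iff S_def)
  have "h constant_on (UNIV - S)"
    by (rule has_field_derivative_0_imp_constant_on)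
      (use S sparse_imp_connected[OF _ connected_UNIV open_UNIV S] open_diff_sparse_pts[OF open_UNIV S]
        in \<open>auto simp: S_def\<close>)
  then obtain c where c: "\<And>x. x \<notin> S \<Longrightarrow> h x = c" by (auto simp: constant_on_def)
  have "\<forall>\<^sub>F x in at p. h x = c" for p
    using assms[of p] by (rule eventually_mono) (rule c, simp add: S_def)
  then show ?thesis by (rule that)
qed

lemma meromorphic_factor:
  assumes "f meromorphic_on {p}" "\<forall>\<^sub>F x in at p. f x \<noteq> 0"
  obtains m g where "g analytic_on {p}" "g p \<noteq> 0" "\<forall>\<^sub>F x in at p. f x = g x * (x - p) powi m"
proof -
  have "\<exists>\<^sub>F x in at p. f x \<noteq> 0" using assms(2) by (intro eventually_frequently) auto
  then obtain r where r: "zor_poly f p p \<noteq> 0" "r > 0" "zor_poly f p holomorphic_on cball p r"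
    "\<And>w. w \<in> cball p r - {p} \<Longrightarrow> f w = zor_poly f p w * (w - p) powi zorder f p"
    using zorder_exist[of f p] assms(1) unfolding meromorphic_at_iff by blast
  show ?thesis
  proof (rule that)
    have "zor_poly f p holomorphic_on ball p r"
      by (rule holomorphic_on_subset[OF r(3)]) auto
    then show "zor_poly f p analytic_on {p}"
      using r(2) by (auto simp: analytic_at intro!: exI[of _ "ball p r"])
    have "\<forall>\<^sub>F x in at p. x \<in> ball p r - {p}" using r(2) by (intro eventually_at_in_open) auto
    then show "\<forall>\<^sub>F x in at p. f x = zor_poly f p x * (x - p) powi zorder f p"
      by eventually_elim (rule r(4), auto)
  qed (rule r(1))
qed

text \<open>The residue of a logarithmic derivative is the order; orders can thus be recovered from
  identities between residues.\<close>

lemma polar_log_deriv: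
  assumes g: "g analytic_on {p}" "g p \<noteq> 0" and f: "\<forall>\<^sub>F x in at p. f x = g x * (x - p) powi m"
  shows "polar (\<lambda>x. deriv f x / f x) p 1 (of_int m)"
proof (rule polarI[where g = "\<lambda>x. deriv g x / g x * (x - p) + of_int m"])
  show "(\<lambda>x. deriv g x / g x * (x - p) + of_int m) analytic_on {p}"
    using g by (intro analytic_intros analytic_deriv) auto
  obtain S where S: "open S" "p \<in> S" "g holomorphic_on S" using g(1) analytic_at by blast
  obtain T where T: "open T" "p \<in> T" "\<And>x. x \<in> T - {p} \<Longrightarrow> f x = g x * (x - p) powi m"
    using f by (auto simp: eventually_at_topological)
  have "(g \<longlongrightarrow> g p) (at p)" using g(1) analytic_at_imp_isCont isCont_def by blast
  then have "\<forall>\<^sub>F x in at p. g x \<noteq> 0" using g(2) by (rule tendsto_imp_eventually_ne)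
  moreover have "\<forall>\<^sub>F x in at p. x \<in> S \<inter> T - {p}" using S T by (intro eventually_at_in_open) auto
  ultimately show "\<forall>\<^sub>F x in at p. deriv f x / f x = (deriv g x / g x * (x - p) + of_int m) / (x - p) ^ 1"
  proof eventually_elim
    case (elim x)
    have u: "x - p \<noteq> 0" using elim by simp
    have dg: "(g has_field_derivative deriv g x) (at x)"
      using S elim holomorphic_derivI by blast
    have dp: "((\<lambda>x. (x - p) powi m) has_field_derivative of_int m * (x - p) powi (m - 1) * 1) (at x)"
      by (rule DERIV_power_int) (use u in \<open>auto intro!: derivative_eq_intros\<close>)
    have "(f has_field_derivative deriv g x * (x - p) powi m + of_int m * (x - p) powi (m - 1) * 1 * g x) (at x)"
      by (rule has_field_derivative_transform_within_open[OF DERIV_mult[OF dg dp], of "T - {p}"])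
        (use T elim in \<open>auto simp: open_Diff\<close>)
    from DERIV_imp_deriv[OF this]
    have "deriv f x = deriv g x * (x - p) powi m + of_int m * ((x - p) powi m / (x - p)) * g x"
      using u by (simp add: power_int_diff)
    moreover have "f x = g x * (x - p) powi m" "(x - p) powi m \<noteq> 0"
      using T(3) elim u by auto
    moreover have "(G' * a + c * (a / t) * G) / (G * a) = (G' / G * t + c) / t ^ 1"
      if "G \<noteq> 0" "a \<noteq> 0" "t \<noteq> 0" for G G' a c t :: complex
      using that by (simp add: field_simps)
    ultimately show ?case using elim(1) u by metis
  qed
qed simp

lemma polar_of_powi:
  assumes "g analytic_on {p}" "\<forall>\<^sub>F x in at p. f x = g x * (x - p) powi m" "m + int n \<ge> 0"
  shows "\<exists>c. polar f p n c"
proof (rule exI, rule polarI[OF _ refl])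
  show "(\<lambda>x. g x * (x - p) ^ nat (m + int n)) analytic_on {p}"
    using assms(1) by (intro analytic_intros)
  show "\<forall>\<^sub>F x in at p. f x = g x * (x - p) ^ nat (m + int n) / (x - p) ^ n"
    using assms(2) eventually_neq_at
  proof eventually_elim
    case (elim x)
    have "(x - p) powi m * (x - p) ^ n = (x - p) powi (m + int n)"
      using elim(2) by (simp add: power_int_add)
    also have "\<dots> = (x - p) ^ nat (m + int n)" using assms(3) by (rule power_int_nonneg_exp)
    finally show ?case using elim by (simp add: field_simps)
  qed
qed

lemma DERIV_power_log:
  fixes f :: "complex \<Rightarrow> complex"
  assumes "(f has_field_derivative f x * L) (at x)"
  shows "((\<lambda>x. f x ^ n) has_field_derivative f x ^ n * (of_nat n * L)) (at x)"
proof (induction n)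
  case (Suc n)
  from DERIV_mult[OF assms Suc.IH] show ?case by (simp add: algebra_simps)
qed simp

text \<open>For u = X1 / (2 X) + q / X the terms linear in q cancel between u' and u^2, and the rest
  equals v - E by the first integral. The left side keeps the unsimplified shape in which the
  quotient rule delivers u'.\<close>

lemma riccati_identity:
  fixes X X1 X2 q v E :: complex
  assumes "X \<noteq> 0" "X\<^sup>2 * (E - v) + 1 / 2 * X * X2 - 1 / 4 * X1\<^sup>2 = - (q\<^sup>2)"
  shows "(X2 * (2 * X) - X1 * (2 * X1)) / (2 * X * (2 * X)) + (0 * X - q * X1) / (X * X) +
    (X1 / (2 * X) + q / X)\<^sup>2 = v - E"
proof -
  have "X\<^sup>2 * (v - E) = q\<^sup>2 + X * X2 / 2 - X1\<^sup>2 / 4"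
    using assms(2) by (simp add: algebra_simps)
  then have eq: "v - E = (q\<^sup>2 + X * X2 / 2 - X1\<^sup>2 / 4) / X\<^sup>2"
    using assms(1) by (simp add: field_simps)
  show ?thesis
    unfolding eq using assms(1) by (simp add: field_simps power2_eq_square)
qed

text \<open>Equal logarithmic derivatives at \<open>x\<close> and \<open>x + v\<close> make the
  quotient of the two values of \<open>f\<close> constant off a sparse set, and nonzero because
  \<open>f\<close> is.\<close>

lemma quasi_periodic_of_log_deriv:
  assumes f: "f meromorphic_on UNIV" and nz: "\<And>p. \<forall>\<^sub>F x in at p. f x \<noteq> 0"
    and deriv: "\<And>p. \<forall>\<^sub>F x in at p. deriv f x = f x * A x"
    and A: "\<And>p. \<forall>\<^sub>F x in at p. A (x + v) = A x"
  obtains B where "B \<noteq> 0" "\<And>p. \<forall>\<^sub>F x in at p. f (x + v) = B * f x"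
proof -
  have an: "\<forall>\<^sub>F x in at p. f analytic_on {x}" for p
    using meromorphic_on_imp_analytic_cosparse[OF f] eventually_cosparse_imp_eventually_at by blast
  have shifted: "\<forall>\<^sub>F x in at p. P (x + v)" if "\<And>p. \<forall>\<^sub>F x in at p. P x" for P p
    using that[of "p + v"] at_shift[where P = P and p = "p + v" and w = v] by simp
  have "\<forall>\<^sub>F x in at p. ((\<lambda>x. f (x + v) / f x) has_field_derivative 0) (at x)" for p
    using an[of p] shifted[OF an, of p] nz[of p] deriv[of p] shifted[OF deriv, of p] A[of p]
  proof eventually_elim
    case (elim x)
    have d: "(f has_field_derivative f y * A y) (at y)" if "f analytic_on {y}" "deriv f y = f y * A y" for y
      using that by (metis analytic_on_imp_differentiable_at DERIV_deriv_iff_field_differentiable insertI1)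
    have "((\<lambda>x. f (x + v)) has_field_derivative f (x + v) * A x) (at x)"
      using d[OF elim(2,5)] elim(6) by (simp add: DERIV_shift)
    from DERIV_divide[OF this d[OF elim(1,4)] elim(3)] show ?case by (simp add: mult_ac)
  qed
  then obtain c where c: "\<And>p. \<forall>\<^sub>F x in at p. f (x + v) / f x = c"
    using eventually_zero_derivative_constant by blast
  have eq: "\<forall>\<^sub>F x in at p. f (x + v) = c * f x" for p
    using c[of p] nz[of p] by eventually_elim (simp add: field_simps)
  have "\<forall>\<^sub>F x in at 0. f (x + v) = c * f x \<and> f (x + v) \<noteq> 0"
    using eq[of 0] shifted[OF nz, of 0] by (rule eventually_conj)
  from eventually_happens[OF this] have "c \<noteq> 0" by auto
  then show ?thesis using eq that by blast
qed

lemma deriv_shift: "deriv (\<lambda>x. f (x + v)) x = deriv f (x + v)"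
  unfolding deriv_def DERIV_shift ..

section \<open>Zeros of \<wp>(x) - \<wp>(d) for d not a half period\<close>

context complex_lattice
begin

lemma wp_comp_meromorphic: "(\<lambda>x. \<wp> (x + a)) meromorphic_on A"
  using wp_comp_polar by (intro polar_meromorphic_UNIV) blast

lemma double_notin: "d \<notin> H \<Longrightarrow> 2 * d \<notin> \<Omega>"
  by (simp add: half_periods_def)

text \<open>If \<open>p - d\<close> and \<open>p + d\<close> were both periods, so would be their
  difference \<open>2 * d\<close>.\<close>

lemma lattice_indicator_pair:
  assumes "d \<notin> H"
  shows "lattice_indicator (p + - d) + lattice_indicator (p + d) \<in> {0, 1}"
  using double_notin[OF assms] lattice_diff[of "p + d" "p + - d"]
  by (auto simp: lattice_indicator_def)

text \<open>
  The residues of the logarithmic derivative of \<open>\<wp> x - \<wp> d\<close> are at most \<open>1\<close>, so its zeros are simple.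
\<close>

lemma inverse_wp_diff_polar:
  assumes "d \<notin> H"
  shows "polar (\<lambda>x. a / (\<wp> x - \<wp> d)) p 2 0"
proof -
  define F where "F x = \<wp> x - \<wp> d" for x
  have d: "d \<notin> \<Omega>" using assms lattice_subset_half_periods by auto
  have F_ne: "\<forall>\<^sub>F x in at p. F x \<noteq> 0"
    using eventually_off_lattice[of p] eventually_off_shifted_lattice[of d p]
      eventually_off_shifted_lattice[of "- d" p]
    by eventually_elim (use wp_eq_iff[OF d] in \<open>auto simp: F_def\<close>)
  have "F meromorphic_on {p}"
    unfolding F_def using wp_comp_meromorphic[of 0 "{p}"] by (auto intro!: meromorphic_intros)
  then obtain m g where g: "g analytic_on {p}" "g p \<noteq> 0" "\<forall>\<^sub>F x in at p. F x = g x * (x - p) powi m"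
    using meromorphic_factor F_ne by blast
  have 1: "polar (\<lambda>x. \<zeta> (x + - d) + \<zeta> (x + d) + - 2 * \<zeta> (x + 0)) p 1
    (lattice_indicator (p + - d) + lattice_indicator (p + d) + - 2 * lattice_indicator (p + 0))"
    by (intro polar_add polar_cmult zeta_comp_polar)
  have "\<forall>\<^sub>F x in at p. \<zeta> (x + - d) + \<zeta> (x + d) + - 2 * \<zeta> (x + 0) = deriv F x / F x"
    using eventually_off_lattice[of p] eventually_off_shifted_lattice[of d p]
      eventually_off_shifted_lattice[of "- d" p] F_ne
  proof eventually_elim
    case (elim x)
    have "x - d \<notin> \<Omega>" using elim(3) by simp
    from DERIV_imp_deriv[OF wp_log_deriv[OF d elim(1) this elim(2)]] elim(4)
    show ?case unfolding F_def by simp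
  qed
  from polar_unique[OF polar_cong[OF 1 this] polar_log_deriv[OF g]]
  have m: "of_int m = lattice_indicator (p + - d) + lattice_indicator (p + d) - 2 * lattice_indicator p"
    by simp
  have "m \<le> 1"
  proof -
    have "of_int m \<in> {0, 1, - 2, - 1 :: complex}"
      using lattice_indicator_pair[OF assms, of p] unfolding m by (auto simp: lattice_indicator_def)
    then have "(of_int m :: complex) \<in> of_int ` {0, 1, - 2, - 1}" by simp
    then have "m \<in> {0, 1, - 2, - 1}" by (simp only: image_iff of_int_eq_iff) simp
    then show ?thesis by auto
  qed
  have "\<exists>c. polar (\<lambda>x. a / F x) p 1 c"
  proof (rule polar_of_powi)
    show "(\<lambda>x. a / g x) analytic_on {p}" using g by (intro analytic_intros) auto
    show "\<forall>\<^sub>F x in at p. a / F x = a / g x * (x - p) powi (- m)"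
      using g(3) by eventually_elim (simp add: power_int_minus field_simps)
    show "- m + int 1 \<ge> 0" using \<open>m \<le> 1\<close> by simp
  qed
  \<comment> \<open>A pole of order at most 1 has coefficient 0 at order 2; therefore the terms with
    \<open>s k\<close> in the potential do not influence the exponents.\<close>
  then show ?thesis using polar_raise[of _ p 1 _ 2] unfolding F_def by auto
qed

end

text \<open>Distinctness of the finite singular points appears here as conditions on the arguments:
  no \<open>\<delta> k\<close> is a half period, and different ones are incongruent even up to
  sign.\<close>

locale lambda_function = complex_lattice \<omega>\<^sub>1 \<omega>\<^sub>3 for \<omega>\<^sub>1 \<omega>\<^sub>3 :: complex +
  fixes l r :: "nat \<Rightarrow> nat" and M :: nat and \<delta> s :: "nat \<Rightarrow> complex" and E Q :: complex
    and \<Xi> \<Lambda> :: "complex \<Rightarrow> complex"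
  assumes delta_notin: "k \<in> {1..M} \<Longrightarrow> \<delta> k \<notin> H"
    and delta_distinct: "k \<in> {1..M} \<Longrightarrow> k' \<in> {1..M} \<Longrightarrow> k \<noteq> k' \<Longrightarrow> \<delta> k + \<delta> k' \<notin> \<Omega> \<and> \<delta> k - \<delta> k' \<notin> \<Omega>"
    and Xi: "is_\<Xi> \<omega>\<^sub>1 \<omega>\<^sub>3 l M \<delta> r s E \<Xi>"
    and Q_const: "x \<notin> singular_set \<omega>\<^sub>1 \<omega>\<^sub>3 M \<delta> \<Longrightarrow> Q_expr \<omega>\<^sub>1 \<omega>\<^sub>3 l M \<delta> r s E \<Xi> x = Q"
    and Lambda: "is_\<Lambda>\<^sub>g \<omega>\<^sub>1 \<omega>\<^sub>3 M \<delta> r Q \<Xi> \<Lambda>"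
begin

abbreviation v :: "complex \<Rightarrow> complex" where "v \<equiv> potential \<omega>\<^sub>1 \<omega>\<^sub>3 l M \<delta> r s"

text \<open>The square of \<Psi>_g: passing to it removes the choice of a branch, and half its
  logarithmic derivative is that of \<Psi>_g.\<close>

definition W :: "complex \<Rightarrow> complex" where "W x = (\<Prod>k=1..M. (\<wp> x - \<wp> (\<delta> k)) ^ r k)"

definition W_log_deriv :: "complex \<Rightarrow> complex" where
  "W_log_deriv x = (\<Sum>k=1..M. of_nat (r k) * (\<zeta> (x + - \<delta> k) + \<zeta> (x + \<delta> k) + - 2 * \<zeta> (x + 0)))"

text \<open>The residue of \<open>W_log_deriv\<close> at p, that is the order of \<open>W\<close>:
  each factor has simple zeros at the classes of plus and minus \<open>\<delta> k\<close> and double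
  poles on the lattice.\<close>

definition W_order :: "complex \<Rightarrow> complex" where
  "W_order p = (\<Sum>k=1..M. of_nat (r k) *
     (lattice_indicator (p + - \<delta> k) + lattice_indicator (p + \<delta> k) + - 2 * lattice_indicator (p + 0)))"

text \<open>The number L (L + 1) in the indicial equation at p. The trailing 0 stands for the terms
  with \<open>s k\<close>, whose poles are at most simple, and keeps the sum parallel to the
  potential.\<close>

definition v_coeff :: "complex \<Rightarrow> complex" where
  "v_coeff p = (\<Sum>i=0..3. of_nat (l i) * (of_nat (l i) + 1) * lattice_indicator (p + half_period i)) +
     (\<Sum>k=1..M. of_nat (r k) / 2 * (of_nat (r k) / 2 + 1) *
        (lattice_indicator (p + - \<delta> k) + lattice_indicator (p + \<delta> k)) + 0)"

lemma W_log_deriv_polar: "polar W_log_deriv p 1 (W_order p)"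
  unfolding W_log_deriv_def[abs_def] W_order_def
  by (intro polar_sum polar_cmult polar_add zeta_comp_polar)

lemma v_polar: "polar v p 2 (v_coeff p)"
proof -
  have "v = (\<lambda>x. (\<Sum>i=0..3. of_nat (l i) * (of_nat (l i) + 1) * \<wp> (x + half_period i)) +
     (\<Sum>k=1..M. of_nat (r k) / 2 * (of_nat (r k) / 2 + 1) * (\<wp> (x + - \<delta> k) + \<wp> (x + \<delta> k)) +
        s k / (\<wp> x - \<wp> (\<delta> k))))"
    by (simp add: potential_def[abs_def])
  then show ?thesis
    unfolding v_coeff_def
    by (simp only:) (intro polar_add polar_sum polar_cmult wp_comp_polar inverse_wp_diff_polar delta_notin)
qed

lemma not_singularD:
  assumes "x \<notin> singular_set \<omega>\<^sub>1 \<omega>\<^sub>3 M \<delta>"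
  shows "x \<notin> H" "x \<notin> \<Omega>" "k \<in> {1..M} \<Longrightarrow> x - \<delta> k \<notin> \<Omega>" "k \<in> {1..M} \<Longrightarrow> x + \<delta> k \<notin> \<Omega>"
  using assms lattice_subset_half_periods by (auto simp: singular_set_def)

lemma delta_notin_lattice: "k \<in> {1..M} \<Longrightarrow> \<delta> k \<notin> \<Omega>"
  using delta_notin lattice_subset_half_periods by auto

lemma W_deriv:
  assumes "x \<notin> singular_set \<omega>\<^sub>1 \<omega>\<^sub>3 M \<delta>"
  shows "(W has_field_derivative W x * W_log_deriv x) (at x)"
  unfolding W_def[abs_def] W_log_deriv_def
proof (rule has_field_derivative_prod_log)
  note x = not_singularD[OF assms]
  fix k assume k: "k \<in> {1..M}"
  have "((\<lambda>x. \<wp> x - \<wp> (\<delta> k)) has_field_derivative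
      (\<wp> x - \<wp> (\<delta> k)) * (\<zeta> (x + - \<delta> k) + \<zeta> (x + \<delta> k) + - 2 * \<zeta> (x + 0))) (at x)"
    using wp_log_deriv[OF delta_notin_lattice[OF k] x(2) x(3)[OF k] x(4)[OF k]] by simp
  from DERIV_power_log[OF this]
  show "((\<lambda>x. (\<wp> x - \<wp> (\<delta> k)) ^ r k) has_field_derivative (\<wp> x - \<wp> (\<delta> k)) ^ r k *
      (of_nat (r k) * (\<zeta> (x + - \<delta> k) + \<zeta> (x + \<delta> k) + - 2 * \<zeta> (x + 0)))) (at x)" .
qed simp

lemma W_nonzero: "x \<notin> singular_set \<omega>\<^sub>1 \<omega>\<^sub>3 M \<delta> \<Longrightarrow> W x \<noteq> 0"
  using not_singularD[of x] wp_eq_iff[OF delta_notin_lattice] by (auto simp: W_def)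

lemma Xi_periodic: "\<Xi> (x + 2 * \<omega>\<^sub>1) = \<Xi> x" "\<Xi> (x + 2 * \<omega>\<^sub>3) = \<Xi> x"
  and Xi_meromorphic: "\<Xi> meromorphic_on A"
proof -
  have "doubly_periodic \<omega>\<^sub>1 \<omega>\<^sub>3 \<Xi>" using Xi by (simp add: is_\<Xi>_def)
  then show "\<Xi> (x + 2 * \<omega>\<^sub>1) = \<Xi> x" "\<Xi> (x + 2 * \<omega>\<^sub>3) = \<Xi> x" "\<Xi> meromorphic_on A"
    using meromorphic_on_subset[of \<Xi> UNIV A] by (simp_all add: doubly_periodic_def nicely_meromorphic_on_def)
qed

lemma Lambda_nice: "\<Lambda> nicely_meromorphic_on UNIV"
  using Lambda by (simp add: is_\<Lambda>\<^sub>g_def)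

lemma Lambda_meromorphic: "\<Lambda> meromorphic_on A"
  using Lambda_nice meromorphic_on_subset[of \<Lambda> UNIV A] by (simp add: nicely_meromorphic_on_def)

definition riccati :: "complex \<Rightarrow> complex \<Rightarrow> complex" where
  "riccati q x = deriv \<Xi> x / (2 * \<Xi> x) + q / \<Xi> x"

definition Lambda_equations :: "complex \<Rightarrow> bool" where
  "Lambda_equations q \<longleftrightarrow>
    (\<forall>p. \<forall>\<^sub>F x in at p. \<Lambda> x \<noteq> 0) \<and>
    (\<forall>p. \<forall>\<^sub>F x in at p. deriv \<Lambda> x = \<Lambda> x * (W_log_deriv x / 2 + riccati q x)) \<and>
    (\<forall>p. \<forall>\<^sub>F x in at p. deriv (riccati q) x + (riccati q x)\<^sup>2 = v x - E)"

lemma Lambda_equationsD: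
  assumes "Lambda_equations q"
  shows "\<forall>\<^sub>F x in at p. \<Lambda> x \<noteq> 0"
    "\<forall>\<^sub>F x in at p. deriv \<Lambda> x = \<Lambda> x * (W_log_deriv x / 2 + riccati q x)"
    "\<forall>\<^sub>F x in at p. deriv (riccati q) x + (riccati q x)\<^sup>2 = v x - E"
  using assms by (simp_all add: Lambda_equations_def)

text \<open>
  Off the poles, \<open>riccati q\<close> is the logarithmic derivative of the solution \<open>\<Lambda> / \<Psi>\<^sub>g\<close> of
  \<open>f'' = (v - E) f\<close>. Both identities are checked on the disc in \<open>is_\<Lambda>\<^sub>g\<close> and continued analytically.
\<close>

lemma ex_Lambda_equations: "\<exists>q. Lambda_equations q"
proof -
  obtain x0 \<epsilon> \<psi> \<rho> q I where \<epsilon>: "\<epsilon> > 0" and sing: "ball x0 \<epsilon> \<inter> singular_set \<omega>\<^sub>1 \<omega>\<^sub>3 M \<delta> = {}"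
    and Xi0: "\<And>x. x \<in> ball x0 \<epsilon> \<Longrightarrow> \<Xi> x \<noteq> 0"
    and \<psi>: "\<psi> holomorphic_on ball x0 \<epsilon>" "\<And>x. x \<in> ball x0 \<epsilon> \<Longrightarrow> (\<psi> x)\<^sup>2 = W x"
    and \<rho>: "\<rho> holomorphic_on ball x0 \<epsilon>" "\<And>x. x \<in> ball x0 \<epsilon> \<Longrightarrow> (\<rho> x)\<^sup>2 = \<Xi> x"
    and q: "q\<^sup>2 = - Q" and I: "\<And>x. x \<in> ball x0 \<epsilon> \<Longrightarrow> (I has_field_derivative q / \<Xi> x) (at x)"
    and eq: "\<And>x. x \<in> ball x0 \<epsilon> \<Longrightarrow> \<Lambda> x = \<psi> x * \<rho> x * exp (I x)"
    using Lambda unfolding is_\<Lambda>\<^sub>g_def W_def by blast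
  let ?B = "ball x0 \<epsilon>"
  have ns: "x \<notin> singular_set \<omega>\<^sub>1 \<omega>\<^sub>3 M \<delta>" if "x \<in> ?B" for x using sing that by blast
  have \<psi>0: "\<psi> x \<noteq> 0" and \<rho>0: "\<rho> x \<noteq> 0" if "x \<in> ?B" for x
    using \<psi>(2)[OF that] \<rho>(2)[OF that] W_nonzero[OF ns[OF that]] Xi0[OF that] by auto
  \<comment> \<open>The logarithmic derivative of a square root depends only on the radicand, so the
    branches \<psi> and \<rho> drop out of the equations.\<close>
  have sq: "(f has_field_derivative f x * (deriv F x / (2 * F x))) (at x)"
    if "f holomorphic_on ?B" "\<And>x. x \<in> ?B \<Longrightarrow> (f x)\<^sup>2 = F x" "x \<in> ?B" "f x \<noteq> 0" for f F x
  proof -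
    have d: "(f has_field_derivative deriv f x) (at x)"
      using that holomorphic_derivI open_ball by blast
    have "(F has_field_derivative deriv f x * f x + deriv f x * f x) (at x)"
      by (rule has_field_derivative_transform_within_open[OF DERIV_mult[OF d d] open_ball that(3)])
        (use that(2) in \<open>simp add: power2_eq_square\<close>)
    then have "deriv F x = 2 * deriv f x * f x" by (simp add: DERIV_imp_deriv)
    then have "f x * (deriv F x / (2 * F x)) = deriv f x"
      using that(4) that(2)[OF that(3), symmetric] by (simp add: power2_eq_square)
    then show ?thesis using d by simp
  qed
  have d\<Lambda>: "deriv \<Lambda> x = \<Lambda> x * (W_log_deriv x / 2 + riccati q x)" if x: "x \<in> ?B" for x
  proof -
    have W: "deriv W x / (2 * W x) = W_log_deriv x / 2"
      using DERIV_imp_deriv[OF W_deriv[OF ns[OF x]]] W_nonzero[OF ns[OF x]] by simp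
    have d\<psi>: "(\<psi> has_field_derivative \<psi> x * (W_log_deriv x / 2)) (at x)"
      using sq[of \<psi> W, OF \<psi> x \<psi>0[OF x]] unfolding W .
    have d\<rho>: "(\<rho> has_field_derivative \<rho> x * (deriv \<Xi> x / (2 * \<Xi> x))) (at x)"
      by (rule sq[of \<rho> \<Xi>, OF \<rho> x \<rho>0[OF x]])
    have dI: "((\<lambda>x. exp (I x)) has_field_derivative exp (I x) * (q / \<Xi> x)) (at x)"
      by (rule DERIV_fun_exp[OF I[OF x]])
    have "((\<lambda>x. \<psi> x * \<rho> x * exp (I x)) has_field_derivative \<psi> x * \<rho> x * exp (I x) *
        (W_log_deriv x / 2 + deriv \<Xi> x / (2 * \<Xi> x) + q / \<Xi> x)) (at x)"
      by (intro DERIV_mult_log d\<psi> d\<rho> dI)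
    also have "\<psi> x * \<rho> x * exp (I x) * (W_log_deriv x / 2 + deriv \<Xi> x / (2 * \<Xi> x) + q / \<Xi> x) =
        \<Lambda> x * (W_log_deriv x / 2 + riccati q x)"
      unfolding eq[OF x] riccati_def by (simp add: add.assoc)
    finally have "(\<Lambda> has_field_derivative \<Lambda> x * (W_log_deriv x / 2 + riccati q x)) (at x)"
      by (rule has_field_derivative_transform_within_open[OF _ open_ball x]) (simp add: eq)
    then show ?thesis by (rule DERIV_imp_deriv)
  qed
  have "\<Xi> holomorphic_on ?B"
    by (rule holomorphic_transform[of "\<lambda>x. (\<rho> x)\<^sup>2"]) (use \<rho> in \<open>auto intro!: holomorphic_intros\<close>)
  then have Xi_hol: "\<Xi> holomorphic_on ?B" "deriv \<Xi> holomorphic_on ?B"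
    by (auto intro: holomorphic_deriv)
  have dric: "deriv (riccati q) x + (riccati q x)\<^sup>2 = v x - E" if x: "x \<in> ?B" for x
  proof -
    have d0: "(\<Xi> has_field_derivative deriv \<Xi> x) (at x)"
      and d1: "(deriv \<Xi> has_field_derivative deriv (deriv \<Xi>) x) (at x)"
      using Xi_hol x holomorphic_derivI open_ball by blast+
    have nz: "\<Xi> x \<noteq> 0" "2 * \<Xi> x \<noteq> 0" using Xi0[OF x] by auto
    have "((\<lambda>x. deriv \<Xi> x / (2 * \<Xi> x) + q / \<Xi> x) has_field_derivative
        (deriv (deriv \<Xi>) x * (2 * \<Xi> x) - deriv \<Xi> x * (2 * deriv \<Xi> x)) / (2 * \<Xi> x * (2 * \<Xi> x)) +
        (0 * \<Xi> x - q * deriv \<Xi> x) / (\<Xi> x * \<Xi> x)) (at x)"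
      by (intro DERIV_add DERIV_divide DERIV_cmult DERIV_const d0 d1 nz)
    then have "deriv (riccati q) x =
        (deriv (deriv \<Xi>) x * (2 * \<Xi> x) - deriv \<Xi> x * (2 * deriv \<Xi> x)) / (2 * \<Xi> x * (2 * \<Xi> x)) +
        (0 * \<Xi> x - q * deriv \<Xi> x) / (\<Xi> x * \<Xi> x)"
      unfolding riccati_def[abs_def] by (rule DERIV_imp_deriv)
    moreover have "(\<Xi> x)\<^sup>2 * (E - v x) + 1 / 2 * \<Xi> x * deriv (deriv \<Xi>) x - 1 / 4 * (deriv \<Xi> x)\<^sup>2 = - (q\<^sup>2)"
      using Q_const[OF ns[OF x]] q by (simp add: Q_expr_def numeral_2_eq_2)
    ultimately show ?thesis
      using riccati_identity[OF nz(1)] unfolding riccati_def by simp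
  qed
  have ric_mero: "riccati q meromorphic_on UNIV"
    unfolding riccati_def[abs_def] by (intro meromorphic_intros Xi_meromorphic)
  have W_mero: "W_log_deriv meromorphic_on UNIV"
    using W_log_deriv_polar by (intro polar_meromorphic_UNIV) blast
  have v_mero: "v meromorphic_on UNIV"
    using v_polar by (intro polar_meromorphic_UNIV) blast
  show ?thesis
    unfolding Lambda_equations_def
  proof (intro exI[of _ q] conjI allI)
    show "\<forall>\<^sub>F x in at p. \<Lambda> x \<noteq> 0" for p
      by (rule meromorphic_dichotomy_on_ball(2)[OF Lambda_meromorphic \<epsilon>, of x0]) (simp add: eq \<psi>0 \<rho>0)
    have "\<forall>\<^sub>F x in at p. deriv \<Lambda> x - \<Lambda> x * (W_log_deriv x / 2 + riccati q x) = 0" for p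
      by (rule meromorphic_dichotomy_on_ball(1)[OF _ \<epsilon>, of _ x0])
        (auto simp: d\<Lambda> intro!: meromorphic_intros Lambda_meromorphic W_mero ric_mero)
    then show "\<forall>\<^sub>F x in at p. deriv \<Lambda> x = \<Lambda> x * (W_log_deriv x / 2 + riccati q x)" for p by simp
    have "\<forall>\<^sub>F x in at p. deriv (riccati q) x + (riccati q x)\<^sup>2 - (v x - E) = 0" for p
      by (rule meromorphic_dichotomy_on_ball(1)[OF _ \<epsilon>, of _ x0])
        (auto simp: dric intro!: meromorphic_intros v_mero ric_mero)
    then show "\<forall>\<^sub>F x in at p. deriv (riccati q) x + (riccati q x)\<^sup>2 = v x - E" for p by simp
  qed
qed

text \<open>In each summand the increments of the three zeta functions cancel: 1 + 1 - 2 =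
  0.\<close>

lemma W_log_deriv_shift:
  assumes "2 * u \<in> \<Omega>" "u \<notin> \<Omega>"
  shows "\<forall>\<^sub>F x in at p. W_log_deriv (x + 2 * u) = W_log_deriv x"
proof -
  have z: "\<zeta> (x + 2 * u + a) = \<zeta> (x + a) + 2 * \<zeta> u" if "x + a \<notin> \<Omega>" for x a
    using zeta_shift_half[OF assms that] by (simp add: add_ac)
  have "\<forall>\<^sub>F x in at p. \<forall>k\<in>{1..M}. x + - \<delta> k \<notin> \<Omega> \<and> x + \<delta> k \<notin> \<Omega> \<and> x + 0 \<notin> \<Omega>"
    by (intro eventually_ball_finite ballI eventually_conj eventually_off_shifted_lattice) auto
  then show ?thesis
  proof eventually_elim
    case (elim x)
    show ?case
      unfolding W_log_deriv_def
    proof (rule sum.cong[OF refl])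
      fix k assume "k \<in> {1..M}"
      then have k: "x + - \<delta> k \<notin> \<Omega>" "x + \<delta> k \<notin> \<Omega>" "x + 0 \<notin> \<Omega>" using elim by auto
      show "of_nat (r k) * (\<zeta> (x + 2 * u + - \<delta> k) + \<zeta> (x + 2 * u + \<delta> k) + - 2 * \<zeta> (x + 2 * u + 0)) =
          of_nat (r k) * (\<zeta> (x + - \<delta> k) + \<zeta> (x + \<delta> k) + - 2 * \<zeta> (x + 0))"
        unfolding z[OF k(1)] z[OF k(2)] z[OF k(3)] by simp
    qed
  qed
qed

section \<open>Multipliers and poles of \<Lambda>\<close>

lemma Lambda_quasi_periodic: obtains B C where "quasi_periodic \<Lambda> B C"
proof -
  obtain q where "Lambda_equations q" using ex_Lambda_equations by blast
  note q = Lambda_equationsD[OF this]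
  have *: "\<exists>B. B \<noteq> 0 \<and> (\<forall>p. \<forall>\<^sub>F x in at p. \<Lambda> (x + 2 * u) = B * \<Lambda> x)"
    if u: "2 * u \<in> \<Omega>" "u \<notin> \<Omega>" and Xi_u: "\<And>x. \<Xi> (x + 2 * u) = \<Xi> x" for u
  proof -
    have "riccati q (x + 2 * u) = riccati q x" for x
      unfolding riccati_def deriv_shift[symmetric] Xi_u by simp
    then have "\<forall>\<^sub>F x in at p. W_log_deriv (x + 2 * u) / 2 + riccati q (x + 2 * u) = W_log_deriv x / 2 + riccati q x" for p
      using W_log_deriv_shift[OF u, of p] by (auto elim: eventually_mono)
    from quasi_periodic_of_log_deriv[OF Lambda_meromorphic q(1) q(2) this] show ?thesis by blast
  qed
  obtain B C where "B \<noteq> 0 \<and> (\<forall>p. \<forall>\<^sub>F x in at p. \<Lambda> (x + 2 * \<omega>\<^sub>1) = B * \<Lambda> x)"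
    "C \<noteq> 0 \<and> (\<forall>p. \<forall>\<^sub>F x in at p. \<Lambda> (x + 2 * \<omega>\<^sub>3) = C * \<Lambda> x)"
    using *[OF period_in_lattice(1) half_period_not_in_lattice(1) Xi_periodic(1)]
      *[OF period_in_lattice(2) half_period_not_in_lattice(2) Xi_periodic(2)] by blast
  then have "quasi_periodic \<Lambda> B C" by (simp add: quasi_periodic_def)
  then show ?thesis by (rule that)
qed

text \<open>
  If \<open>m\<close> is the order of \<open>\<Lambda>\<close> at \<open>p\<close>, then \<open>m - W_order p / 2\<close> is an exponent of \<open>f'' = (v - E) f\<close>
  at \<open>p\<close>, that is \<open>- L\<close> or \<open>L + 1\<close>.
\<close>

lemma Lambda_polar:
  assumes "v_coeff p = L * (L + 1)" "W_order p / 2 = L - of_nat n" "2 * L = of_nat b"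
  shows "\<exists>c. polar \<Lambda> p n c"
proof -
  obtain q where "Lambda_equations q" using ex_Lambda_equations by blast
  note q = Lambda_equationsD[OF this]
  obtain m g where g: "g analytic_on {p}" "g p \<noteq> 0" "\<forall>\<^sub>F x in at p. \<Lambda> x = g x * (x - p) powi m"
    using meromorphic_factor[OF Lambda_meromorphic q(1)] by blast
  \<comment> \<open>The residue of \<open>riccati q\<close> at p, hence the exponent of \<Lambda> /
    \<Psi>_g there; it need not be an integer, since \<open>W_order p\<close> can be odd.\<close>
  define k where "k = of_int m - 1 / 2 * W_order p"
  have "polar (\<lambda>x. deriv \<Lambda> x / \<Lambda> x - 1 / 2 * W_log_deriv x) p 1 k"
    unfolding k_def by (intro polar_diff polar_cmult polar_log_deriv[OF g] W_log_deriv_polar)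
  then have ric: "polar (riccati q) p 1 k"
    by (rule polar_cong) (use q(1)[of p] q(2)[of p] in eventually_elim, simp)
  have "polar (\<lambda>x. deriv (riccati q) x + riccati q x * riccati q x) p 2 (- of_nat 1 * k + k * k)"
    using polar_add[OF polar_deriv[OF ric]] polar_mult[OF ric ric] by (simp add: numeral_2_eq_2)
  moreover have "polar (\<lambda>x. v x - E) p 2 (v_coeff p - 0)"
    by (intro polar_diff v_polar polar_raise[OF polar_const]) simp
  moreover have "\<forall>\<^sub>F x in at p. deriv (riccati q) x + riccati q x * riccati q x = v x - E"
    using q(3)[of p] by (simp add: power2_eq_square)
  \<comment> \<open>The coefficients of order 2 in the Riccati equation give the indicial equation
    k^2 - k = L (L + 1).\<close>
  ultimately have "- of_nat 1 * k + k * k = v_coeff p - 0"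
    using polar_unique[OF polar_cong] by metis
  then have "(k + L) * (k - (L + 1)) = 0"
    using assms(1) by (simp add: algebra_simps)
  then consider "k = - L" | "k = L + 1" by (auto simp: eq_neg_iff_add_eq_0)
  \<comment> \<open>With \<open>W_order p / 2 = L - of_nat n\<close> the exponent - L gives m + n =
    0, and L + 1 gives m + n = 2 L + 1, a positive integer because
    \<open>2 * L = of_nat b\<close>.\<close>
  then have "m + int n \<ge> 0"
  proof cases
    case 1
    then have "complex_of_int (m + int n) = 0"
      using assms(2) by (simp add: k_def field_simps)
    then show ?thesis by (simp only: of_int_eq_0_iff)
  next
    case 2
    then have "complex_of_int (m + int n) = of_int (int b + 1)"
      using assms(2,3) by (simp add: k_def field_simps)
    then show ?thesis by (simp only: of_int_eq_iff)
  qed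
  with g show ?thesis by (intro polar_of_powi)
qed

text \<open>On the lattice \<open>W\<close> has a pole of order twice the sum of the
  \<open>r k\<close>, so \<Psi>_g raises the bound \<open>l 0\<close> by that sum, which is the
  origin of \<open>tilde_l 0\<close>; at the other half periods \<open>W\<close> has order 0. At the
  classes of plus and minus \<open>\<delta> k\<close> one has L = r k / 2, and half the order of
  \<open>W\<close> compensates the exponent - L exactly, so no pole is left. Elsewhere L =
  0.\<close>

lemma Lambda_poles: "half_period_poles \<Lambda> (tilde_l l M r)"
proof (rule half_period_polesI)
  fix j assume j: "j \<in> {0..3 :: nat}"
  let ?p = "- half_period j"
  have half: "lattice_indicator (?p + half_period i) = (if i = j then 1 else 0)" if "i \<in> {0..3}" for i
    using half_period_diff[of j i] that j by (auto simp: lattice_indicator_def)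
  have delta: "lattice_indicator (?p + - \<delta> k) = 0" "lattice_indicator (?p + \<delta> k) = 0" if "k \<in> {1..M}" for k
  proof -
    have d: "\<delta> k + half_period j \<notin> \<Omega>" using delta_notin[OF that] j half_periods_iff by blast
    have "?p + - \<delta> k = - (\<delta> k + half_period j)" by simp
    then show "lattice_indicator (?p + - \<delta> k) = 0" using d unfolding lattice_indicator_def by (simp only: lattice_uminus_iff if_False)
    have "?p + \<delta> k = \<delta> k + half_period j - 2 * half_period j" by simp
    then have "?p + \<delta> k \<notin> \<Omega>"
      using d lattice_diff_iff[OF half_period_double[of j], of "\<delta> k + half_period j"] by metis
    then show "lattice_indicator (?p + \<delta> k) = 0" by (simp add: lattice_indicator_def)
  qed
  have zero: "lattice_indicator (?p + 0) = (if j = 0 then 1 else 0)"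
    using half[of 0] by (simp add: half_period_simps)
  have "(\<Sum>i=0..3. of_nat (l i) * (of_nat (l i) + 1) * lattice_indicator (?p + half_period i)) =
      (\<Sum>i=0..3. if i = j then of_nat (l i) * (of_nat (l i) + 1) else 0)"
    by (rule sum.cong[OF refl], subst half) auto
  moreover have "(\<Sum>k=1..M. of_nat (r k) / 2 * (of_nat (r k) / 2 + 1) *
      (lattice_indicator (?p + - \<delta> k) + lattice_indicator (?p + \<delta> k)) + 0) = 0"
    by (rule sum.neutral, rule ballI) (simp only: delta, simp)
  ultimately have "v_coeff ?p = (\<Sum>i=0..3. if i = j then of_nat (l i) * (of_nat (l i) + 1) else 0)"
    unfolding v_coeff_def by (simp only: add_0_right)
  also have "\<dots> = of_nat (l j) * (of_nat (l j) + 1)" using j by (simp add: sum.delta)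
  finally have "v_coeff ?p = of_nat (l j) * (of_nat (l j) + 1)" .
  moreover have "W_order ?p = (\<Sum>k=1..M. of_nat (r k) * (- 2 * (if j = 0 then 1 else 0)))"
    unfolding W_order_def zero by (rule sum.cong[OF refl]) (simp only: delta, simp)
  then have "W_order ?p / 2 = of_nat (l j) - of_nat (tilde_l l M r j)"
    by (simp add: tilde_l_def sum_distrib_right[symmetric] sum_negf)
  ultimately show "\<exists>c. polar \<Lambda> ?p (tilde_l l M r j) c"
    by (rule Lambda_polar[where b = "2 * l j"]) simp
next
  fix p assume p: "p \<notin> H"
  let ?t = "\<lambda>k. lattice_indicator (p + - \<delta> k) + lattice_indicator (p + \<delta> k)"
  have half: "lattice_indicator (p + half_period i) = 0" if "i \<in> {0..3}" for i
    using p that half_periods_iff by (auto simp: lattice_indicator_def)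
  have zero: "lattice_indicator (p + 0) = 0"
    using half[of 0] by (simp add: half_period_simps)
  have V: "v_coeff p = (\<Sum>k=1..M. of_nat (r k) / 2 * (of_nat (r k) / 2 + 1) * ?t k)"
    unfolding v_coeff_def using half by simp
  have WO: "W_order p = (\<Sum>k=1..M. of_nat (r k) * ?t k)"
    unfolding W_order_def zero by simp
  show "\<exists>c. polar \<Lambda> p 0 c"
  proof (cases "\<exists>k\<in>{1..M}. ?t k \<noteq> 0")
    case False
    then have "v_coeff p = 0 * (0 + 1)" "W_order p / 2 = 0 - of_nat 0"
      unfolding V WO by simp_all
    then show ?thesis by (rule Lambda_polar) simp
  next
    case True
    then obtain k where k: "k \<in> {1..M}" "?t k \<noteq> 0" by blast
    have tk: "?t k = 1" using lattice_indicator_pair[OF delta_notin[OF k(1)], of p] k(2) by auto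
    \<comment> \<open>Two indices contributing at the same p would make the corresponding
      \<delta>-values congruent up to sign.\<close>
    have t0: "?t k' = 0" if k': "k' \<in> {1..M}" "k' \<noteq> k" for k'
    proof (rule ccontr)
      assume "?t k' \<noteq> 0"
      then have a: "p + - \<delta> k' \<in> \<Omega> \<or> p + \<delta> k' \<in> \<Omega>"
        by (auto simp: lattice_indicator_def split: if_splits)
      from k(2) have b: "p + - \<delta> k \<in> \<Omega> \<or> p + \<delta> k \<in> \<Omega>"
        by (auto simp: lattice_indicator_def split: if_splits)
      have n: "\<delta> k + \<delta> k' \<notin> \<Omega>" "\<delta> k - \<delta> k' \<notin> \<Omega>" "- (\<delta> k + \<delta> k') \<notin> \<Omega>" "- (\<delta> k - \<delta> k') \<notin> \<Omega>"
        unfolding lattice_uminus_iff using delta_distinct[OF k(1) k'(1)] k'(2) by blast+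
      show False
        using a b n lattice_diff[of "p + - \<delta> k'" "p + - \<delta> k"] lattice_diff[of "p + - \<delta> k'" "p + \<delta> k"]
          lattice_diff[of "p + \<delta> k'" "p + - \<delta> k"] lattice_diff[of "p + \<delta> k'" "p + \<delta> k"]
        by (auto simp: algebra_simps)
    qed
    have pick: "(\<Sum>i=1..M. c i * ?t i) = c k" for c
    proof -
      have "(\<Sum>i=1..M. c i * ?t i) = (\<Sum>i=1..M. if i = k then c i else 0)"
        by (rule sum.cong) (use tk t0 in auto)
      then show ?thesis using k(1) by (simp add: sum.delta)
    qed
    have "v_coeff p = of_nat (r k) / 2 * (of_nat (r k) / 2 + 1)" "W_order p / 2 = of_nat (r k) / 2 - of_nat 0"
      unfolding V WO pick by simp_all
    then show ?thesis by (rule Lambda_polar) simp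
  qed
qed


section \<open>Realization of prescribed multipliers\<close>

text \<open>
  The multipliers \<open>exp (2 * c * \<omega>\<^sub>j - 2 * \<eta>\<^sub>j * \<alpha>)\<close> exhaust all pairs of nonzero numbers because the
  period matrix is nondegenerate.
\<close>

lemma multipliers_exist:
  assumes "B \<noteq> 0" "C \<noteq> 0"
  obtains \<alpha> c where "exp (- 2 * \<zeta> \<omega>\<^sub>1 * \<alpha> + 2 * \<omega>\<^sub>1 * c) = B" "exp (- 2 * \<zeta> \<omega>\<^sub>3 * \<alpha> + 2 * \<omega>\<^sub>3 * c) = C"
proof
  \<comment> \<open>Cramer's rule for the two linear equations in \<alpha> and c with right-hand
    sides \<open>Ln B\<close> and \<open>Ln C\<close>; \<open>D\<close> is a quarter of their
    determinant.\<close>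
  define D where "D = \<zeta> \<omega>\<^sub>3 * \<omega>\<^sub>1 - \<zeta> \<omega>\<^sub>1 * \<omega>\<^sub>3"
  define \<alpha> where "\<alpha> = (Ln B * \<omega>\<^sub>3 - Ln C * \<omega>\<^sub>1) / (2 * D)"
  define c where "c = (Ln B * \<zeta> \<omega>\<^sub>3 - Ln C * \<zeta> \<omega>\<^sub>1) / (2 * D)"
  have D: "D \<noteq> 0" using eta_nondegenerate by (simp add: D_def)
  have "- 2 * \<zeta> \<omega>\<^sub>1 * \<alpha> + 2 * \<omega>\<^sub>1 * c = Ln B * D / D" "- 2 * \<zeta> \<omega>\<^sub>3 * \<alpha> + 2 * \<omega>\<^sub>3 * c = Ln C * D / D"
    unfolding \<alpha>_def c_def using D by (simp_all add: divide_simps) (simp_all add: D_def algebra_simps)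
  then show "exp (- 2 * \<zeta> \<omega>\<^sub>1 * \<alpha> + 2 * \<omega>\<^sub>1 * c) = B" "exp (- 2 * \<zeta> \<omega>\<^sub>3 * \<alpha> + 2 * \<omega>\<^sub>3 * c) = C"
    using D assms by simp_all
qed

lemma legendre_power: "exp (of_int n * (4 * (\<zeta> \<omega>\<^sub>1 * \<omega>\<^sub>3 - \<zeta> \<omega>\<^sub>3 * \<omega>\<^sub>1))) = 1"
  using legendre_relation by (simp add: exp_power_int[symmetric])

text \<open>For a period \<alpha> = 2 m \<omega>_1 + 2 n \<omega>_3 the quasi-periods 2 m
  \<zeta>(\<omega>_1) + 2 n \<zeta>(\<omega>_3) are subtracted from c to give \<kappa>. The
  exponents then change by - n, respectively m, times the quantity whose exponential is 1 by the
  Legendre relation.\<close>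

lemma multipliers_lattice:
  assumes "\<alpha> \<in> \<Omega>"
  obtains \<kappa> where "exp (- 2 * \<zeta> \<omega>\<^sub>1 * \<alpha> + 2 * \<omega>\<^sub>1 * c) = exp (2 * \<kappa> * \<omega>\<^sub>1)"
    "exp (- 2 * \<zeta> \<omega>\<^sub>3 * \<alpha> + 2 * \<omega>\<^sub>3 * c) = exp (2 * \<kappa> * \<omega>\<^sub>3)"
proof -
  obtain m n where mn: "\<alpha> = 2 * of_int m * \<omega>\<^sub>1 + 2 * of_int n * \<omega>\<^sub>3"
    using assms unfolding lattice_def by auto
  let ?\<kappa> = "c - (2 * of_int m * \<zeta> \<omega>\<^sub>1 + 2 * of_int n * \<zeta> \<omega>\<^sub>3)"
  let ?X = "4 * (\<zeta> \<omega>\<^sub>1 * \<omega>\<^sub>3 - \<zeta> \<omega>\<^sub>3 * \<omega>\<^sub>1)"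
  have "- 2 * \<zeta> \<omega>\<^sub>1 * \<alpha> + 2 * \<omega>\<^sub>1 * c = 2 * ?\<kappa> * \<omega>\<^sub>1 + of_int (- n) * ?X"
    "- 2 * \<zeta> \<omega>\<^sub>3 * \<alpha> + 2 * \<omega>\<^sub>3 * c = 2 * ?\<kappa> * \<omega>\<^sub>3 + of_int m * ?X"
    unfolding mn by (simp_all add: algebra_simps)
  then have "exp (- 2 * \<zeta> \<omega>\<^sub>1 * \<alpha> + 2 * \<omega>\<^sub>1 * c) = exp (2 * ?\<kappa> * \<omega>\<^sub>1)"
    "exp (- 2 * \<zeta> \<omega>\<^sub>3 * \<alpha> + 2 * \<omega>\<^sub>3 * c) = exp (2 * ?\<kappa> * \<omega>\<^sub>3)"
    by (simp_all only: exp_add legendre_power mult_1_right)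
  then show ?thesis by (rule that)
qed

end

theorem theorem2p5:
  fixes \<omega>\<^sub>1 \<omega>\<^sub>3 E Q :: complex
    and l r :: "nat \<Rightarrow> nat" and M :: nat
    and \<delta> s :: "nat \<Rightarrow> complex"
    and \<Xi> \<Lambda> :: "complex \<Rightarrow> complex"
  assumes "\<omega>\<^sub>1 \<noteq> \<omega>\<^sub>3" and "independent {\<omega>\<^sub>1, \<omega>\<^sub>3}"
    and "\<forall>k\<in>{1..M}. r k > 0"
    and "\<forall>k\<in>{1..M}. \<delta> k \<notin> lattice \<omega>\<^sub>1 \<omega>\<^sub>3"
    and "distinct ([e \<omega>\<^sub>1 \<omega>\<^sub>3 1, e \<omega>\<^sub>1 \<omega>\<^sub>3 2, e \<omega>\<^sub>1 \<omega>\<^sub>3 3] @ map (\<lambda>k. wp \<omega>\<^sub>1 \<omega>\<^sub>3 (\<delta> k)) [1..<Suc M])"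
    and "\<forall>k\<in>{1..M}. apparent_singularity
           (fuchs_p \<omega>\<^sub>1 \<omega>\<^sub>3 l M \<delta> r) (fuchs_q \<omega>\<^sub>1 \<omega>\<^sub>3 l M \<delta> r s E) (wp \<omega>\<^sub>1 \<omega>\<^sub>3 (\<delta> k))"
    and "is_\<Xi> \<omega>\<^sub>1 \<omega>\<^sub>3 l M \<delta> r s E \<Xi>"
    and "\<forall>x. x \<notin> singular_set \<omega>\<^sub>1 \<omega>\<^sub>3 M \<delta> \<longrightarrow> Q_expr \<omega>\<^sub>1 \<omega>\<^sub>3 l M \<delta> r s E \<Xi> x = Q"
    and "is_\<Lambda>\<^sub>g \<omega>\<^sub>1 \<omega>\<^sub>3 M \<delta> r Q \<Xi> \<Lambda>"
  shows
    "((\<exists>\<alpha> \<kappa> b. \<alpha> \<notin> lattice \<omega>\<^sub>1 \<omega>\<^sub>3 \<and>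
         (\<forall>x. x \<notin> half_periods \<omega>\<^sub>1 \<omega>\<^sub>3 \<longrightarrow> \<Lambda> x = form_a \<omega>\<^sub>1 \<omega>\<^sub>3 l M r \<alpha> \<kappa> b x)) \<or>
      (\<exists>\<kappa> c0 c b.
         \<forall>x. x \<notin> half_periods \<omega>\<^sub>1 \<omega>\<^sub>3 \<longrightarrow> \<Lambda> x = form_b \<omega>\<^sub>1 \<omega>\<^sub>3 l M r \<kappa> c0 c b x)) \<and>
     (\<forall>\<alpha> \<kappa> b. \<alpha> \<notin> lattice \<omega>\<^sub>1 \<omega>\<^sub>3 \<longrightarrow>
        (\<forall>x. x \<notin> half_periods \<omega>\<^sub>1 \<omega>\<^sub>3 \<longrightarrow> \<Lambda> x = form_a \<omega>\<^sub>1 \<omega>\<^sub>3 l M r \<alpha> \<kappa> b x) \<longrightarrow>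
        (\<forall>j\<in>{1, 3}. \<forall>x. \<Lambda> (x + 2 * \<omega> \<omega>\<^sub>1 \<omega>\<^sub>3 j) =
           exp (- 2 * \<eta> \<omega>\<^sub>1 \<omega>\<^sub>3 j * \<alpha> + 2 * \<omega> \<omega>\<^sub>1 \<omega>\<^sub>3 j * wzeta \<omega>\<^sub>1 \<omega>\<^sub>3 \<alpha> + 2 * \<kappa> * \<omega> \<omega>\<^sub>1 \<omega>\<^sub>3 j) * \<Lambda> x)) \<and>
     (\<forall>\<kappa> c0 c b.
        (\<forall>x. x \<notin> half_periods \<omega>\<^sub>1 \<omega>\<^sub>3 \<longrightarrow> \<Lambda> x = form_b \<omega>\<^sub>1 \<omega>\<^sub>3 l M r \<kappa> c0 c b x) \<longrightarrow>
        (\<forall>j\<in>{1, 3}. \<forall>x. \<Lambda> (x + 2 * \<omega> \<omega>\<^sub>1 \<omega>\<^sub>3 j) = exp (2 * \<kappa> * \<omega> \<omega>\<^sub>1 \<omega>\<^sub>3 j) * \<Lambda> x))"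
proof -
  interpret complex_lattice \<omega>\<^sub>1 \<omega>\<^sub>3
    using assms(1,2) by unfold_locales
  have e_ne: "\<wp> (\<delta> k) \<noteq> e \<omega>\<^sub>1 \<omega>\<^sub>3 i" if "k \<in> {1..M}" "i \<in> {1..3}" for k i
  proof -
    have "i = 1 \<or> i = 2 \<or> i = 3" using that by auto
    then have "e \<omega>\<^sub>1 \<omega>\<^sub>3 i \<in> set [e \<omega>\<^sub>1 \<omega>\<^sub>3 1, e \<omega>\<^sub>1 \<omega>\<^sub>3 2, e \<omega>\<^sub>1 \<omega>\<^sub>3 3]" by auto
    moreover have "\<wp> (\<delta> k) \<in> set (map (\<lambda>k. \<wp> (\<delta> k)) [1..<Suc M])"
      unfolding set_map set_upt using that by (intro imageI) simp
    ultimately show ?thesis using assms(5) unfolding distinct_append by (metis IntI empty_iff)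
  qed
  have "inj_on (\<lambda>k. \<wp> (\<delta> k)) (set [1..<Suc M])"
    using assms(5) unfolding distinct_append distinct_map by blast
  then have wp_inj: "\<wp> (\<delta> k) \<noteq> \<wp> (\<delta> k')" if "k \<in> {1..M}" "k' \<in> {1..M}" "k \<noteq> k'" for k k'
    using inj_onD[of "\<lambda>k. \<wp> (\<delta> k)" "{1..M}" k k'] that
    by (metis set_upt atLeastLessThanSuc_atLeastAtMost)
  \<comment> \<open>\<wp> separates points up to sign and periods, so a half period would make
    \<wp>(\<delta> k) equal to some e_i.\<close>
  have delta_H: "\<delta> k \<notin> H" if k: "k \<in> {1..M}" for k
  proof
    assume "\<delta> k \<in> H"
    then obtain i where i: "i \<in> {0..3}" "\<delta> k + half_period i \<in> \<Omega>" using half_periods_iff by blast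
    have d: "\<delta> k \<notin> \<Omega>" using assms(4) k by blast
    then have "i \<noteq> 0" using i by (cases "i = 0") (auto simp: half_period_simps)
    then have i': "i \<in> {1..3}" using i(1) by auto
    have "\<wp> (\<delta> k) = e \<omega>\<^sub>1 \<omega>\<^sub>3 i"
      using wp_eq_iff[OF half_period_notin[OF i'] d] i(2) by (simp add: e_def)
    then show False using e_ne[OF k i'] by contradiction
  qed
  interpret lambda_function \<omega>\<^sub>1 \<omega>\<^sub>3 l r M \<delta> s E Q \<Xi> \<Lambda>
  proof unfold_locales
    fix k k' assume k: "k \<in> {1..M}" "k' \<in> {1..M}" "k \<noteq> k'"
    show "\<delta> k + \<delta> k' \<notin> \<Omega> \<and> \<delta> k - \<delta> k' \<notin> \<Omega>"
      using wp_eq_iff[of "\<delta> k'" "\<delta> k"] assms(4) k wp_inj[OF k] by blast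
  qed (use delta_H assms(7,8,9) in auto)
  obtain B C where qp: "quasi_periodic \<Lambda> B C" by (rule Lambda_quasi_periodic)
  obtain \<alpha> c where BC: "exp (- 2 * \<zeta> \<omega>\<^sub>1 * \<alpha> + 2 * \<omega>\<^sub>1 * c) = B" "exp (- 2 * \<zeta> \<omega>\<^sub>3 * \<alpha> + 2 * \<omega>\<^sub>3 * c) = C"
    using multipliers_exist[OF quasi_periodicD(1,2)[OF qp]] by blast
  show ?thesis
  proof (intro conjI allI impI ballI)
    show "(\<exists>\<alpha> \<kappa> b. \<alpha> \<notin> \<Omega> \<and> (\<forall>x. x \<notin> H \<longrightarrow> \<Lambda> x = form_a \<omega>\<^sub>1 \<omega>\<^sub>3 l M r \<alpha> \<kappa> b x)) \<or>
      (\<exists>\<kappa> c0 c b. \<forall>x. x \<notin> H \<longrightarrow> \<Lambda> x = form_b \<omega>\<^sub>1 \<omega>\<^sub>3 l M r \<kappa> c0 c b x)"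
    proof (cases "\<alpha> \<in> \<Omega>")
      case True
      obtain \<kappa> where "B = exp (2 * \<kappa> * \<omega>\<^sub>1)" "C = exp (2 * \<kappa> * \<omega>\<^sub>3)"
        using multipliers_lattice[OF True, of c] unfolding BC by blast
      from representation_b[OF Lambda_nice qp[unfolded this] Lambda_poles]
      show ?thesis unfolding form_b_def by blast
    next
      case False
      \<comment> \<open>\<open>multiplier \<alpha>\<close> already contains
        \<open>\<zeta> \<alpha>\<close> as the factor of twice the half period, so only the excess
        of c over it is left for \<kappa>.\<close>
      define \<kappa> where "\<kappa> = c - \<zeta> \<alpha>"
      have "B = exp (2 * \<kappa> * \<omega>\<^sub>1) * multiplier \<alpha> \<omega>\<^sub>1" "C = exp (2 * \<kappa> * \<omega>\<^sub>3) * multiplier \<alpha> \<omega>\<^sub>3"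
        unfolding BC[symmetric] multiplier_def exp_add[symmetric] \<kappa>_def by (simp_all add: algebra_simps)
      from representation_a[OF Lambda_nice False qp[unfolded this] Lambda_poles] False
      show ?thesis unfolding form_a_def by blast
    qed
  next
    fix \<alpha> \<kappa> b j x
    assume rep: "\<forall>x. x \<notin> H \<longrightarrow> \<Lambda> x = form_a \<omega>\<^sub>1 \<omega>\<^sub>3 l M r \<alpha> \<kappa> b x" and j: "j \<in> {1, 3 :: nat}"
    have "half_period j \<notin> \<Omega>" using j by (intro half_period_notin) auto
    from representation_a_shift[OF Lambda_nice rep[unfolded form_a_def, rule_format] half_period_double this]
    show "\<Lambda> (x + 2 * half_period j) = exp (- 2 * \<eta> \<omega>\<^sub>1 \<omega>\<^sub>3 j * \<alpha> + 2 * half_period j * \<zeta> \<alpha> +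
        2 * \<kappa> * half_period j) * \<Lambda> x"
      unfolding \<eta>_def .
  next
    fix \<kappa> c0 c b j x
    assume rep: "\<forall>x. x \<notin> H \<longrightarrow> \<Lambda> x = form_b \<omega>\<^sub>1 \<omega>\<^sub>3 l M r \<kappa> c0 c b x" and "j \<in> {1, 3 :: nat}"
    from representation_b_shift[OF Lambda_nice rep[unfolded form_b_def, rule_format] half_period_double]
    show "\<Lambda> (x + 2 * half_period j) = exp (2 * \<kappa> * half_period j) * \<Lambda> x" .
  qed
qed

end
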